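(* Let $\varphi\colon A\to B$ be a surjective cdga morphism with kernel $K=\ker\varphi$. Then $$\mathrm{nil}\,\ker H(\varphi)\le \mathrm{secat}(\varphi)\le \mathrm{Asecat}(\varphi)\le \mathrm{hnil}\,K\le \mathrm{nil}\,K,$$ and, if $H(\varphi)$ is surjective, $$\mathrm{nil}\,H(K)\le \mathrm{secat}(\varphi)\le \mathrm{hnil}\,K.$$
   Context: A cdga is a non-negatively graded commutative differential graded algebra over $\mathbb{Q}$, with differential of degree $+1$. All invariants below are $\infty$ when no integer with the required property exists. For an ideal $I$, $\mathrm{nil}\,I=\min\{k: I^{k+1}=0\}$. For an ideal $I$ of a cdga $A$, the homology nilpotency is $\mathrm{hnil}\,I=\min\{k: I^{k+1}\subset J \text{ for some acyclic ideal } J \text{ of } A\}$, where an acyclic ideal is a differential ideal $J$ with $H(J)=0$. When $H(\varphi)$ is surjective, $H(K)\to H(A)$ is injective and $H(K)$ is identified with the ideal $\ker H(\varphi)$ of $H(A)$. A relative Sullivan model of a cdga morphism $\psi\colon C\to E$ is the inclusion $i\colon C\to (C\otimes\Lambda V,D)$ of a relative Sullivan algebra together with a quasi-isomorphism $(C\otimes\Lambda V,D)\to E$ restricting to $\psi$ on $C$. The morphism $\psi$ admits a homotopy retraction if there is a cdga morphism $r\colon (C\otimes\Lambda V,D)\to C$ with $r\circ i=\mathrm{id}_C$. $\mathrm{secat}(\varphi)$ is the smallest $m$ for which there is a cdga morphism $\tau\colon (A^{\otimes m+1}\otimes\Lambda W_m,D)\to A$ with $\tau\circ i_m=\mu_{m+1}$,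 where $\mu_{m+1}\colon A^{\otimes m+1}\to A$ is the multiplication and $i_m\colon A^{\otimes m+1}\to (A^{\otimes m+1}\otimes\Lambda W_m,D)$ is a relative Sullivan model of the projection $q_m\colon A^{\otimes m+1}\to A^{\otimes m+1}/K^{\otimes m+1}$. $\mathrm{Asecat}(\varphi)$ is the smallest $m$ such that the projection $\rho_m\colon A\to A/K^{m+1}$ admits a homotopy retraction.
   Formalization: Assumes relative Sullivan models of all projections q_m and ρ_m exist, as the definitions of secat and Asecat presuppose; without this the chain can fail (A=ℚ[e]/e² in degree 0, B=ℚ: no q_m has a model, yet Asecat ≤ 1). *)

theory Defs
  imports
    "HOL-Algebra.Algebra"
    "HOL-Algebra.Algebraic_Closure_Type"
    "HOL-Library.Poly_Mapping"
    "HOL-Library.Extended_Nat"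
begin

section \<open>Graded vector spaces and cdgas over the rationals\<close>

abbreviation rat_field :: "rat ring"
  where "rat_field \<equiv> ring_of_type_algebra"

record 'a graded = "(rat, 'a) module" +
  hcomp :: "nat \<Rightarrow> 'a set"

record 'a dga = "'a graded" +
  diff :: "'a \<Rightarrow> 'a"

text \<open>For a graded vector space only the additive part, the scalars and the homogeneous components
  matter; the ring multiplication of the record is ignored.\<close>

locale graded_space = module rat_field M for M :: "('a, 'm) graded_scheme" (structure) +
  assumes hcomp_submodule: "submodule (hcomp M n) rat_field M"
    and direct_sum: "x \<in> carrier M \<Longrightarrow>
      \<exists>!f. (\<forall>n. f n \<in> hcomp M n) \<and> finite {n. f n \<noteq> \<zero>} \<and> x = (\<Oplus>n\<in>{n. f n \<noteq> \<zero>}. f n)"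

definition decomp :: "('a, 'm) graded_scheme \<Rightarrow> 'a \<Rightarrow> nat \<Rightarrow> 'a"
  where "decomp M x = (THE f. (\<forall>n. f n \<in> hcomp M n) \<and> finite {n. f n \<noteq> \<zero>\<^bsub>M\<^esub>} \<and>
    x = (\<Oplus>\<^bsub>M\<^esub>n\<in>{n. f n \<noteq> \<zero>\<^bsub>M\<^esub>}. f n))"

locale cdga = graded_space A + ring A for A :: "('a, 'm) dga_scheme" (structure) +
  assumes smult_mult_left: "\<lbrakk>x \<in> carrier A; y \<in> carrier A\<rbrakk> \<Longrightarrow> (q \<odot> x) \<otimes> y = q \<odot> (x \<otimes> y)"
    and smult_mult_right: "\<lbrakk>x \<in> carrier A; y \<in> carrier A\<rbrakk> \<Longrightarrow> x \<otimes> (q \<odot> y) = q \<odot> (x \<otimes> y)"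
    and one_hcomp: "\<one> \<in> hcomp A 0"
    and mult_hcomp: "\<lbrakk>x \<in> hcomp A m; y \<in> hcomp A n\<rbrakk> \<Longrightarrow> x \<otimes> y \<in> hcomp A (m + n)"
    and graded_comm: "\<lbrakk>x \<in> hcomp A m; y \<in> hcomp A n\<rbrakk> \<Longrightarrow> x \<otimes> y = (- 1) ^ (m * n) \<odot> (y \<otimes> x)"
    and diff_add: "\<lbrakk>x \<in> carrier A; y \<in> carrier A\<rbrakk> \<Longrightarrow> diff A (x \<oplus> y) = diff A x \<oplus> diff A y"
    and diff_smult: "x \<in> carrier A \<Longrightarrow> diff A (q \<odot> x) = q \<odot> diff A x"
    and diff_hcomp: "x \<in> hcomp A n \<Longrightarrow> diff A x \<in> hcomp A (Suc n)"
    and diff_diff: "x \<in> carrier A \<Longrightarrow> diff A (diff A x) = \<zero>"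
    and diff_mult: "\<lbrakk>x \<in> hcomp A m; y \<in> hcomp A n\<rbrakk> \<Longrightarrow>
      diff A (x \<otimes> y) = (diff A x \<otimes> y) \<oplus> ((- 1) ^ m \<odot> (x \<otimes> diff A y))"

definition cdga_hom :: "('a, 'm) dga_scheme \<Rightarrow> ('b, 'n) dga_scheme \<Rightarrow> ('a \<Rightarrow> 'b) set"
  where "cdga_hom A B = {h \<in> ring_hom A B.
    (\<forall>q. \<forall>x\<in>carrier A. h (q \<odot>\<^bsub>A\<^esub> x) = q \<odot>\<^bsub>B\<^esub> h x) \<and>
    (\<forall>n. h ` hcomp A n \<subseteq> hcomp B n) \<and>
    (\<forall>x\<in>carrier A. h (diff A x) = diff B (h x))}"

inductive_set lin_span :: "(rat, 'a, 'm) module_scheme \<Rightarrow> 'a set \<Rightarrow> 'a set"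
  for M and S where
    zero: "\<zero>\<^bsub>M\<^esub> \<in> lin_span M S"
  | step: "\<lbrakk>x \<in> S; y \<in> lin_span M S\<rbrakk> \<Longrightarrow> (q \<odot>\<^bsub>M\<^esub> x) \<oplus>\<^bsub>M\<^esub> y \<in> lin_span M S"

section \<open>Quotients and cohomology\<close>

text \<open>The map on cosets induced by a function that is constant on each coset.\<close>

definition on_cosets :: "('a \<Rightarrow> 'b) \<Rightarrow> 'a set \<Rightarrow> 'b"
  where "on_cosets h S = the_elem (h ` S)"

definition graded_quot :: "('a, 'm) graded_scheme \<Rightarrow> 'a set \<Rightarrow> 'a set graded"
  where "graded_quot A I =
    \<lparr>carrier = carrier (A Quot I), monoid.mult = monoid.mult (A Quot I), one = one (A Quot I),
     ring.zero = ring.zero (A Quot I), add = add (A Quot I),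
     module.smult = (\<lambda>q. on_cosets (\<lambda>x. I +>\<^bsub>A\<^esub> (q \<odot>\<^bsub>A\<^esub> x))),
     hcomp = (\<lambda>n. (\<lambda>x. I +>\<^bsub>A\<^esub> x) ` hcomp A n)\<rparr>"

definition with_diff :: "'a graded \<Rightarrow> ('a \<Rightarrow> 'a) \<Rightarrow> 'a dga"
  where "with_diff G D = graded.extend G (dga.fields D)"

definition dga_quot :: "('a, 'm) dga_scheme \<Rightarrow> 'a set \<Rightarrow> 'a set dga"
  where "dga_quot A I = with_diff (graded_quot A I) (on_cosets (\<lambda>x. I +>\<^bsub>A\<^esub> diff A x))"

definition restrict_to :: "('a, 'm) dga_scheme \<Rightarrow> 'a set \<Rightarrow> ('a, 'm) dga_scheme"
  where "restrict_to A S = A\<lparr>carrier := S, hcomp := (\<lambda>n. hcomp A n \<inter> S)\<rparr>"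

definition cocycles :: "('a, 'm) dga_scheme \<Rightarrow> 'a set"
  where "cocycles A = {x \<in> carrier A. diff A x = \<zero>\<^bsub>A\<^esub>}"

definition boundaries :: "('a, 'm) dga_scheme \<Rightarrow> 'a set"
  where "boundaries A = diff A ` carrier A"

text \<open>For a differential ideal \<open>J\<close> of \<open>A\<close>, \<open>cohomology (restrict_to A J)\<close> is \<open>H(J)\<close>; it is closed
  under the multiplication, but the \<open>one\<close> field is meaningless there.\<close>

definition cohomology :: "('a, 'm) dga_scheme \<Rightarrow> 'a set graded"
  where "cohomology A = graded_quot (restrict_to A (cocycles A)) (boundaries A)"

definition cohomology_map ::
    "('a, 'm) dga_scheme \<Rightarrow> ('b, 'n) dga_scheme \<Rightarrow> ('a \<Rightarrow> 'b) \<Rightarrow> 'a set \<Rightarrow> 'b set"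
  where "cohomology_map A B h = on_cosets (\<lambda>x. boundaries B +>\<^bsub>B\<^esub> h x)"

definition quasi_iso :: "('a, 'm) dga_scheme \<Rightarrow> ('b, 'n) dga_scheme \<Rightarrow> ('a \<Rightarrow> 'b) \<Rightarrow> bool"
  where "quasi_iso A B h \<longleftrightarrow> h \<in> cdga_hom A B \<and>
    bij_betw (cohomology_map A B h) (carrier (cohomology A)) (carrier (cohomology B))"

section \<open>Nilpotency\<close>

text \<open>Setting \<open>I\<^sup>1 = I\<close> (rather than \<open>R \<cdot> I\<close>) lets this be used in rings without unit, such as
  \<open>H(K)\<close> regarded as an ideal of itself.\<close>

fun ideal_power :: "('a, 'm) ring_scheme \<Rightarrow> 'a set \<Rightarrow> nat \<Rightarrow> 'a set"
  where
    "ideal_power R I 0 = carrier R"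
  | "ideal_power R I (Suc 0) = I"
  | "ideal_power R I (Suc (Suc n)) = ideal_prod R (ideal_power R I (Suc n)) I"

definition nil :: "('a, 'm) ring_scheme \<Rightarrow> 'a set \<Rightarrow> enat"
  where "nil R I = Inf {enat k |k. ideal_power R I (k + 1) = {\<zero>\<^bsub>R\<^esub>}}"

text \<open>Ideals of a graded algebra are homogeneous.\<close>

definition differential_ideal :: "('a, 'm) dga_scheme \<Rightarrow> 'a set \<Rightarrow> bool"
  where "differential_ideal A J \<longleftrightarrow> ideal J A \<and>
    (\<forall>x\<in>J. \<forall>n. decomp A x n \<in> J) \<and> diff A ` J \<subseteq> J"

definition acyclic_ideal :: "('a, 'm) dga_scheme \<Rightarrow> 'a set \<Rightarrow> bool"
  where "acyclic_ideal A J \<longleftrightarrow> differential_ideal A J \<and>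
    carrier (cohomology (restrict_to A J)) = {\<zero>\<^bsub>cohomology (restrict_to A J)\<^esub>}"

definition hnil :: "('a, 'm) dga_scheme \<Rightarrow> 'a set \<Rightarrow> enat"
  where "hnil A I = Inf {enat k |k. \<exists>J. acyclic_ideal A J \<and> ideal_power A I (k + 1) \<subseteq> J}"

section \<open>Algebras presented by words\<close>

text \<open>The vector space with basis \<open>B\<close>, whose multiplication and grading are the linear
  extensions of the given data on basis elements (words); the product of words \<open>u\<close> and \<open>v\<close>
  is \<open>sg u v\<close> times the word \<open>prd u v\<close>.  Tensor powers and \<open>C \<otimes> \<Lambda>V\<close> are quotients of such spaces.
  Every letter \<open>(p, a)\<close> of a word is a homogeneous element \<open>a\<close> together with its degree \<open>p\<close>.\<close>

definition word_space :: "'g set \<Rightarrow> ('g \<Rightarrow> 'g \<Rightarrow> 'g) \<Rightarrow> ('g \<Rightarrow> 'g \<Rightarrow> rat) \<Rightarrow> 'g \<Rightarrow> ('g \<Rightarrow> nat) \<Rightarrow>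
    ('g \<Rightarrow>\<^sub>0 rat) graded"
  where "word_space B prd sg e dg =
    \<lparr>carrier = {f. Poly_Mapping.keys f \<subseteq> B},
     monoid.mult = (\<lambda>f g. \<Sum>u\<in>Poly_Mapping.keys f. \<Sum>v\<in>Poly_Mapping.keys g.
       Poly_Mapping.single (prd u v) (sg u v * (Poly_Mapping.lookup f u * Poly_Mapping.lookup g v))),
     one = Poly_Mapping.single e 1,
     ring.zero = 0,
     add = (+),
     module.smult = (\<lambda>q. Poly_Mapping.map ((*) q)),
     hcomp = (\<lambda>n. {f. Poly_Mapping.keys f \<subseteq> {u \<in> B. dg u = n}})\<rparr>"

section \<open>Tensor powers\<close>

type_synonym 'a letter = "nat \<times> 'a"
type_synonym 'a tensor = "('a letter list \<Rightarrow>\<^sub>0 rat) set"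

definition tensor_words :: "('a, 'm) dga_scheme \<Rightarrow> nat \<Rightarrow> 'a letter list set"
  where "tensor_words A n = {u. length u = n \<and> (\<forall>(p, a)\<in>set u. a \<in> hcomp A p)}"

definition tensor_word_diff :: "('a, 'm) dga_scheme \<Rightarrow> 'a letter list \<Rightarrow> ('a letter list \<Rightarrow>\<^sub>0 rat)"
  where "tensor_word_diff A u = (\<Sum>i<length u. Poly_Mapping.single
    (u[i := (Suc (fst (u ! i)), diff A (snd (u ! i)))]) ((- 1) ^ (\<Sum>j<i. fst (u ! j))))"

definition tensor_space :: "('a, 'm) dga_scheme \<Rightarrow> nat \<Rightarrow> ('a letter list \<Rightarrow>\<^sub>0 rat) dga"
  where "tensor_space A n = with_diff
    (word_space (tensor_words A n)
      (map2 (\<lambda>(p, a) (q, b). (p + q, a \<otimes>\<^bsub>A\<^esub> b)))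
      (\<lambda>u v. (- 1) ^ (\<Sum>i<length u. \<Sum>j<i. fst (u ! i) * fst (v ! j)))
      (replicate n (0, \<one>\<^bsub>A\<^esub>))
      (\<lambda>u. sum_list (map fst u)))
    (\<lambda>f. \<Sum>u\<in>Poly_Mapping.keys f.
      Poly_Mapping.map ((*) (Poly_Mapping.lookup f u)) (tensor_word_diff A u))"

definition tensor_rels :: "('a, 'm) dga_scheme \<Rightarrow> nat \<Rightarrow> ('a letter list \<Rightarrow>\<^sub>0 rat) set"
  where "tensor_rels A n = lin_span (tensor_space A n)
    {Poly_Mapping.single (u @ (p, (s \<odot>\<^bsub>A\<^esub> a) \<oplus>\<^bsub>A\<^esub> (t \<odot>\<^bsub>A\<^esub> b)) # v) 1
       - Poly_Mapping.single (u @ (p, a) # v) s - Poly_Mapping.single (u @ (p, b) # v) t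
     |u v p a b s t. u @ (p, a) # v \<in> tensor_words A n \<and> u @ (p, b) # v \<in> tensor_words A n}"

definition tensor_power :: "('a, 'm) dga_scheme \<Rightarrow> nat \<Rightarrow> 'a tensor dga"
  where "tensor_power A n = dga_quot (tensor_space A n) (tensor_rels A n)"

definition pure_tensor :: "('a, 'm) dga_scheme \<Rightarrow> 'a letter list \<Rightarrow> 'a tensor"
  where "pure_tensor A u =
    tensor_rels A (length u) +>\<^bsub>tensor_space A (length u)\<^esub> Poly_Mapping.single u 1"

text \<open>The image of \<open>K\<^sup>\<otimes>\<^sup>n\<close> in the \<open>n\<close>-th tensor power of \<open>A\<close>, for a graded subspace \<open>K\<close>.\<close>

definition tensor_power_sub :: "('a, 'm) dga_scheme \<Rightarrow> 'a set \<Rightarrow> nat \<Rightarrow> 'a tensor set"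
  where "tensor_power_sub A K n = lin_span (tensor_power A n)
    {pure_tensor A u |u. u \<in> tensor_words A n \<and> (\<forall>(p, a)\<in>set u. a \<in> K)}"

definition tensor_mult :: "('a, 'm) dga_scheme \<Rightarrow> 'a tensor \<Rightarrow> 'a"
  where "tensor_mult A = on_cosets (\<lambda>f. \<Oplus>\<^bsub>A\<^esub>u\<in>Poly_Mapping.keys f.
    Poly_Mapping.lookup f u \<odot>\<^bsub>A\<^esub> foldr (\<lambda>(p, a) b. a \<otimes>\<^bsub>A\<^esub> b) u \<one>\<^bsub>A\<^esub>)"

section \<open>Relative Sullivan algebras\<close>

text \<open>A word \<open>(c, [v\<^sub>1, \<dots>, v\<^sub>k])\<close> stands for \<open>c \<otimes> v\<^sub>1 \<cdots> v\<^sub>k\<close>.\<close>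

type_synonym ('c, 'v) ext_word = "'c letter \<times> 'v letter list"
type_synonym ('c, 'v) ext = "(('c, 'v) ext_word \<Rightarrow>\<^sub>0 rat) set"

definition ext_words ::
    "('c, 'm) dga_scheme \<Rightarrow> (nat \<Rightarrow> 'v set) \<Rightarrow> ('c, 'v) ext_word set"
  where "ext_words C U = {((p, c), u). c \<in> hcomp C p \<and> (\<forall>(q, v)\<in>set u. v \<in> U q)}"

definition ext_space ::
    "('c, 'm) dga_scheme \<Rightarrow> 'v graded \<Rightarrow> (('c, 'v) ext_word \<Rightarrow>\<^sub>0 rat) graded"
  where "ext_space C V = word_space (ext_words C (hcomp V))
    (\<lambda>((p, c), u) ((p', c'), u'). ((p + p', c \<otimes>\<^bsub>C\<^esub> c'), u @ u'))
    (\<lambda>((p, c), u) ((p', c'), u'). (- 1) ^ (sum_list (map fst u) * p'))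
    ((0, \<one>\<^bsub>C\<^esub>), [])
    (\<lambda>((p, c), u). p + sum_list (map fst u))"

text \<open>Multilinearity in all slots and graded commutativity of the letters from \<open>V\<close>.\<close>

definition ext_rels :: "('c, 'm) dga_scheme \<Rightarrow> 'v graded \<Rightarrow> (('c, 'v) ext_word \<Rightarrow>\<^sub>0 rat) set"
  where "ext_rels C V = lin_span (ext_space C V)
    ({Poly_Mapping.single ((p, (s \<odot>\<^bsub>C\<^esub> c) \<oplus>\<^bsub>C\<^esub> (t \<odot>\<^bsub>C\<^esub> c')), u) 1
       - Poly_Mapping.single ((p, c), u) s - Poly_Mapping.single ((p, c'), u) t
      |p c c' s t u. ((p, c), u) \<in> ext_words C (hcomp V) \<and> ((p, c'), u) \<in> ext_words C (hcomp V)} \<union>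
     {Poly_Mapping.single (c, u @ (q, (s \<odot>\<^bsub>V\<^esub> v) \<oplus>\<^bsub>V\<^esub> (t \<odot>\<^bsub>V\<^esub> v')) # w) 1
       - Poly_Mapping.single (c, u @ (q, v) # w) s - Poly_Mapping.single (c, u @ (q, v') # w) t
      |c u q v v' s t w. (c, u @ (q, v) # w) \<in> ext_words C (hcomp V) \<and>
        (c, u @ (q, v') # w) \<in> ext_words C (hcomp V)} \<union>
     {Poly_Mapping.single (c, u @ (q, v) # (q', v') # w) 1
       - Poly_Mapping.single (c, u @ (q', v') # (q, v) # w) ((- 1) ^ (q * q'))
      |c u q v q' v' w. (c, u @ (q, v) # (q', v') # w) \<in> ext_words C (hcomp V)})"

definition ext_class ::
    "('c, 'm) dga_scheme \<Rightarrow> 'v graded \<Rightarrow> (('c, 'v) ext_word \<Rightarrow>\<^sub>0 rat) \<Rightarrow> ('c, 'v) ext"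
  where "ext_class C V f = ext_rels C V +>\<^bsub>ext_space C V\<^esub> f"

text \<open>\<open>(C \<otimes> \<Lambda>V, D)\<close>\<close>

definition ext_dga ::
    "('c, 'm) dga_scheme \<Rightarrow> 'v graded \<Rightarrow> (('c, 'v) ext \<Rightarrow> ('c, 'v) ext) \<Rightarrow> ('c, 'v) ext dga"
  where "ext_dga C V D = with_diff (graded_quot (ext_space C V) (ext_rels C V)) D"

definition ext_incl :: "('c, 'm) dga_scheme \<Rightarrow> 'v graded \<Rightarrow> 'c \<Rightarrow> ('c, 'v) ext"
  where "ext_incl C V c = ext_class C V
    (\<Sum>p\<in>{p. decomp C c p \<noteq> \<zero>\<^bsub>C\<^esub>}. Poly_Mapping.single ((p, decomp C c p), []) 1)"

definition ext_gen :: "('c, 'm) dga_scheme \<Rightarrow> 'v graded \<Rightarrow> nat \<Rightarrow> 'v \<Rightarrow> ('c, 'v) ext"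
  where "ext_gen C V q v = ext_class C V (Poly_Mapping.single ((0, \<one>\<^bsub>C\<^esub>), [(q, v)]) 1)"

text \<open>The subalgebra \<open>C \<otimes> \<Lambda>U\<close> for a graded subspace \<open>U\<close> of \<open>V\<close>.\<close>

definition ext_sub :: "('c, 'm) dga_scheme \<Rightarrow> 'v graded \<Rightarrow> (nat \<Rightarrow> 'v set) \<Rightarrow> ('c, 'v) ext set"
  where "ext_sub C V U = ext_class C V ` {f. Poly_Mapping.keys f \<subseteq> ext_words C U}"

text \<open>\<open>F k\<close> is the family of homogeneous components of the graded subspace \<open>V(k)\<close>.  Generators of
  degree \<open>0\<close> are allowed and \<open>H\<^sup>0(C) = \<rat>\<close> is not required.\<close>

definition relative_sullivan ::
    "('c, 'm) dga_scheme \<Rightarrow> 'v graded \<Rightarrow> (('c, 'v) ext \<Rightarrow> ('c, 'v) ext) \<Rightarrow> bool"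
  where "relative_sullivan C V D \<longleftrightarrow>
    cdga C \<and> graded_space V \<and> cdga (ext_dga C V D) \<and> ext_incl C V \<in> cdga_hom C (ext_dga C V D) \<and>
    (\<exists>F. (\<forall>k q. submodule (F k q) rat_field V \<and> F k q \<subseteq> F (Suc k) q) \<and>
      (\<forall>q. hcomp V q = (\<Union>k. F k q)) \<and>
      (\<forall>q. \<forall>v\<in>F 0 q. D (ext_gen C V q v) \<in> ext_incl C V ` carrier C) \<and>
      (\<forall>k q. \<forall>v\<in>F (Suc k) q. D (ext_gen C V q v) \<in> ext_sub C V (F k)))"

definition relative_sullivan_model :: "('c, 'm) dga_scheme \<Rightarrow> ('e, 'n) dga_scheme \<Rightarrow> ('c \<Rightarrow> 'e) \<Rightarrow>
    'v graded \<Rightarrow> (('c, 'v) ext \<Rightarrow> ('c, 'v) ext) \<Rightarrow> (('c, 'v) ext \<Rightarrow> 'e) \<Rightarrow> bool"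
  where "relative_sullivan_model C E \<psi> V D \<pi> \<longleftrightarrow>
    relative_sullivan C V D \<and> quasi_iso (ext_dga C V D) E \<pi> \<and>
    (\<forall>c\<in>carrier C. \<pi> (ext_incl C V c) = \<psi> c)"

text \<open>The type argument is the ambient type of the generating spaces \<open>V\<close>: HOL cannot quantify over
  types inside a formula.  By the lifting property of relative Sullivan algebras, the retraction and
  the morphism \<open>\<tau>\<close> below exist for one relative Sullivan model if and only if they exist for every
  one, so the invariants do not depend on this type as long as models with such \<open>V\<close> exist.\<close>

definition has_relative_sullivan_model ::
    "'v itself \<Rightarrow> ('c, 'm) dga_scheme \<Rightarrow> ('e, 'n) dga_scheme \<Rightarrow> ('c \<Rightarrow> 'e) \<Rightarrow> bool"
  where "has_relative_sullivan_model _ C E \<psi> \<longleftrightarrow>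
    (\<exists>(V :: 'v graded) D \<pi>. relative_sullivan_model C E \<psi> V D \<pi>)"

definition homotopy_retraction ::
    "'v itself \<Rightarrow> ('c, 'm) dga_scheme \<Rightarrow> ('e, 'n) dga_scheme \<Rightarrow> ('c \<Rightarrow> 'e) \<Rightarrow> bool"
  where "homotopy_retraction _ C E \<psi> \<longleftrightarrow>
    (\<exists>(V :: 'v graded) D \<pi>. relative_sullivan_model C E \<psi> V D \<pi> \<and>
      (\<exists>r\<in>cdga_hom (ext_dga C V D) C. \<forall>c\<in>carrier C. r (ext_incl C V c) = c))"

section \<open>Sectional category\<close>

text \<open>For a kernel \<open>K\<close>: the projections \<open>q\<^sub>m\<close> and \<open>\<rho>\<^sub>m\<close> and their codomains.\<close>

definition secat_quot :: "('a, 'm) dga_scheme \<Rightarrow> 'a set \<Rightarrow> nat \<Rightarrow> 'a tensor set dga"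
  where "secat_quot A K m = dga_quot (tensor_power A (m + 1)) (tensor_power_sub A K (m + 1))"

definition secat_proj :: "('a, 'm) dga_scheme \<Rightarrow> 'a set \<Rightarrow> nat \<Rightarrow> 'a tensor \<Rightarrow> 'a tensor set"
  where "secat_proj A K m x = tensor_power_sub A K (m + 1) +>\<^bsub>tensor_power A (m + 1)\<^esub> x"

definition Asecat_quot :: "('a, 'm) dga_scheme \<Rightarrow> 'a set \<Rightarrow> nat \<Rightarrow> 'a set dga"
  where "Asecat_quot A K m = dga_quot A (ideal_power A K (m + 1))"

definition Asecat_proj :: "('a, 'm) dga_scheme \<Rightarrow> 'a set \<Rightarrow> nat \<Rightarrow> 'a \<Rightarrow> 'a set"
  where "Asecat_proj A K m x = ideal_power A K (m + 1) +>\<^bsub>A\<^esub> x"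

definition secat :: "'v itself \<Rightarrow> ('a, 'm) dga_scheme \<Rightarrow> ('b, 'n) dga_scheme \<Rightarrow> ('a \<Rightarrow> 'b) \<Rightarrow> enat"
  where "secat _ A B \<phi> = Inf {enat m |m. \<exists>(W :: 'v graded) D \<pi>.
    relative_sullivan_model (tensor_power A (m + 1)) (secat_quot A (a_kernel A B \<phi>) m)
      (secat_proj A (a_kernel A B \<phi>) m) W D \<pi> \<and>
    (\<exists>\<tau>\<in>cdga_hom (ext_dga (tensor_power A (m + 1)) W D) A.
      \<forall>x\<in>carrier (tensor_power A (m + 1)).
        \<tau> (ext_incl (tensor_power A (m + 1)) W x) = tensor_mult A x)}"

definition Asecat :: "'v itself \<Rightarrow> ('a, 'm) dga_scheme \<Rightarrow> ('b, 'n) dga_scheme \<Rightarrow> ('a \<Rightarrow> 'b) \<Rightarrow> enat"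
  where "Asecat T A B \<phi> = Inf {enat m |m.
    homotopy_retraction T A (Asecat_quot A (a_kernel A B \<phi>) m) (Asecat_proj A (a_kernel A B \<phi>) m)}"

end

theory Submission
  imports Defs
begin

text \<open>
  All five inequalities compare the existence of certain acyclic ideals, retractions and boundaries
  for a fixed number \<open>m\<close>; only two mechanisms are at work.

  \<^bold>\<open>Lifting.\<close>  Let \<open>C \<rightarrow> C \<otimes> \<Lambda>V\<close> be a relative Sullivan algebra and let \<open>p : E \<rightarrow> Q\<close> be such that every
  cocycle \<open>e\<close> of \<open>E\<close> with \<open>p e = d y\<close> equals \<open>d x\<close> for some \<open>x\<close> over \<open>y\<close> (\<open>lifts_cocycles\<close>).  Then a
  commutative square from \<open>C \<rightarrow> C \<otimes> \<Lambda>V\<close> to \<open>p\<close> has a diagonal (\<open>relative_sullivan_lift\<close>).  The map is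
  built along the filtration of \<open>V\<close>: on \<open>V(k+1)\<close> the element \<open>D v\<close> lies in \<open>C \<otimes> \<Lambda>V(k)\<close>, so its image
  is a known cocycle, and \<open>p\<close> provides a primitive, chosen linearly in \<open>v\<close> by \<open>linear_selection\<close>.
  Two maps have the property: \<open>A \<rightarrow> A/J\<close> for an acyclic ideal \<open>J\<close>, and the model
  \<open>A \<otimes> \<Lambda>V \<rightarrow> A/K\<^bsup>m+1\<^esup>\<close>, which is a surjective quasi-isomorphism because \<open>A\<close> already maps onto the
  quotient.

  If \<open>K\<^bsup>m+1\<^esup> \<subseteq> J\<close> with \<open>J\<close> acyclic, then lifting \<open>A \<otimes> \<Lambda>V \<rightarrow> A/K\<^bsup>m+1\<^esup> \<rightarrow> A/J\<close> through \<open>A \<rightarrow> A/J\<close> gives a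
  homotopy retraction, so \<open>Asecat \<le> hnil\<close>.  The zero ideal is acyclic, so \<open>hnil \<le> nil\<close>.  The
  multiplication \<open>\<mu>\<close> is a morphism (\<open>tensor_mult_hom\<close>) and carries \<open>K\<^bsup>\<otimes>m+1\<^esup>\<close> into \<open>K\<^bsup>m+1\<^esup>\<close>; lifting
  the induced map between the quotients through \<open>A \<otimes> \<Lambda>V \<rightarrow> A/K\<^bsup>m+1\<^esup>\<close> and composing with a homotopy
  retraction gives \<open>\<tau>\<close>, so \<open>secat \<le> Asecat\<close>.

  \<^bold>\<open>Bounding.\<close>  For cocycles \<open>a\<^sub>0, \<dots>, a\<^sub>m\<close> in \<open>K\<close> the tensor \<open>a\<^sub>0 \<otimes> \<dots> \<otimes> a\<^sub>m\<close> vanishes in the quotient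
  by \<open>K\<^bsup>\<otimes>m+1\<^esup>\<close>, hence bounds in its model, and \<open>\<tau>\<close> maps it to \<open>a\<^sub>0 \<cdots> a\<^sub>m\<close>, which therefore bounds in
  \<open>A\<close> (\<open>letter_prod_boundary\<close>).  Since \<open>\<phi>\<close> is onto, every class in \<open>ker H(\<phi>)\<close> is represented by a
  cocycle of \<open>K\<close>; this proves \<open>nil (ker H(\<phi>)) \<le> secat\<close>.  If \<open>H(\<phi>)\<close> is onto, then an element of \<open>K\<close> that
  bounds in \<open>A\<close> bounds in \<open>K\<close> (\<open>kernel_boundary\<close>), so the same products vanish in \<open>H(K)\<close>.
\<close>

section \<open>Rational vector spaces, spans and cosets\<close>

lemma rat_field_simps [simp]:
  "carrier rat_field = UNIV" "ring.zero rat_field = 0" "one rat_field = 1"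
  "add rat_field = (+)" "monoid.mult rat_field = (*)"
  by (auto simp: ring_of_type_algebra_def)

lemma rat_field_cring: "cring rat_field"
  by (rule cring_from_type_algebra)

locale rat_module = module rat_field M for M (structure)

sublocale graded_space \<subseteq> rat_module M
  by (simp add: module_axioms rat_module_def)

context rat_module
begin

lemma smult_carrier [simp]: "x \<in> carrier M \<Longrightarrow> q \<odot> x \<in> carrier M"
  using smult_closed[of q x] by simp

lemma smult_add_left: "x \<in> carrier M \<Longrightarrow> (p + q) \<odot> x = p \<odot> x \<oplus> q \<odot> x"
  using smult_l_distr[of p q x] by simp

lemma smult_add_right: "x \<in> carrier M \<Longrightarrow> y \<in> carrier M \<Longrightarrow> q \<odot> (x \<oplus> y) = q \<odot> x \<oplus> q \<odot> y"
  using smult_r_distr[of q x y] by simp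

lemma smult_smult: "x \<in> carrier M \<Longrightarrow> p \<odot> (q \<odot> x) = (p * q) \<odot> x"
  using smult_assoc1[of p q x] by simp

lemma smult_1 [simp]: "x \<in> carrier M \<Longrightarrow> 1 \<odot> x = x"
  using smult_one[of x] by simp

lemma smult_0 [simp]: "x \<in> carrier M \<Longrightarrow> 0 \<odot> x = \<zero>"
  using smult_l_null[of x] by simp

lemma smult_zero [simp]: "q \<odot> \<zero> = \<zero>"
  using smult_r_null[of q] by simp

lemma smult_minus_1: "x \<in> carrier M \<Longrightarrow> (- 1) \<odot> x = \<ominus> x"
  by (metis M.add.inv_equality add.left_inverse smult_0 smult_1 smult_add_left smult_carrier)

lemma submodule_zero: "submodule N rat_field M \<Longrightarrow> \<zero> \<in> N"
  using subgroup.one_closed[OF submodule.axioms(1), of N rat_field M] by simp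

lemma submodule_subset: "submodule N rat_field M \<Longrightarrow> N \<subseteq> carrier M"
  using subgroup.subset[OF submodule.axioms(1), of N rat_field M] by simp

lemma submodule_add: "submodule N rat_field M \<Longrightarrow> x \<in> N \<Longrightarrow> y \<in> N \<Longrightarrow> x \<oplus> y \<in> N"
  using subgroup.m_closed[OF submodule.axioms(1), of N rat_field M x y] by simp

lemma submodule_smult: "submodule N rat_field M \<Longrightarrow> x \<in> N \<Longrightarrow> q \<odot> x \<in> N"
  using submodule.smult_closed[of N rat_field M q x] by simp

lemma submodule_minus: "submodule N rat_field M \<Longrightarrow> x \<in> N \<Longrightarrow> \<ominus> x \<in> N"
  by (metis smult_minus_1 submodule_smult submodule_subset subsetD)

lemma rat_submoduleI:
  assumes "N \<subseteq> carrier M" "\<zero> \<in> N" "\<And>x y. x \<in> N \<Longrightarrow> y \<in> N \<Longrightarrow> x \<oplus> y \<in> N"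
    "\<And>q x. x \<in> N \<Longrightarrow> q \<odot> x \<in> N"
  shows "submodule N rat_field M"
  using assms by (intro submoduleI) (auto simp: smult_minus_1[symmetric] subset_iff)

lemma submodule_finsum:
  assumes "submodule N rat_field M" "\<And>i. i \<in> S \<Longrightarrow> f i \<in> N"
  shows "(\<Oplus>i\<in>S. f i) \<in> N"
  using assms(2)
proof (induction S rule: infinite_finite_induct)
  case (insert i S)
  moreover have "f \<in> insert i S \<rightarrow> carrier M"
    using submodule_subset[OF assms(1)] insert by auto
  ultimately show ?case
    by (simp add: submodule_add[OF assms(1)])
qed (auto simp: submodule_zero[OF assms(1)] finsum_infinite)

lemma lin_span_subset_carrier:
  assumes "S \<subseteq> carrier M" shows "lin_span M S \<subseteq> carrier M"
proof
  fix x assume "x \<in> lin_span M S"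
  then show "x \<in> carrier M"
    by induction (use assms in auto)
qed

lemma lin_span_superset:
  assumes "S \<subseteq> carrier M" "x \<in> S" shows "x \<in> lin_span M S"
  using lin_span.step[OF assms(2) lin_span.zero, of M 1] assms by auto

lemma lin_span_add:
  assumes S: "S \<subseteq> carrier M" and x: "x \<in> lin_span M S" and y: "y \<in> lin_span M S"
  shows "x \<oplus> y \<in> lin_span M S"
  using x
proof induction
  case zero
  then show ?case using y lin_span_subset_carrier[OF S] by auto
next
  case (step x z q)
  moreover have "x \<in> carrier M" "y \<in> carrier M" "z \<in> carrier M"
    using step y S lin_span_subset_carrier[OF S] by auto
  ultimately show ?case
    by (simp add: M.a_assoc lin_span.step)
qed

lemma lin_span_smult:
  assumes S: "S \<subseteq> carrier M" and x: "x \<in> lin_span M S"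
  shows "q \<odot> x \<in> lin_span M S"
  using x
proof induction
  case zero
  then show ?case by (simp add: lin_span.zero)
next
  case (step x z p)
  moreover have "x \<in> carrier M" "z \<in> carrier M"
    using step S lin_span_subset_carrier[OF S] by auto
  ultimately show ?case
    by (simp add: smult_add_right smult_smult lin_span.step)
qed

lemma lin_span_submodule:
  assumes "S \<subseteq> carrier M" shows "submodule (lin_span M S) rat_field M"
  using lin_span_subset_carrier[OF assms] lin_span_add[OF assms] lin_span_smult[OF assms]
  by (intro rat_submoduleI) (auto intro: lin_span.zero)

lemma lin_span_least:
  assumes "submodule N rat_field M" "S \<subseteq> N"
  shows "lin_span M S \<subseteq> N"
proof
  fix x assume "x \<in> lin_span M S"
  then show "x \<in> N"
    by induction (use assms submodule_add submodule_smult submodule_zero in blast)+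
qed

lemma mem_coset_iff: "y \<in> N +> x \<longleftrightarrow> (\<exists>n\<in>N. y = n \<oplus> x)"
  by (auto simp: a_r_coset_def')

context
  fixes N
  assumes N: "submodule N rat_field M"
begin

lemma submodule_abelian_subgroup: "abelian_subgroup N M"
proof (rule abelian_subgroupI3)
  show "additive_subgroup N M"
    by (rule additive_subgroup.intro) (rule submodule.axioms(1)[OF N])
qed (rule M.abelian_group_axioms)

interpretation N: abelian_subgroup N M
  by (rule submodule_abelian_subgroup)

lemma coset_self: "x \<in> carrier M \<Longrightarrow> x \<in> N +> x"
  by (rule N.a_rcos_self)

lemma coset_shift: "n \<in> N \<Longrightarrow> x \<in> carrier M \<Longrightarrow> N +> (n \<oplus> x) = N +> x"
  by (metis mem_coset_iff N.a_repr_independence')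

lemma coset_eq_iff: "x \<in> carrier M \<Longrightarrow> y \<in> carrier M \<Longrightarrow> N +> x = N +> y \<longleftrightarrow> x \<ominus> y \<in> N"
proof -
  assume x: "x \<in> carrier M" and y: "y \<in> carrier M"
  show ?thesis
  proof
    assume "N +> x = N +> y"
    then obtain n where n: "n \<in> N" "x = n \<oplus> y"
      using coset_self[OF x] by (auto simp: mem_coset_iff)
    moreover have "n \<in> carrier M"
      using n submodule_subset[OF N] by auto
    ultimately show "x \<ominus> y \<in> N"
      using y by (simp add: a_minus_def M.a_assoc M.r_neg)
  next
    assume n: "x \<ominus> y \<in> N"
    have "x = (x \<ominus> y) \<oplus> y"
      using x y by (simp add: a_minus_def M.a_assoc M.l_neg)
    then show "N +> x = N +> y"
      using coset_shift[OF n y] by simp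
  qed
qed

lemma coset_zero: "N +> \<zero> = N"
  using a_coset_add_zero[OF submodule_subset[OF N]] .

lemma coset_eq_zero_iff: "x \<in> carrier M \<Longrightarrow> N +> x = N \<longleftrightarrow> x \<in> N"
  using coset_eq_iff[of x \<zero>] by (simp add: coset_zero a_minus_def smult_minus_1[symmetric])

lemma coset_add: "x \<in> carrier M \<Longrightarrow> y \<in> carrier M \<Longrightarrow> (N +> x) <+> (N +> y) = N +> (x \<oplus> y)"
  by (rule N.a_rcos_sum)

lemma on_cosets_eq:
  assumes "x \<in> carrier M" "\<And>n. n \<in> N \<Longrightarrow> h (n \<oplus> x) = h x"
  shows "on_cosets h (N +> x) = h x"
proof -
  have "h ` (N +> x) = {h x}"
    using assms coset_self[of x] by (fastforce simp: mem_coset_iff)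
  then show ?thesis
    by (simp add: on_cosets_def)
qed

end

end

lemma carrier_Quot: "carrier (A Quot I) = (\<lambda>x. I +>\<^bsub>A\<^esub> x) ` carrier A"
  by (auto simp: FactRing_def A_RCOSETS_def')

lemma graded_quot_simps [simp]:
  "carrier (graded_quot A I) = (\<lambda>x. I +>\<^bsub>A\<^esub> x) ` carrier A"
  "monoid.mult (graded_quot A I) = rcoset_mult A I"
  "one (graded_quot A I) = I +>\<^bsub>A\<^esub> \<one>\<^bsub>A\<^esub>"
  "ring.zero (graded_quot A I) = I"
  "add (graded_quot A I) = set_add A"
  "module.smult (graded_quot A I) q = on_cosets (\<lambda>x. I +>\<^bsub>A\<^esub> (q \<odot>\<^bsub>A\<^esub> x))"
  "hcomp (graded_quot A I) n = (\<lambda>x. I +>\<^bsub>A\<^esub> x) ` hcomp A n"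
  by (auto simp: graded_quot_def carrier_Quot) (simp_all add: FactRing_def)

lemma with_diff_simps [simp]:
  "carrier (with_diff G D) = carrier G"
  "monoid.mult (with_diff G D) = monoid.mult G"
  "one (with_diff G D) = one G"
  "ring.zero (with_diff G D) = ring.zero G"
  "add (with_diff G D) = add G"
  "module.smult (with_diff G D) = module.smult G"
  "hcomp (with_diff G D) = hcomp G"
  "diff (with_diff G D) = D"
  by (simp_all add: with_diff_def graded.extend_def dga.fields_def)

lemma restrict_to_simps [simp]:
  "carrier (restrict_to A S) = S"
  "monoid.mult (restrict_to A S) = monoid.mult A"
  "one (restrict_to A S) = one A"
  "ring.zero (restrict_to A S) = ring.zero A"
  "add (restrict_to A S) = add A"
  "module.smult (restrict_to A S) = module.smult A"
  "hcomp (restrict_to A S) n = hcomp A n \<inter> S"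
  "diff (restrict_to A S) = diff A"
  by (simp_all add: restrict_to_def)

lemma coset_cong_add: "add A = add B \<Longrightarrow> a_r_coset A = a_r_coset B"
  by (intro ext) (simp add: a_r_coset_def')

lemma coset_restrict_to [simp]: "a_r_coset (restrict_to A S) = a_r_coset A"
  by (rule coset_cong_add) simp

lemma coset_with_diff [simp]: "a_r_coset (with_diff G D) = a_r_coset G"
  by (rule coset_cong_add) simp

lemma set_add_restrict_to [simp]: "set_add (restrict_to A S) = set_add A"
  by (intro ext) (simp add: set_add_def')

lemma rcoset_mult_restrict_to [simp]: "rcoset_mult (restrict_to A S) = rcoset_mult A"
  by (intro ext) (simp add: rcoset_mult_def)

lemma dga_quot_simps [simp]:
  "carrier (dga_quot A I) = (\<lambda>x. I +>\<^bsub>A\<^esub> x) ` carrier A"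
  "monoid.mult (dga_quot A I) = rcoset_mult A I"
  "one (dga_quot A I) = I +>\<^bsub>A\<^esub> \<one>\<^bsub>A\<^esub>"
  "ring.zero (dga_quot A I) = I"
  "add (dga_quot A I) = set_add A"
  "module.smult (dga_quot A I) q = on_cosets (\<lambda>x. I +>\<^bsub>A\<^esub> (q \<odot>\<^bsub>A\<^esub> x))"
  "hcomp (dga_quot A I) n = (\<lambda>x. I +>\<^bsub>A\<^esub> x) ` hcomp A n"
  "diff (dga_quot A I) = on_cosets (\<lambda>x. I +>\<^bsub>A\<^esub> diff A x)"
  by (simp_all add: dga_quot_def)

lemma cohomology_simps [simp]:
  "carrier (cohomology A) = (\<lambda>x. boundaries A +>\<^bsub>A\<^esub> x) ` cocycles A"
  "monoid.mult (cohomology A) = rcoset_mult A (boundaries A)"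
  "ring.zero (cohomology A) = boundaries A"
  "add (cohomology A) = set_add A"
  by (simp_all add: cohomology_def)

lemma (in rat_module) coset_smult:
  assumes "submodule N rat_field M" "x \<in> carrier M"
  shows "on_cosets (\<lambda>x. N +> (q \<odot> x)) (N +> x) = N +> (q \<odot> x)"
proof (intro on_cosets_eq assms)
  fix n assume "n \<in> N"
  then show "N +> q \<odot> (n \<oplus> x) = N +> q \<odot> x"
    using assms subsetD[OF submodule_subset[OF assms(1)]]
    by (simp add: smult_add_right submodule_smult coset_shift)
qed

lemma (in rat_module) quot_diff:
  assumes N: "submodule N rat_field M" and x: "x \<in> carrier M"
    and d: "\<And>x. x \<in> carrier M \<Longrightarrow> d x \<in> carrier M"
      "\<And>x y. x \<in> carrier M \<Longrightarrow> y \<in> carrier M \<Longrightarrow> d (x \<oplus> y) = d x \<oplus> d y"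
      "\<And>x. x \<in> N \<Longrightarrow> d x \<in> N"
  shows "on_cosets (\<lambda>x. N +> d x) (N +> x) = N +> d x"
proof (intro on_cosets_eq N x)
  fix n assume "n \<in> N"
  then show "N +> d (n \<oplus> x) = N +> d x"
    using x d subsetD[OF submodule_subset[OF N]] by (simp add: coset_shift[OF N])
qed

lemma image_eq_singletonI: "(\<And>x. x \<in> S \<Longrightarrow> f x = c) \<Longrightarrow> y \<in> S \<Longrightarrow> f ` S = {c}"
  by auto

lemma rcoset_mult_eqI:
  assumes "\<And>a b. a \<in> U \<Longrightarrow> b \<in> V \<Longrightarrow> I +>\<^bsub>A\<^esub> (a \<otimes>\<^bsub>A\<^esub> b) = Z" "U \<noteq> {}" "V \<noteq> {}"
  shows "rcoset_mult A I U V = Z"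
  unfolding rcoset_mult_def using assms by auto

section \<open>Homogeneous components\<close>

context graded_space
begin

lemma hcomp_carrier [intro]: "x \<in> hcomp M n \<Longrightarrow> x \<in> carrier M"
  using submodule_subset[OF hcomp_submodule] by auto

lemma hcomp_zero [simp]: "\<zero> \<in> hcomp M n"
  by (rule submodule_zero[OF hcomp_submodule])

lemma hcomp_add: "x \<in> hcomp M n \<Longrightarrow> y \<in> hcomp M n \<Longrightarrow> x \<oplus> y \<in> hcomp M n"
  by (rule submodule_add[OF hcomp_submodule])

lemma hcomp_smult: "x \<in> hcomp M n \<Longrightarrow> q \<odot> x \<in> hcomp M n"
  by (rule submodule_smult[OF hcomp_submodule])

lemma
  assumes "x \<in> carrier M"
  shows decomp_hcomp: "decomp M x n \<in> hcomp M n"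
    and decomp_finite: "finite {n. decomp M x n \<noteq> \<zero>}"
    and decomp_sum: "x = (\<Oplus>n\<in>{n. decomp M x n \<noteq> \<zero>}. decomp M x n)"
  using theI'[OF direct_sum[OF assms]] unfolding decomp_def[symmetric] by blast+

lemma decomp_carrier [simp]: "x \<in> carrier M \<Longrightarrow> decomp M x n \<in> carrier M"
  using decomp_hcomp by blast

lemma finsum_support:
  assumes "finite S" "{n. f n \<noteq> \<zero>} \<subseteq> S" "\<And>n. f n \<in> carrier M"
  shows "(\<Oplus>n\<in>{n. f n \<noteq> \<zero>}. f n) = (\<Oplus>n\<in>S. f n)"
  using assms by (intro add.finprod_mono_neutral_cong_left) auto

lemma decomp_unique:
  assumes "finite S" "{n. f n \<noteq> \<zero>} \<subseteq> S" "\<And>n. f n \<in> hcomp M n" "x = (\<Oplus>n\<in>S. f n)"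
  shows "decomp M x = f"
proof -
  have fin: "finite {n. f n \<noteq> \<zero>}"
    using assms finite_subset by blast
  have x: "x = (\<Oplus>n\<in>{n. f n \<noteq> \<zero>}. f n)"
    unfolding assms(4) by (rule finsum_support[symmetric]) (use assms in auto)
  have "x \<in> carrier M"
    using assms by (auto intro!: finsum_closed)
  from direct_sum[OF this] show ?thesis
    unfolding decomp_def by (rule the1_equality) (use assms fin x in blast)
qed

lemma decomp_homogeneous:
  assumes "x \<in> hcomp M n"
  shows "decomp M x m = (if m = n then x else \<zero>)"
proof -
  have "decomp M x = (\<lambda>m. if m = n then x else \<zero>)"
  proof (rule decomp_unique[of "{n}"])
    show "x = (\<Oplus>m\<in>{n}. if m = n then x else \<zero>)"
      using assms by (subst finsum_insert) (auto simp: hcomp_carrier)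
  qed (use assms in auto)
  then show ?thesis by simp
qed

lemma decomp_zero [simp]: "decomp M \<zero> n = \<zero>"
  using decomp_homogeneous[of \<zero> n n] by simp

lemma decomp_add:
  assumes x: "x \<in> carrier M" and y: "y \<in> carrier M"
  shows "decomp M (x \<oplus> y) n = decomp M x n \<oplus> decomp M y n"
proof -
  let ?S = "{n. decomp M x n \<noteq> \<zero>} \<union> {n. decomp M y n \<noteq> \<zero>}"
  have fin: "finite ?S"
    using decomp_finite x y by auto
  have "decomp M (x \<oplus> y) = (\<lambda>n. decomp M x n \<oplus> decomp M y n)"
  proof (rule decomp_unique[of ?S])
    show "x \<oplus> y = (\<Oplus>n\<in>?S. decomp M x n \<oplus> decomp M y n)"
      using finsum_support[OF fin, of "decomp M x"] finsum_support[OF fin, of "decomp M y"]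
        decomp_sum[OF x] decomp_sum[OF y] x y by (simp add: finsum_addf)
  qed (use fin x y hcomp_add decomp_hcomp in auto)
  then show ?thesis by simp
qed

lemma decomp_induct [consumes 1, case_names zero add]:
  assumes x: "x \<in> carrier M" and "P \<zero>"
    and step: "\<And>n y. y \<in> carrier M \<Longrightarrow> P y \<Longrightarrow> P (decomp M x n \<oplus> y)"
  shows "P x"
proof -
  have "P (\<Oplus>n\<in>S. decomp M x n)" if "finite S" for S
    using that
    by induction (use assms in \<open>auto simp: Pi_def intro!: step finsum_closed\<close>)
  from this[OF decomp_finite[OF x]] show ?thesis
    using decomp_sum[OF x] by simp
qed

lemma graded_induct [consumes 1, case_names zero add]:
  assumes "x \<in> carrier M" and "P \<zero>"
    and "\<And>n a y. a \<in> hcomp M n \<Longrightarrow> y \<in> carrier M \<Longrightarrow> P y \<Longrightarrow> P (a \<oplus> y)"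
  shows "P x"
  using assms by (blast intro: decomp_induct decomp_hcomp)

end

lemma decomp_graded_map:
  assumes M: "graded_space M" and N: "graded_space N" and s: "inj s"
    and h: "\<And>x. x \<in> carrier M \<Longrightarrow> h x \<in> carrier N"
      "\<And>x y. x \<in> carrier M \<Longrightarrow> y \<in> carrier M \<Longrightarrow> h (x \<oplus>\<^bsub>M\<^esub> y) = h x \<oplus>\<^bsub>N\<^esub> h y"
      "h \<zero>\<^bsub>M\<^esub> = \<zero>\<^bsub>N\<^esub>"
      "\<And>x n. x \<in> hcomp M n \<Longrightarrow> h x \<in> hcomp N (s n)"
    and x: "x \<in> carrier M"
  shows "decomp N (h x) (s n) = h (decomp M x n)"
proof -
  interpret M: graded_space M by fact
  interpret N: graded_space N by fact
  show ?thesis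
    using x
  proof (induction x rule: M.graded_induct)
    case (add m a y)
    then have a: "decomp N (h a) (s n) = h (decomp M a n)"
      using inj_eq[OF s] by (simp add: M.decomp_homogeneous N.decomp_homogeneous[of _ "s m"] h)
    have "a \<in> carrier M" using add by auto
    then show ?case
      using add a by (simp add: h M.decomp_add N.decomp_add)
  qed (simp add: h)
qed

section \<open>Cocycles, boundaries and morphisms\<close>

context cdga
begin

lemma diff_zero [simp]: "diff A \<zero> = \<zero>"
  using diff_smult[of \<zero> 0] diff_hcomp[of \<zero> 0] by (simp add: hcomp_carrier)

lemma diff_carrier [simp]: "x \<in> carrier A \<Longrightarrow> diff A x \<in> carrier A"
proof (induction x rule: graded_induct)
  case (add n a y)
  then show ?case using hcomp_carrier diff_hcomp by (simp add: diff_add) blast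
qed simp

lemma diff_minus: "x \<in> carrier A \<Longrightarrow> diff A (\<ominus> x) = \<ominus> diff A x"
  using diff_smult[of x "-1"] by (simp add: smult_minus_1)

lemma decomp_diff: "x \<in> carrier A \<Longrightarrow> decomp A (diff A x) (Suc n) = diff A (decomp A x n)"
  by (rule decomp_graded_map) (auto simp: graded_space_axioms diff_add diff_hcomp)

lemma cocycles_submodule: "submodule (cocycles A) rat_field A"
  by (rule rat_submoduleI) (auto simp: cocycles_def diff_add diff_smult)

lemma diff_image_submodule:
  assumes "submodule J rat_field A" shows "submodule (diff A ` J) rat_field A"
proof (rule rat_submoduleI)
  note J = submodule_subset[OF assms]
  show "diff A ` J \<subseteq> carrier A" using J by auto
  show "\<zero> \<in> diff A ` J" using submodule_zero[OF assms] diff_zero by (metis image_eqI)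
  fix x assume "x \<in> diff A ` J"
  then obtain a where a: "a \<in> J" "x = diff A a" by auto
  then show "q \<odot> x \<in> diff A ` J" for q
    using J submodule_smult[OF assms] by (auto simp: diff_smult[symmetric])
  fix y assume "y \<in> diff A ` J"
  then obtain b where b: "b \<in> J" "y = diff A b" by auto
  have "x \<oplus> y = diff A (a \<oplus> b)" using a b J by (simp add: diff_add subset_iff)
  then show "x \<oplus> y \<in> diff A ` J"
    using a b submodule_add[OF assms] by blast
qed

lemma carrier_submodule: "submodule (carrier A) rat_field A"
  by (rule rat_submoduleI) auto

lemma boundaries_submodule: "submodule (boundaries A) rat_field A"
  unfolding boundaries_def by (rule diff_image_submodule[OF carrier_submodule])

lemma cocycle_decomp: "x \<in> cocycles A \<Longrightarrow> decomp A x n \<in> cocycles A"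
  using decomp_diff[of x n] by (auto simp: cocycles_def)

lemma zero_submodule: "submodule {\<zero>} rat_field A"
  by (rule rat_submoduleI) auto

text \<open>Statements about a product that are additive in the product need only be checked on the
  homogeneous components of the factors, where the Leibniz rule and the grading are available.\<close>

lemma additive_on_products:
  assumes N: "submodule N rat_field A"
    and T: "\<And>x y. x \<in> carrier A \<Longrightarrow> y \<in> carrier A \<Longrightarrow> T (x \<oplus> y) = T x \<oplus> T y" "T \<zero> = \<zero>"
    and x: "x \<in> carrier A" and y: "y \<in> carrier A"
    and components: "\<And>m n. T (decomp A x m \<otimes> decomp A y n) \<in> N"
  shows "T (x \<otimes> y) \<in> N"
proof -
  have 1: "T (decomp A x m \<otimes> y) \<in> N" for m
    using y
  proof (induction y rule: decomp_induct)
    case zero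
    then show ?case using x T submodule_zero[OF N] by simp
  next
    case (add n b)
    then show ?case
      using x y components by (simp add: r_distr T submodule_add[OF N])
  qed
  show ?thesis
    using x
  proof (induction x rule: decomp_induct)
    case zero
    then show ?case using y T submodule_zero[OF N] by simp
  next
    case (add n b)
    then show ?case
      using x y 1 by (simp add: l_distr T submodule_add[OF N])
  qed
qed

lemma cocycles_mult:
  assumes x: "x \<in> cocycles A" and y: "y \<in> cocycles A"
  shows "x \<otimes> y \<in> cocycles A"
proof -
  have xc: "x \<in> carrier A" and yc: "y \<in> carrier A"
    using x y by (auto simp: cocycles_def)
  have "diff A (x \<otimes> y) \<in> {\<zero>}"
  proof (rule additive_on_products[OF zero_submodule diff_add diff_zero xc yc])
    show "diff A (decomp A x m \<otimes> decomp A y n) \<in> {\<zero>}" for m n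
      using diff_mult[OF decomp_hcomp[OF xc] decomp_hcomp[OF yc]]
        cocycle_decomp[OF x] cocycle_decomp[OF y] by (simp add: cocycles_def)
  qed
  then show ?thesis
    using xc yc by (simp add: cocycles_def)
qed

lemma ideal_submodule:
  assumes "ideal J A" shows "submodule J rat_field A"
proof -
  interpret J: ideal J A by fact
  show ?thesis
  proof (rule rat_submoduleI)
    fix q x assume x: "x \<in> J"
    have "(q \<odot> \<one>) \<otimes> x = q \<odot> x"
      using x by (simp add: smult_mult_left J.Icarr)
    then show "q \<odot> x \<in> J"
      using J.I_l_closed[OF x, of "q \<odot> \<one>"] by simp
  qed (auto simp: J.Icarr)
qed

lemma sign_smult_cancel: "x \<in> carrier A \<Longrightarrow> (- 1) ^ n \<odot> ((- 1) ^ n \<odot> x) = x"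
  by (simp add: smult_smult power_mult_distrib[symmetric])

text \<open>The Leibniz rule is available for homogeneous factors only, so the general case is reduced to
  it by decomposing the left factor.\<close>

lemma cocycle_mult_boundary:
  assumes J: "ideal J A" and x: "x \<in> cocycles A" and w: "w \<in> J"
  shows "x \<otimes> diff A w \<in> diff A ` J" "diff A w \<otimes> x \<in> diff A ` J"
proof -
  interpret J: ideal J A by fact
  note sub = diff_image_submodule[OF ideal_submodule[OF J]]
  have xc: "x \<in> carrier A" using x by (auto simp: cocycles_def)
  have leibniz: "diff A (a \<otimes> w) = (- 1) ^ m \<odot> (a \<otimes> diff A w)"
    if a: "a \<in> cocycles A" "a \<in> hcomp A m" and w: "w \<in> carrier A" for a m w
    using w
  proof (induction w rule: graded_induct)
    case (add n b y)
    then show ?case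
      using a diff_mult[OF a(2) add(1)]
      by (simp add: cocycles_def r_distr diff_add smult_add_right hcomp_carrier)
  qed (use a in \<open>simp add: cocycles_def\<close>)
  have leibniz': "diff A (w \<otimes> a) = diff A w \<otimes> a"
    if a: "a \<in> cocycles A" "a \<in> hcomp A m" and w: "w \<in> carrier A" for a m w
    using w
  proof (induction w rule: graded_induct)
    case (add n b y)
    then show ?case
      using a diff_mult[OF add(1) a(2)]
      by (simp add: cocycles_def l_distr diff_add hcomp_carrier)
  qed (use a in \<open>simp add: cocycles_def\<close>)
  have wc: "w \<in> carrier A" using w J.Icarr by auto
  show "x \<otimes> diff A w \<in> diff A ` J"
    using xc
  proof (induction x rule: decomp_induct)
    case zero
    then show ?case using wc submodule_zero[OF sub] by simp
  next
    case (add n b)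
    let ?a = "decomp A x n"
    have "?a \<otimes> diff A w = diff A ((- 1) ^ n \<odot> (?a \<otimes> w))"
      using leibniz[OF cocycle_decomp[OF x] decomp_hcomp[OF xc] wc, of n] xc wc
      by (simp add: diff_smult sign_smult_cancel)
    moreover have "(- 1) ^ n \<odot> (?a \<otimes> w) \<in> J"
      using J.I_l_closed[OF w] xc submodule_smult[OF ideal_submodule[OF J]] by simp
    ultimately show ?case
      using add xc wc by (simp add: l_distr submodule_add[OF sub])
  qed
  show "diff A w \<otimes> x \<in> diff A ` J"
    using xc
  proof (induction x rule: decomp_induct)
    case zero
    then show ?case using wc submodule_zero[OF sub] by simp
  next
    case (add n b)
    let ?a = "decomp A x n"
    have "diff A w \<otimes> ?a \<in> diff A ` J"
      using leibniz'[OF cocycle_decomp[OF x] decomp_hcomp[OF xc] wc, of n] xc J.I_r_closed[OF w]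
      by (metis decomp_carrier image_eqI)
    then show ?case
      using add xc wc by (simp add: r_distr submodule_add[OF sub])
  qed
qed

end

lemma cdga_hom_cdga_ring_hom: "h \<in> cdga_hom A B \<Longrightarrow> h \<in> ring_hom A B"
  by (simp add: cdga_hom_def)

lemma cdga_homD:
  assumes "h \<in> cdga_hom A B"
  shows cdga_hom_carrier: "\<And>x. x \<in> carrier A \<Longrightarrow> h x \<in> carrier B"
    and cdga_hom_mult: "\<And>x y. x \<in> carrier A \<Longrightarrow> y \<in> carrier A \<Longrightarrow> h (x \<otimes>\<^bsub>A\<^esub> y) = h x \<otimes>\<^bsub>B\<^esub> h y"
    and cdga_hom_add: "\<And>x y. x \<in> carrier A \<Longrightarrow> y \<in> carrier A \<Longrightarrow> h (x \<oplus>\<^bsub>A\<^esub> y) = h x \<oplus>\<^bsub>B\<^esub> h y"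
    and cdga_hom_one: "h \<one>\<^bsub>A\<^esub> = \<one>\<^bsub>B\<^esub>"
    and cdga_hom_smult: "\<And>q x. x \<in> carrier A \<Longrightarrow> h (q \<odot>\<^bsub>A\<^esub> x) = q \<odot>\<^bsub>B\<^esub> h x"
    and cdga_hom_hcomp: "\<And>x n. x \<in> hcomp A n \<Longrightarrow> h x \<in> hcomp B n"
    and cdga_hom_diff: "\<And>x. x \<in> carrier A \<Longrightarrow> h (diff A x) = diff B (h x)"
  using assms unfolding cdga_hom_def
  by (auto simp: ring_hom_closed ring_hom_mult ring_hom_add ring_hom_one subset_iff)

lemma cdga_homI:
  assumes "\<And>x. x \<in> carrier A \<Longrightarrow> h x \<in> carrier B"
    and "\<And>x y. x \<in> carrier A \<Longrightarrow> y \<in> carrier A \<Longrightarrow> h (x \<otimes>\<^bsub>A\<^esub> y) = h x \<otimes>\<^bsub>B\<^esub> h y"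
    and "\<And>x y. x \<in> carrier A \<Longrightarrow> y \<in> carrier A \<Longrightarrow> h (x \<oplus>\<^bsub>A\<^esub> y) = h x \<oplus>\<^bsub>B\<^esub> h y"
    and "h \<one>\<^bsub>A\<^esub> = \<one>\<^bsub>B\<^esub>"
    and "\<And>q x. x \<in> carrier A \<Longrightarrow> h (q \<odot>\<^bsub>A\<^esub> x) = q \<odot>\<^bsub>B\<^esub> h x"
    and "\<And>x n. x \<in> hcomp A n \<Longrightarrow> h x \<in> hcomp B n"
    and "\<And>x. x \<in> carrier A \<Longrightarrow> h (diff A x) = diff B (h x)"
  shows "h \<in> cdga_hom A B"
  using assms unfolding cdga_hom_def by (auto intro!: ring_hom_memI)

lemma cdga_hom_comp:
  assumes "f \<in> cdga_hom A B" "g \<in> cdga_hom B C"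
  shows "g \<circ> f \<in> cdga_hom A C"
  by (rule cdga_homI) (simp_all add: cdga_homD[OF assms(1)] cdga_homD[OF assms(2)])

lemma cdga_hom_zero:
  assumes "cdga A" "cdga B" "h \<in> cdga_hom A B"
  shows "h \<zero>\<^bsub>A\<^esub> = \<zero>\<^bsub>B\<^esub>"
proof -
  interpret A: cdga A by fact
  interpret B: cdga B by fact
  show ?thesis
    using cdga_hom_smult[OF assms(3), of "\<zero>\<^bsub>A\<^esub>" 0] cdga_hom_carrier[OF assms(3), of "\<zero>\<^bsub>A\<^esub>"] by simp
qed

lemma cdga_hom_decomp:
  assumes "cdga A" "cdga B" "h \<in> cdga_hom A B" "x \<in> carrier A"
  shows "decomp B (h x) n = h (decomp A x n)"
proof -
  interpret A: cdga A by fact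
  interpret B: cdga B by fact
  show ?thesis
    using decomp_graded_map[of A B "\<lambda>n. n" h x n] cdga_homD[OF assms(3)] cdga_hom_zero[OF assms(1-3)]
      A.graded_space_axioms B.graded_space_axioms assms(4)
    by simp
qed

section \<open>Morphisms out of quotients\<close>

text \<open>The product of two cosets is a union of cosets of products of representatives, and \<open>f\<close> is
  constant on such a union because it kills \<open>I\<close>; so the induced map is multiplicative for every
  differential subspace \<open>I\<close>.\<close>

lemma hom_on_quot:
  assumes A: "cdga A" and I: "submodule I rat_field A" and f: "f \<in> cdga_hom A B"
    and vanish: "\<forall>i\<in>I. f i = f \<zero>\<^bsub>A\<^esub>" and diff_I: "\<forall>i\<in>I. diff A i \<in> I"
  shows "on_cosets f \<in> cdga_hom (dga_quot A I) B"
    and "\<And>x. x \<in> carrier A \<Longrightarrow> on_cosets f (I +>\<^bsub>A\<^esub> x) = f x"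
proof -
  interpret cdga A by fact
  note subset = subsetD[OF submodule_subset[OF I]]
  note f_simps = cdga_homD[OF f]
  have shift: "f (i \<oplus>\<^bsub>A\<^esub> x) = f x" if "i \<in> I" "x \<in> carrier A" for i x
    using that vanish f_simps(3)[of i x] f_simps(3)[of "\<zero>\<^bsub>A\<^esub>" x] subset by simp
  show eval: "on_cosets f (I +>\<^bsub>A\<^esub> x) = f x" if "x \<in> carrier A" for x
    using that by (intro on_cosets_eq[OF I] shift)
  show "on_cosets f \<in> cdga_hom (dga_quot A I) B"
  proof (rule cdga_homI)
    fix U V assume U: "U \<in> carrier (dga_quot A I)" and V: "V \<in> carrier (dga_quot A I)"
    then obtain x y where x: "x \<in> carrier A" "U = I +>\<^bsub>A\<^esub> x" and y: "y \<in> carrier A" "V = I +>\<^bsub>A\<^esub> y"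
      by auto
    show "on_cosets f U \<in> carrier B"
      using x f_simps eval by simp
    show "on_cosets f (U \<oplus>\<^bsub>dga_quot A I\<^esub> V) = on_cosets f U \<oplus>\<^bsub>B\<^esub> on_cosets f V"
      using x y f_simps by (simp add: coset_add[OF I] eval)
    have "f ` (rcoset_mult A I U V) = {f x \<otimes>\<^bsub>B\<^esub> f y}"
    proof -
      have 1: "f z = f x \<otimes>\<^bsub>B\<^esub> f y" if z: "z \<in> rcoset_mult A I U V" for z
      proof -
        from z obtain i j k where "i \<in> I" "j \<in> I" "k \<in> I"
          "z = k \<oplus>\<^bsub>A\<^esub> ((i \<oplus>\<^bsub>A\<^esub> x) \<otimes>\<^bsub>A\<^esub> (j \<oplus>\<^bsub>A\<^esub> y))"
          by (auto simp: rcoset_mult_def x y mem_coset_iff)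
        then show ?thesis
          using x y f_simps subset by (simp add: shift)
      qed
      have 2: "x \<otimes>\<^bsub>A\<^esub> y \<in> rcoset_mult A I U V"
        using x y coset_self[OF I] m_closed[of x y] unfolding rcoset_mult_def by blast
      show ?thesis
        by (rule image_eq_singletonI[OF 1 2])
    qed
    then show "on_cosets f (U \<otimes>\<^bsub>dga_quot A I\<^esub> V) = on_cosets f U \<otimes>\<^bsub>B\<^esub> on_cosets f V"
      using x y by (simp add: eval) (simp add: on_cosets_def)
    show "on_cosets f (q \<odot>\<^bsub>dga_quot A I\<^esub> U) = q \<odot>\<^bsub>B\<^esub> on_cosets f U" for q
      using x f_simps by (simp add: coset_smult[OF I] eval)
    show "on_cosets f (diff (dga_quot A I) U) = diff B (on_cosets f U)"
      using x f_simps
      by (simp add: quot_diff[OF I _ diff_carrier diff_add bspec[OF diff_I]] eval)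
  next
    show "on_cosets f \<one>\<^bsub>dga_quot A I\<^esub> = \<one>\<^bsub>B\<^esub>"
      using f_simps by (simp add: eval)
    show "on_cosets f U \<in> hcomp B n" if "U \<in> hcomp (dga_quot A I) n" for U n
      using that f_simps(6) by (auto simp: eval hcomp_carrier)
  qed
qed

lemma quot_projection_hom:
  assumes A: "cdga A" and J: "ideal J A" and diff_J: "\<And>x. x \<in> J \<Longrightarrow> diff A x \<in> J"
  shows "(\<lambda>x. J +>\<^bsub>A\<^esub> x) \<in> cdga_hom A (dga_quot A J)"
proof -
  interpret cdga A by fact
  note sub = ideal_submodule[OF J]
  show ?thesis
    by (rule cdga_homI)
      (auto simp: ideal.rcoset_mult_add[OF J] coset_add[OF sub] coset_smult[OF sub]
        quot_diff[OF sub _ diff_carrier diff_add diff_J])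
qed

section \<open>Lifting cocycles through surjective quasi-isomorphisms\<close>

text \<open>The lifting property of a surjective quasi-isomorphism with respect to adjoining one
  generator \<open>v\<close>: \<open>e\<close> is the prescribed value of the differential of \<open>v\<close>, and \<open>y\<close> is the prescribed
  image of \<open>v\<close>.\<close>

definition lifts_cocycles :: "('e, 'm) dga_scheme \<Rightarrow> ('q, 'n) dga_scheme \<Rightarrow> ('e \<Rightarrow> 'q) \<Rightarrow> bool"
  where "lifts_cocycles E Q p \<longleftrightarrow> p \<in> cdga_hom E Q \<and>
    (\<forall>q. \<forall>e\<in>hcomp E (Suc q). \<forall>y\<in>hcomp Q q. diff E e = \<zero>\<^bsub>E\<^esub> \<longrightarrow> p e = diff Q y \<longrightarrow>
      (\<exists>x\<in>hcomp E q. p x = y \<and> diff E x = e))"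

lemma differential_idealD:
  assumes "differential_ideal A J"
  shows "ideal J A" "\<And>x n. x \<in> J \<Longrightarrow> decomp A x n \<in> J" "\<And>x. x \<in> J \<Longrightarrow> diff A x \<in> J"
  using assms by (auto simp: differential_ideal_def)

lemma (in cdga) acyclic_ideal_primitive:
  assumes "acyclic_ideal A J" and x: "x \<in> J" "diff A x = \<zero>"
  shows "\<exists>y\<in>J. diff A y = x"
proof -
  have J: "differential_ideal A J"
    and H: "carrier (cohomology (restrict_to A J)) = {\<zero>\<^bsub>cohomology (restrict_to A J)\<^esub>}"
    using assms by (auto simp: acyclic_ideal_def)
  note sub = ideal_submodule[OF differential_idealD(1)[OF J]]
  have "x \<in> cocycles (restrict_to A J)"
    using x by (simp add: cocycles_def)
  then have "diff A ` J +> x = diff A ` J"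
    using H by (auto simp: boundaries_def)
  then have "x \<in> diff A ` J"
    using coset_eq_zero_iff[OF diff_image_submodule[OF sub], of x] x submodule_subset[OF sub] by auto
  then show ?thesis by auto
qed

text \<open>If \<open>y\<close> is the class of \<open>a\<close>, then the error \<open>e - d a\<close> is a cocycle of \<open>J\<close> and bounds in \<open>J\<close>; the
  component of degree \<open>q\<close> of a primitive corrects \<open>a\<close>, and it stays in \<open>J\<close> because \<open>J\<close> is homogeneous.\<close>

lemma acyclic_quotient_lifts_cocycles:
  assumes A: "cdga A" and "acyclic_ideal A J"
  shows "lifts_cocycles A (dga_quot A J) (\<lambda>x. J +>\<^bsub>A\<^esub> x)"
proof -
  interpret cdga A by fact
  have J: "differential_ideal A J"
    using assms by (simp add: acyclic_ideal_def)
  note ideal = differential_idealD(1)[OF J]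
  note sub = ideal_submodule[OF ideal]
  have "\<exists>x\<in>hcomp A q. J +>\<^bsub>A\<^esub> x = y \<and> diff A x = e"
    if e: "e \<in> hcomp A (Suc q)" "diff A e = \<zero>\<^bsub>A\<^esub>" and y: "y \<in> hcomp (dga_quot A J) q"
      and eq: "J +>\<^bsub>A\<^esub> e = diff (dga_quot A J) y" for q e y
  proof -
    from y obtain a where a: "a \<in> hcomp A q" "y = J +>\<^bsub>A\<^esub> a" by auto
    have ac: "a \<in> carrier A" and ec: "e \<in> carrier A" using a e by auto
    have "J +>\<^bsub>A\<^esub> e = J +>\<^bsub>A\<^esub> diff A a"
      using eq a ac quot_diff[OF sub ac diff_carrier diff_add differential_idealD(3)[OF J]] by simp
    then have "e \<ominus>\<^bsub>A\<^esub> diff A a \<in> J"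
      using coset_eq_iff[OF sub] ec ac by simp
    moreover have "diff A (e \<ominus>\<^bsub>A\<^esub> diff A a) = \<zero>\<^bsub>A\<^esub>"
      using ec ac e by (simp add: a_minus_def diff_add diff_minus diff_diff)
    ultimately obtain j where j: "j \<in> J" "diff A j = e \<ominus>\<^bsub>A\<^esub> diff A a"
      using acyclic_ideal_primitive[OF assms(2)] by blast
    have jc: "j \<in> carrier A"
      using j submodule_subset[OF sub] by auto
    have jq: "decomp A j q \<in> J" "decomp A j q \<in> hcomp A q"
      using j jc differential_idealD(2)[OF J] decomp_hcomp by auto
    have "diff A (decomp A j q) = decomp A (e \<ominus>\<^bsub>A\<^esub> diff A a) (Suc q)"
      using decomp_diff[OF jc, of q] j by simp
    also have "\<dots> = e \<ominus>\<^bsub>A\<^esub> diff A a"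
    proof -
      have "e \<ominus>\<^bsub>A\<^esub> diff A a \<in> hcomp A (Suc q)"
        using hcomp_add[OF e(1) hcomp_smult[OF diff_hcomp[OF a(1)], of "-1"]] ac
        by (simp add: a_minus_def smult_minus_1)
      then show ?thesis by (simp add: decomp_homogeneous)
    qed
    finally have "diff A (decomp A j q \<oplus>\<^bsub>A\<^esub> a) = e"
      using jc ac ec by (simp add: diff_add a_minus_def a_assoc l_neg)
    moreover have "J +>\<^bsub>A\<^esub> (decomp A j q \<oplus>\<^bsub>A\<^esub> a) = y"
      using coset_shift[OF sub jq(1) ac] a by simp
    moreover have "decomp A j q \<oplus>\<^bsub>A\<^esub> a \<in> hcomp A q"
      using jq a hcomp_add by auto
    ultimately show ?thesis by blast
  qed
  then show ?thesis
    unfolding lifts_cocycles_def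
    using quot_projection_hom[OF A ideal differential_idealD(3)[OF J]] by blast
qed

text \<open>Equations between sums and multiples hold in the image of a morphism because they hold in its
  source.\<close>

lemma surjective_image_module:
  assumes E: "cdga E" and p: "p \<in> cdga_hom E Q" and surj: "p ` carrier E = carrier Q"
    and p_zero: "p \<zero>\<^bsub>E\<^esub> = \<zero>\<^bsub>Q\<^esub>"
  shows "rat_module Q"
proof -
  interpret cdga E by fact
  note p_simps = cdga_homD[OF p]
  have "Q \<lparr>carrier := p ` carrier E, ring.zero := p \<zero>\<^bsub>E\<^esub>\<rparr> = Q"
    by (simp add: surj p_zero)
  then have "ring Q"
    using ring_hom_imp_img_ring[OF cdga_hom_cdga_ring_hom[OF p]] by simp
  then interpret Q: ring Q by simp
  have "module rat_field Q"
  proof (rule moduleI)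
    fix q r :: rat and x y assume "x \<in> carrier Q" "y \<in> carrier Q"
    then obtain a b where ab: "a \<in> carrier E" "x = p a" "b \<in> carrier E" "y = p b"
      using surj by (metis imageE)
    show "q \<odot>\<^bsub>Q\<^esub> x \<in> carrier Q"
      using ab p_simps(1,5) by (metis smult_carrier)
    show "(q \<oplus>\<^bsub>rat_field\<^esub> r) \<odot>\<^bsub>Q\<^esub> x = q \<odot>\<^bsub>Q\<^esub> x \<oplus>\<^bsub>Q\<^esub> r \<odot>\<^bsub>Q\<^esub> x"
      using ab by (simp add: p_simps(3,5)[symmetric] smult_add_left)
    show "q \<odot>\<^bsub>Q\<^esub> (x \<oplus>\<^bsub>Q\<^esub> y) = q \<odot>\<^bsub>Q\<^esub> x \<oplus>\<^bsub>Q\<^esub> q \<odot>\<^bsub>Q\<^esub> y"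
      using ab by (simp add: p_simps(3,5)[symmetric] smult_add_right)
    show "(q \<otimes>\<^bsub>rat_field\<^esub> r) \<odot>\<^bsub>Q\<^esub> x = q \<odot>\<^bsub>Q\<^esub> (r \<odot>\<^bsub>Q\<^esub> x)"
      using ab by (simp add: p_simps(5)[symmetric] smult_smult)
    show "\<one>\<^bsub>rat_field\<^esub> \<odot>\<^bsub>Q\<^esub> x = x"
      using ab by (simp add: p_simps(5)[symmetric])
  qed (rule rat_field_cring, rule Q.abelian_group_axioms)
  then show ?thesis by (simp add: rat_module_def)
qed

text \<open>The error \<open>e - d x\<close> is a cocycle killed by \<open>p\<close>, so by injectivity of \<open>H(p)\<close> it is \<open>d w\<close> for some \<open>w\<close>.
  Then \<open>p w\<close> is a cocycle, and by surjectivity of \<open>H(p)\<close> it is the image of \<open>z + d v\<close> for a cocycle \<open>z\<close>;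
  subtracting this from \<open>w\<close> moves \<open>w\<close> into the kernel of \<open>p\<close> and leaves \<open>d w\<close> unchanged.\<close>

lemma quasi_iso_lift:
  assumes E: "cdga E" and q: "quasi_iso E Q p" and surj: "p ` carrier E = carrier Q"
    and p_zero: "p \<zero>\<^bsub>E\<^esub> = \<zero>\<^bsub>Q\<^esub>"
    and e: "e \<in> carrier E" "diff E e = \<zero>\<^bsub>E\<^esub>" and x: "x \<in> carrier E" and eq: "p e = diff Q (p x)"
  shows "\<exists>y\<in>carrier E. p y = p x \<and> diff E y = e"
proof -
  interpret cdga E by fact
  have p: "p \<in> cdga_hom E Q"
    and inj: "inj_on (cohomology_map E Q p) (carrier (cohomology E))"
    and onto: "cohomology_map E Q p ` carrier (cohomology E) = carrier (cohomology Q)"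
    using q by (auto simp: quasi_iso_def bij_betw_def)
  note p_simps = cdga_homD[OF p]
  interpret Q: rat_module Q
    by (rule surjective_image_module[OF E p surj p_zero])
  have p_minus: "p (\<ominus>\<^bsub>E\<^esub> a) = \<ominus>\<^bsub>Q\<^esub> p a" if "a \<in> carrier E" for a
    using that p_simps(1) p_simps(5)[of a "-1"] by (simp add: smult_minus_1 Q.smult_minus_1)
  have bQ_eq: "boundaries Q = (\<lambda>a. p (diff E a)) ` carrier E"
    unfolding boundaries_def surj[symmetric] by (auto simp: image_image p_simps)
  have bQ: "submodule (boundaries Q) rat_field Q"
  proof (rule Q.rat_submoduleI)
    show "boundaries Q \<subseteq> carrier Q" using p_simps(1)[OF diff_carrier] by (auto simp: bQ_eq)
    show "\<zero>\<^bsub>Q\<^esub> \<in> boundaries Q"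
      unfolding bQ_eq using p_zero by (metis diff_zero image_eqI zero_closed)
    fix u assume "u \<in> boundaries Q"
    then obtain a where a: "a \<in> carrier E" "u = p (diff E a)" by (auto simp: bQ_eq)
    then have "r \<odot>\<^bsub>Q\<^esub> u = p (diff E (r \<odot>\<^bsub>E\<^esub> a))" for r
      by (simp add: p_simps(5)[symmetric] diff_smult)
    then show "r \<odot>\<^bsub>Q\<^esub> u \<in> boundaries Q" for r
      using a by (auto simp: bQ_eq)
    fix v assume "v \<in> boundaries Q"
    then obtain b where b: "b \<in> carrier E" "v = p (diff E b)" by (auto simp: bQ_eq)
    then have "u \<oplus>\<^bsub>Q\<^esub> v = p (diff E (a \<oplus>\<^bsub>E\<^esub> b))"
      using a by (simp add: p_simps(3)[symmetric] diff_add)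
    then show "u \<oplus>\<^bsub>Q\<^esub> v \<in> boundaries Q"
      using a b by (auto simp: bQ_eq)
  qed
  have H: "cohomology_map E Q p (boundaries E +>\<^bsub>E\<^esub> c) = boundaries Q +>\<^bsub>Q\<^esub> p c"
    if c: "c \<in> carrier E" for c
    unfolding cohomology_map_def
  proof (rule on_cosets_eq[OF boundaries_submodule c])
    fix n assume "n \<in> boundaries E"
    then obtain w where w: "w \<in> carrier E" "n = diff E w" by (auto simp: boundaries_def)
    then have "p n \<in> boundaries Q" by (auto simp: bQ_eq)
    then show "boundaries Q +>\<^bsub>Q\<^esub> p (n \<oplus>\<^bsub>E\<^esub> c) = boundaries Q +>\<^bsub>Q\<^esub> p c"
      using w c Q.coset_shift[OF bQ] by (simp add: p_simps)
  qed
  let ?e = "e \<ominus>\<^bsub>E\<^esub> diff E x"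
  have ec: "?e \<in> carrier E" using e x by simp
  have "diff E ?e = \<zero>\<^bsub>E\<^esub>"
    using e x by (simp add: a_minus_def diff_add diff_minus diff_diff)
  then have e_coc: "?e \<in> cocycles E" using ec by (simp add: cocycles_def)
  have pe: "p ?e = \<zero>\<^bsub>Q\<^esub>"
    using e x eq Q.M.r_neg[OF p_simps(1)[OF diff_carrier[OF x]]]
    by (simp add: a_minus_def p_simps(3) p_minus p_simps(7))
  have "cohomology_map E Q p (boundaries E +>\<^bsub>E\<^esub> ?e) = cohomology_map E Q p (boundaries E +>\<^bsub>E\<^esub> \<zero>\<^bsub>E\<^esub>)"
    using ec by (simp add: H pe p_zero)
  then have "boundaries E +>\<^bsub>E\<^esub> ?e = boundaries E +>\<^bsub>E\<^esub> \<zero>\<^bsub>E\<^esub>"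
    by (rule inj_onD[OF inj]) (use e_coc submodule_zero[OF cocycles_submodule] in auto)
  then have "?e \<in> boundaries E"
    using ec coset_eq_zero_iff[OF boundaries_submodule] coset_zero[OF boundaries_submodule] by simp
  then obtain w where w: "w \<in> carrier E" "diff E w = ?e" by (auto simp: boundaries_def)
  have "p w \<in> cocycles Q"
    using w p_simps(1)[of w] p_simps(7)[of w] pe by (simp add: cocycles_def)
  then have "boundaries Q +>\<^bsub>Q\<^esub> p w \<in> cohomology_map E Q p ` carrier (cohomology E)"
    using onto by simp
  then obtain z where z: "z \<in> cocycles E" "boundaries Q +>\<^bsub>Q\<^esub> p w = boundaries Q +>\<^bsub>Q\<^esub> p z"
    by (auto simp: H cocycles_def)
  have zc: "z \<in> carrier E" "diff E z = \<zero>\<^bsub>E\<^esub>" using z by (auto simp: cocycles_def)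
  have "p w \<ominus>\<^bsub>Q\<^esub> p z \<in> boundaries Q"
    using z zc w Q.coset_eq_iff[OF bQ] p_simps(1) by simp
  then obtain v where v: "v \<in> carrier E" "p w \<ominus>\<^bsub>Q\<^esub> p z = p (diff E v)"
    by (auto simp: bQ_eq)
  let ?k = "(w \<ominus>\<^bsub>E\<^esub> z) \<ominus>\<^bsub>E\<^esub> diff E v"
  have kc: "?k \<in> carrier E" using w zc v by simp
  have "p ?k = (p w \<ominus>\<^bsub>Q\<^esub> p z) \<ominus>\<^bsub>Q\<^esub> p (diff E v)"
    using w zc v by (simp add: a_minus_def p_simps(3) p_minus)
  also have "\<dots> = \<zero>\<^bsub>Q\<^esub>"
    using v p_simps(1)[of "diff E v"] by (simp add: a_minus_def Q.M.r_neg)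
  finally have pk: "p ?k = \<zero>\<^bsub>Q\<^esub>" .
  have dk: "diff E ?k = ?e"
    using w zc v ec by (simp add: a_minus_def diff_add diff_minus diff_diff)
  have "p (?k \<oplus>\<^bsub>E\<^esub> x) = p x"
    using kc x pk p_simps(1)[of x] by (simp add: p_simps(3))
  moreover have "diff E (?k \<oplus>\<^bsub>E\<^esub> x) = e"
    using kc x dk e by (simp add: diff_add) (simp add: a_minus_def a_assoc l_neg)
  ultimately show ?thesis
    using kc x by (metis a_closed)
qed

text \<open>The lift above need not be homogeneous, but its component of the right degree is again a lift
  when the kernel of \<open>p\<close> is homogeneous.\<close>

lemma quasi_iso_lifts_cocycles:
  assumes E: "cdga E" and q: "quasi_iso E Q p" and surj: "p ` carrier E = carrier Q"
    and surj_hcomp: "\<And>n. hcomp Q n \<subseteq> p ` hcomp E n"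
    and p_zero: "p \<zero>\<^bsub>E\<^esub> = \<zero>\<^bsub>Q\<^esub>"
    and ker: "\<And>x n. x \<in> carrier E \<Longrightarrow> p x = \<zero>\<^bsub>Q\<^esub> \<Longrightarrow> p (decomp E x n) = \<zero>\<^bsub>Q\<^esub>"
  shows "lifts_cocycles E Q p"
proof -
  interpret cdga E by fact
  have p: "p \<in> cdga_hom E Q"
    using q by (auto simp: quasi_iso_def)
  note p_simps = cdga_homD[OF p]
  interpret Q: rat_module Q
    by (rule surjective_image_module[OF E p surj p_zero])
  have p_minus: "p (\<ominus>\<^bsub>E\<^esub> a) = \<ominus>\<^bsub>Q\<^esub> p a" if "a \<in> carrier E" for a
    using that p_simps(1) p_simps(5)[of a "-1"] by (simp add: smult_minus_1 Q.smult_minus_1)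
  have "\<exists>x\<in>hcomp E n. p x = y \<and> diff E x = e"
    if e: "e \<in> hcomp E (Suc n)" "diff E e = \<zero>\<^bsub>E\<^esub>" and y: "y \<in> hcomp Q n" and eq: "p e = diff Q y" for n e y
  proof -
    obtain a where a: "a \<in> hcomp E n" "y = p a"
      using y surj_hcomp by auto
    have ac: "a \<in> carrier E" and ec: "e \<in> carrier E" using a e by auto
    obtain x where x: "x \<in> carrier E" "p x = p a" "diff E x = e"
      using quasi_iso_lift[OF E q surj p_zero ec e(2) ac] eq a by auto
    let ?k = "x \<ominus>\<^bsub>E\<^esub> a"
    have "p ?k = \<zero>\<^bsub>Q\<^esub>"
      using x ac p_simps(1)[OF ac] by (simp add: a_minus_def p_simps(3) p_minus Q.M.r_neg)
    then have pk: "p (decomp E ?k n) = \<zero>\<^bsub>Q\<^esub>"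
      using ker x ac by simp
    have "x = ?k \<oplus>\<^bsub>E\<^esub> a"
      using x ac by (simp add: a_minus_def a_assoc l_neg)
    then have "decomp E x n = decomp E ?k n \<oplus>\<^bsub>E\<^esub> a"
      using decomp_add[of ?k a n] x ac a by (simp add: decomp_homogeneous)
    then have "p (decomp E x n) = y"
      using pk a ac x p_simps(1)[OF ac] by (simp add: p_simps(3))
    moreover have "diff E (decomp E x n) = e"
      using decomp_diff[OF x(1), of n] x e by (simp add: decomp_homogeneous)
    ultimately show ?thesis
      using decomp_hcomp[OF x(1)] by blast
  qed
  then show ?thesis
    unfolding lifts_cocycles_def using p by blast
qed

section \<open>Linear maps on spaces of words\<close>

abbreviation supp :: "('g \<Rightarrow>\<^sub>0 rat) \<Rightarrow> 'g set"
  where "supp \<equiv> Poly_Mapping.keys"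

abbreviation coef :: "('g \<Rightarrow>\<^sub>0 rat) \<Rightarrow> 'g \<Rightarrow> rat"
  where "coef \<equiv> Poly_Mapping.lookup"

abbreviation word :: "'g \<Rightarrow> rat \<Rightarrow> ('g \<Rightarrow>\<^sub>0 rat)"
  where "word \<equiv> Poly_Mapping.single"

abbreviation word_scale :: "rat \<Rightarrow> ('g \<Rightarrow>\<^sub>0 rat) \<Rightarrow> ('g \<Rightarrow>\<^sub>0 rat)"
  where "word_scale q \<equiv> Poly_Mapping.map ((*) q)"

definition word_mult ::
    "('g \<Rightarrow> 'g \<Rightarrow> 'g) \<Rightarrow> ('g \<Rightarrow> 'g \<Rightarrow> rat) \<Rightarrow> ('g \<Rightarrow>\<^sub>0 rat) \<Rightarrow> ('g \<Rightarrow>\<^sub>0 rat) \<Rightarrow> ('g \<Rightarrow>\<^sub>0 rat)"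
  where "word_mult prd sg f g = (\<Sum>u\<in>supp f. \<Sum>v\<in>supp g.
    word (prd u v) (sg u v * (coef f u * coef g v)))"

lemma word_space_simps [simp]:
  "carrier (word_space B prd sg e dg) = {f. supp f \<subseteq> B}"
  "monoid.mult (word_space B prd sg e dg) = word_mult prd sg"
  "one (word_space B prd sg e dg) = word e 1"
  "ring.zero (word_space B prd sg e dg) = 0"
  "add (word_space B prd sg e dg) = (+)"
  "module.smult (word_space B prd sg e dg) q = word_scale q"
  "hcomp (word_space B prd sg e dg) n = {f. supp f \<subseteq> {u \<in> B. dg u = n}}"
  by (auto simp: word_space_def word_mult_def fun_eq_iff)

lemma lookup_word_scale [simp]: "coef (word_scale q f) u = q * coef f u"
  by (simp add: Poly_Mapping.map.rep_eq when_def)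

lemma word_scale_simps [simp]:
  "word_scale q (f + g) = word_scale q f + word_scale q g"
  "word_scale q (f - g) = word_scale q f - word_scale q g"
  "word_scale (p + q) f = word_scale p f + word_scale q f"
  "word_scale p (word_scale q f) = word_scale (p * q) f"
  "word_scale 1 f = f" "word_scale q 0 = 0" "word_scale 0 f = 0"
  "word_scale q (word u c) = word u (q * c)"
  by (auto intro!: poly_mapping_eqI simp: lookup_add lookup_minus algebra_simps lookup_single when_def)

lemma word_scale_null [simp]: "Poly_Mapping.map (\<lambda>c :: rat. 0 :: rat) f = 0"
  by (rule poly_mapping_eqI) (simp add: Poly_Mapping.map.rep_eq when_def)

lemma keys_word_scale: "supp (word_scale q f) \<subseteq> supp f"
  by (auto simp: in_keys_iff)

lemma keys_diff_subset: "supp (f - g :: 'g \<Rightarrow>\<^sub>0 rat) \<subseteq> supp f \<union> supp g"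
  by (auto simp: in_keys_iff lookup_minus)

lemma keys_single_subset: "supp (word u c) \<subseteq> {u}"
  by (auto simp: in_keys_iff lookup_single when_def split: if_splits)

lemma keys_sum_subset:
  fixes f :: "'i \<Rightarrow> 'g \<Rightarrow>\<^sub>0 rat"
  shows "(\<And>i. i \<in> S \<Longrightarrow> supp (f i) \<subseteq> B) \<Longrightarrow> supp (\<Sum>i\<in>S. f i) \<subseteq> B"
proof (induction S rule: infinite_finite_induct)
  case (insert i S)
  then show ?case
    using keys_add[of "f i" "sum f S"] by auto
qed auto

lemma poly_mapping_as_sum:
  fixes f :: "'g \<Rightarrow>\<^sub>0 rat"
  shows "f = (\<Sum>u\<in>supp f. word u (coef f u))"
  by (rule poly_mapping_eqI)
    (simp add: lookup_sum lookup_single when_def in_keys_iff)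

lemma word_induct [consumes 1, case_names zero add]:
  fixes f :: "'g \<Rightarrow>\<^sub>0 rat"
  assumes "supp f \<subseteq> B" and "P 0"
    and "\<And>u c g. u \<in> B \<Longrightarrow> supp g \<subseteq> B \<Longrightarrow> P g \<Longrightarrow> P (word u c + g)"
  shows "P f"
proof -
  have "P (\<Sum>u\<in>S. word u (coef f u))" if "finite S" "S \<subseteq> B" for S
    using that
  proof induction
    case (insert u S)
    then show ?case
      using keys_single_subset[of _ "coef f _"]
      by simp (intro assms(3), auto intro!: keys_sum_subset order_trans[OF keys_single_subset])
  qed (simp add: assms)
  from this[OF finite_keys assms(1)] show ?thesis
    using poly_mapping_as_sum by metis
qed

lemma word_space_module: "rat_module (word_space B prd sg e dg)"
proof -
  have "abelian_group (word_space B prd sg e dg)"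
  proof (rule abelian_groupI; simp add: add.assoc add.commute)
    fix f g :: "'a \<Rightarrow>\<^sub>0 rat"
    assume "supp f \<subseteq> B" "supp g \<subseteq> B"
    then show "supp (f + g) \<subseteq> B"
      using keys_add by fastforce
  next
    fix f :: "'a \<Rightarrow>\<^sub>0 rat"
    assume "supp f \<subseteq> B"
    then show "\<exists>g. supp g \<subseteq> B \<and> f + g = 0"
      by (intro exI[of _ "- f"]) (auto simp: in_keys_iff)
  qed
  then have "module rat_field (word_space B prd sg e dg)"
  proof (intro moduleI rat_field_cring)
    fix q and f :: "'a \<Rightarrow>\<^sub>0 rat"
    assume "f \<in> carrier (word_space B prd sg e dg)"
    then show "q \<odot>\<^bsub>word_space B prd sg e dg\<^esub> f \<in> carrier (word_space B prd sg e dg)"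
      using keys_word_scale[of q f] by auto
  qed simp_all
  then show ?thesis
    by (simp add: rat_module_def)
qed

lemma word_mult_zero [simp]: "word_mult prd sg 0 g = 0" "word_mult prd sg f 0 = 0"
  by (simp_all add: word_mult_def)

lemma word_mult_add_left: "word_mult prd sg (f + f') g = word_mult prd sg f g + word_mult prd sg f' g"
  unfolding word_mult_def
  by (rule setsum_keys_plus_distrib) (simp_all add: algebra_simps single_add sum.distrib)

lemma word_mult_add_right: "word_mult prd sg f (g + g') = word_mult prd sg f g + word_mult prd sg f g'"
proof -
  have "(\<Sum>v\<in>supp (g + g'). word (prd u v)
      (sg u v * (c * coef (g + g') v))) =
    (\<Sum>v\<in>supp g. word (prd u v) (sg u v * (c * coef g v))) +
    (\<Sum>v\<in>supp g'. word (prd u v) (sg u v * (c * coef g' v)))"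
    for u c
    by (rule setsum_keys_plus_distrib) (simp_all add: algebra_simps single_add)
  then show ?thesis
    unfolding word_mult_def by (simp add: sum.distrib)
qed

lemma word_mult_single [simp]:
  "word_mult prd sg (word u a) (word v b) =
    word (prd u v) (sg u v * (a * b))"
  by (cases "a = 0"; cases "b = 0") (simp_all add: word_mult_def)

lemma keys_word_mult:
  assumes "supp f \<subseteq> B" "supp g \<subseteq> B"
    "\<And>u v. u \<in> B \<Longrightarrow> v \<in> B \<Longrightarrow> prd u v \<in> B"
  shows "supp (word_mult prd sg f g) \<subseteq> B"
  unfolding word_mult_def
  by (intro keys_sum_subset order_trans[OF keys_single_subset]) (use assms in auto)

definition word_eval :: "(rat, 'a, 'm) module_scheme \<Rightarrow> ('g \<Rightarrow> 'a) \<Rightarrow> ('g \<Rightarrow>\<^sub>0 rat) \<Rightarrow> 'a"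
  where "word_eval M w f = (\<Oplus>\<^bsub>M\<^esub>u\<in>supp f. coef f u \<odot>\<^bsub>M\<^esub> w u)"

context rat_module
begin

lemma word_eval_zero [simp]: "word_eval M w 0 = \<zero>"
  by (simp add: word_eval_def)

context
  fixes w :: "'g \<Rightarrow> 'a" and B
  assumes w: "\<And>u. u \<in> B \<Longrightarrow> w u \<in> carrier M"
begin

lemma word_eval_superset:
  assumes "finite S" "supp f \<subseteq> S" "S \<subseteq> B"
  shows "word_eval M w f = (\<Oplus>u\<in>S. coef f u \<odot> w u)"
  unfolding word_eval_def
  by (rule add.finprod_mono_neutral_cong_left) (use assms w in \<open>auto simp: in_keys_iff\<close>)

lemma word_eval_closed: "supp f \<subseteq> B \<Longrightarrow> word_eval M w f \<in> carrier M"
  unfolding word_eval_def by (intro finsum_closed) (use w in auto)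

lemma word_eval_single: "u \<in> B \<Longrightarrow> word_eval M w (word u c) = c \<odot> w u"
  using word_eval_superset[of "{u}" "word u c"] w
  by (simp add: keys_single_subset finsum_insert)

lemma word_eval_add:
  assumes "supp f \<subseteq> B" "supp g \<subseteq> B"
  shows "word_eval M w (f + g) = word_eval M w f \<oplus> word_eval M w g"
proof -
  let ?S = "supp f \<union> supp g"
  have S: "finite ?S" "?S \<subseteq> B" using assms by auto
  have wS: "w u \<in> carrier M" if "u \<in> ?S" for u using that S w by auto
  have "word_eval M w (f + g) = (\<Oplus>u\<in>?S. coef f u \<odot> w u \<oplus> coef g u \<odot> w u)"
    unfolding word_eval_superset[OF S(1) keys_add S(2)]
    by (rule finsum_cong') (use wS in \<open>auto simp: lookup_add smult_add_left\<close>)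
  also have "\<dots> = (\<Oplus>u\<in>?S. coef f u \<odot> w u) \<oplus> (\<Oplus>u\<in>?S. coef g u \<odot> w u)"
    by (rule finsum_addf) (use wS in auto)
  also have "\<dots> = word_eval M w f \<oplus> word_eval M w g"
    using word_eval_superset[OF S(1) _ S(2), of f] word_eval_superset[OF S(1) _ S(2), of g] by simp
  finally show ?thesis .
qed

lemma word_eval_scale:
  assumes "supp f \<subseteq> B"
  shows "word_eval M w (word_scale q f) = q \<odot> word_eval M w f"
  using assms
proof (induction f rule: word_induct)
  case (add u c g)
  moreover have "supp (word_scale q g) \<subseteq> B"
    "supp (word u d) \<subseteq> B" for d
    using add keys_word_scale[of q g] keys_single_subset[of u d] by auto
  ultimately show ?case
    using w by (simp add: word_eval_add word_eval_single word_eval_closed smult_add_right smult_smult)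
qed simp

lemma word_eval_diff:
  assumes "supp f \<subseteq> B" "supp g \<subseteq> B"
  shows "word_eval M w (f - g) = word_eval M w f \<ominus> word_eval M w g"
proof -
  have k: "supp (word_scale (-1) g) \<subseteq> B"
    using assms keys_word_scale[of "-1" g] by auto
  have eq: "f - g = f + word_scale (-1) g"
    by (rule poly_mapping_eqI) (simp add: lookup_add lookup_minus)
  show ?thesis
    unfolding eq using assms k
    by (simp add: word_eval_add word_eval_scale smult_minus_1 word_eval_closed a_minus_def)
qed

lemma word_eval_sum:
  assumes "finite S" "\<And>i. i \<in> S \<Longrightarrow> supp (f i) \<subseteq> B"
  shows "word_eval M w (\<Sum>i\<in>S. f i) = (\<Oplus>i\<in>S. word_eval M w (f i))"
  using assms
proof induction
  case (insert i S)
  moreover have "supp (\<Sum>i\<in>S. f i) \<subseteq> B"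
    using insert by (intro keys_sum_subset) auto
  ultimately show ?case
    by (simp add: word_eval_add word_eval_closed finsum_insert Pi_def)
qed simp

lemma word_eval_relation:
  assumes "x \<in> B" "y \<in> B" "z \<in> B" "w x = s \<odot> w y \<oplus> t \<odot> w z"
  shows "supp (word x 1 - word y s - word z t) \<subseteq> B \<and>
    word_eval M w (word x 1 - word y s - word z t) = \<zero>"
proof -
  have k: "supp (word v c) \<subseteq> B" if "v \<in> B" for v and c :: rat
    using that keys_single_subset[of v c] by auto
  have k2: "supp (f - g) \<subseteq> B"
    if "supp f \<subseteq> B" "supp g \<subseteq> B" for f g :: "'g \<Rightarrow>\<^sub>0 rat"
    using that keys_diff_subset[of f g] by blast
  have "word_eval M w (word x 1 - word y s - word z t) =
    ((s \<odot> w y \<oplus> t \<odot> w z) \<ominus> s \<odot> w y) \<ominus> t \<odot> w z"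
    using assms w by (simp add: word_eval_diff word_eval_single k k2)
  also have "\<dots> = (s \<odot> w y \<oplus> t \<odot> w z) \<oplus> \<ominus> (s \<odot> w y \<oplus> t \<odot> w z)"
    using assms w by (simp add: a_minus_def M.a_assoc M.minus_add)
  also have "\<dots> = \<zero>"
    using assms w by (simp add: M.r_neg)
  finally show ?thesis
    using assms by (simp add: k k2)
qed

lemma word_eval_in_submodule:
  assumes "submodule N rat_field M" "supp f \<subseteq> B" "\<And>u. u \<in> supp f \<Longrightarrow> w u \<in> N"
  shows "word_eval M w f \<in> N"
  unfolding word_eval_def by (intro submodule_finsum assms(1) submodule_smult) (use assms in auto)

lemma word_eval_lin_span:
  assumes "f \<in> lin_span (word_space B prd sg e dg) R"
    and R: "\<And>r. r \<in> R \<Longrightarrow> supp r \<subseteq> B \<and> word_eval M w r = \<zero>"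
  shows "supp f \<subseteq> B \<and> word_eval M w f = \<zero>"
  using assms(1)
proof induction
  case (step r f q)
  moreover have "supp (word_scale q r) \<subseteq> B"
    using R[OF step(1)] keys_word_scale[of q r] by auto
  moreover from this have "supp (word_scale q r + f) \<subseteq> B"
    using step keys_add[of "word_scale q r" f] by auto
  ultimately show ?case
    using R[OF step(1)] by (simp add: word_eval_add word_eval_scale)
qed simp

end

end

lemma (in cdga) word_eval_mult:
  assumes w: "\<And>u. u \<in> B \<Longrightarrow> w u \<in> carrier A"
    and prd: "\<And>u v. u \<in> B \<Longrightarrow> v \<in> B \<Longrightarrow> prd u v \<in> B"
    and mult: "\<And>u v. u \<in> B \<Longrightarrow> v \<in> B \<Longrightarrow> sg u v \<odot> w (prd u v) = w u \<otimes> w v"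
    and f: "supp f \<subseteq> B" and g: "supp g \<subseteq> B"
  shows "word_eval A w (word_mult prd sg f g) = word_eval A w f \<otimes> word_eval A w g"
proof -
  note simps = word_eval_add[OF w] word_eval_single[OF w] word_eval_closed[OF w]
  have single: "supp (word u c) \<subseteq> B" if "u \<in> B" for u c
    using that keys_single_subset[of u c] by auto
  have 1: "word_eval A w (word_mult prd sg (word u c) g) =
      word_eval A w (word u c) \<otimes> word_eval A w g" if u: "u \<in> B" for u c
    using g
  proof (induction g rule: word_induct)
    case (add v d g)
    have "(sg u v * (c * d)) \<odot> w (prd u v) = (c \<odot> w u) \<otimes> (d \<odot> w v)"
    proof -
      have "(c \<odot> w u) \<otimes> (d \<odot> w v) = (c * d) \<odot> (sg u v \<odot> w (prd u v))"
        using mult[OF u add(1)] w[OF u] w[OF add(1)]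
        by (simp add: smult_mult_left smult_mult_right smult_smult mult.commute[of d c])
      also have "\<dots> = (sg u v * (c * d)) \<odot> w (prd u v)"
        using w[OF prd[OF u add(1)]] by (simp add: smult_smult mult.commute)
      finally show ?thesis ..
    qed
    then show ?case
      using add u w
      by (simp add: word_mult_add_right simps single keys_word_mult prd r_distr)
  qed (use u w in \<open>simp add: simps\<close>)
  show ?thesis
    using f
  proof (induction f rule: word_induct)
    case (add u c f)
    then show ?case
      using 1[OF add(1)] g w
      by (simp add: word_mult_add_left simps single keys_word_mult prd l_distr)
  qed (use g w in \<open>simp add: simps\<close>)
qed

section \<open>Morphisms out of algebras presented by words\<close>

definition word_prod :: "('e, 'm) ring_scheme \<Rightarrow> (nat \<Rightarrow> 'v \<Rightarrow> 'e) \<Rightarrow> (nat \<times> 'v) list \<Rightarrow> 'e"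
  where "word_prod E l u = foldr (\<lambda>(q, v) b. l q v \<otimes>\<^bsub>E\<^esub> b) u \<one>\<^bsub>E\<^esub>"

lemma word_prod_simps [simp]:
  "word_prod E l [] = \<one>\<^bsub>E\<^esub>"
  "word_prod E l ((q, v) # u) = l q v \<otimes>\<^bsub>E\<^esub> word_prod E l u"
  by (simp_all add: word_prod_def)

lemma set_add_with_diff [simp]: "set_add (with_diff G D) = set_add G"
  by (intro ext) (simp add: set_add_def')

lemma rcoset_mult_with_diff [simp]: "rcoset_mult (with_diff G D) = rcoset_mult G"
  by (intro ext) (simp add: rcoset_mult_def)

lemma lin_span_cong:
  fixes M :: "(rat, 'a, 'm) module_scheme" and N :: "(rat, 'a, 'n) module_scheme"
  assumes "\<zero>\<^bsub>M\<^esub> = \<zero>\<^bsub>N\<^esub>" "add M = add N" "module.smult M = module.smult N"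
  shows "lin_span M S = lin_span N S"
proof -
  have "x \<in> lin_span N S" if "x \<in> lin_span M S" for x
    using that by induction (auto simp: assms intro: lin_span.zero lin_span.step)
  moreover have "x \<in> lin_span M S" if "x \<in> lin_span N S" for x
    using that by induction (auto simp: assms[symmetric] intro: lin_span.zero lin_span.step)
  ultimately show ?thesis by blast
qed

lemma lin_span_with_diff [simp]: "lin_span (with_diff G D) S = lin_span G S"
  by (rule lin_span_cong) (simp_all add: fun_eq_iff)

context cdga
begin

lemma word_prod_hcomp:
  "(\<And>q v. (q, v) \<in> set u \<Longrightarrow> l q v \<in> hcomp A q) \<Longrightarrow> word_prod A l u \<in> hcomp A (sum_list (map fst u))"
  by (induction u) (auto intro!: one_hcomp mult_hcomp)

lemma word_prod_append:
  assumes "\<And>q v. (q, v) \<in> set (u @ u') \<Longrightarrow> l q v \<in> hcomp A q"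
  shows "word_prod A l (u @ u') = word_prod A l u \<otimes> word_prod A l u'"
  using assms
proof (induction u)
  case Nil
  then show ?case using word_prod_hcomp[of u' l] by (auto simp: hcomp_carrier)
next
  case (Cons x u)
  obtain q v where x: "x = (q, v)" by (cases x)
  have "l q v \<in> carrier A" "word_prod A l u \<in> carrier A" "word_prod A l u' \<in> carrier A"
    using Cons.prems word_prod_hcomp[of u l] word_prod_hcomp[of u' l] by (auto simp: x hcomp_carrier)
  then show ?case
    using Cons by (simp add: x m_assoc)
qed

lemma word_prod_relation:
  assumes "\<And>p v. (p, v) \<in> set (u @ u') \<Longrightarrow> l p v \<in> hcomp A p"
    and "l q a \<in> hcomp A q" "l q b \<in> hcomp A q" and z: "l q z = s \<odot> l q a \<oplus> t \<odot> l q b"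
  shows "word_prod A l (u @ (q, z) # u') =
    s \<odot> word_prod A l (u @ (q, a) # u') \<oplus> t \<odot> word_prod A l (u @ (q, b) # u')"
proof -
  have split: "word_prod A l (u @ (q, x) # u') = word_prod A l u \<otimes> (l q x \<otimes> word_prod A l u')"
    if "l q x \<in> hcomp A q" for x
    using word_prod_append[of u "(q, x) # u'" l] assms(1) that by auto
  have "l q a \<in> carrier A" "l q b \<in> carrier A" "word_prod A l u \<in> carrier A" "word_prod A l u' \<in> carrier A"
    using assms word_prod_hcomp[of u l] word_prod_hcomp[of u' l] by (auto intro: hcomp_carrier)
  moreover have "l q z \<in> hcomp A q"
    unfolding z using assms by (intro hcomp_add hcomp_smult)
  ultimately show ?thesis
    using assms by (simp add: split z l_distr r_distr smult_mult_left smult_mult_right)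
qed

end

text \<open>A map \<open>w\<close> on words that respects their degrees, turns their products into products up to the
  prescribed signs and kills the relations \<open>R\<close> induces a morphism of graded algebras on the
  quotient.  This covers both the multiplication of a tensor power and the morphisms out of
  \<open>C \<otimes> \<Lambda>V\<close>.\<close>

locale word_morphism = cdga A for A :: "('a, 'm) dga_scheme" (structure) +
  fixes B :: "'g set" and prd sg e dg R and w :: "'g \<Rightarrow> 'a"
  assumes w: "\<And>u. u \<in> B \<Longrightarrow> w u \<in> hcomp A (dg u)"
    and prd: "\<And>u v. u \<in> B \<Longrightarrow> v \<in> B \<Longrightarrow> prd u v \<in> B"
    and mult: "\<And>u v. u \<in> B \<Longrightarrow> v \<in> B \<Longrightarrow> sg u v \<odot> w (prd u v) = w u \<otimes> w v"
    and unit: "e \<in> B" "w e = \<one>"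
    and R: "\<And>r. r \<in> R \<Longrightarrow> supp r \<subseteq> B \<and> word_eval A w r = \<zero>"
begin

abbreviation (input) "W \<equiv> word_space B prd sg e dg"
abbreviation (input) "I \<equiv> lin_span W R"

lemma wc: "u \<in> B \<Longrightarrow> w u \<in> carrier A"
  using w by blast

lemma span_submodule: "submodule I rat_field W"
  using R by (intro rat_module.lin_span_submodule[OF word_space_module]) auto

lemma eval_coset:
  assumes "f' \<in> I +>\<^bsub>W\<^esub> f" "supp f \<subseteq> B"
  shows "supp f' \<subseteq> B \<and> word_eval A w f' = word_eval A w f"
proof -
  from assms(1) obtain i where i: "i \<in> I" "f' = i + f"
    by (auto simp: rat_module.mem_coset_iff[OF word_space_module])
  have "supp i \<subseteq> B \<and> word_eval A w i = \<zero>"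
    by (rule word_eval_lin_span[OF wc i(1) R])
  then show ?thesis
    using assms(2) i keys_add[of i f] by (auto simp: word_eval_add[OF wc] word_eval_closed[OF wc])
qed

lemma quot_eval:
  assumes f: "supp f \<subseteq> B"
  shows "on_cosets (word_eval A w) (I +>\<^bsub>W\<^esub> f) = word_eval A w f"
proof -
  have "f \<in> I +>\<^bsub>W\<^esub> f"
    using rat_module.coset_self[OF word_space_module span_submodule] f by simp
  from image_eq_singletonI[OF conjunct2[OF eval_coset[OF _ f]] this]
  have "word_eval A w ` (I +>\<^bsub>W\<^esub> f) = {word_eval A w f}" .
  then show ?thesis
    by (simp add: on_cosets_def)
qed

lemma quot_closed:
  "U \<in> carrier (graded_quot W I) \<Longrightarrow> on_cosets (word_eval A w) U \<in> carrier A"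
  by (auto simp: quot_eval word_eval_closed[OF wc])

lemma quot_add:
  assumes "U \<in> carrier (graded_quot W I)" "V \<in> carrier (graded_quot W I)"
  shows "on_cosets (word_eval A w) (U \<oplus>\<^bsub>graded_quot W I\<^esub> V) =
    on_cosets (word_eval A w) U \<oplus> on_cosets (word_eval A w) V"
proof -
  obtain f g where f: "supp f \<subseteq> B" "U = I +>\<^bsub>W\<^esub> f"
    and g: "supp g \<subseteq> B" "V = I +>\<^bsub>W\<^esub> g"
    using assms by auto
  have "supp (f + g) \<subseteq> B"
    using f g keys_add[of f g] by auto
  moreover have "U \<oplus>\<^bsub>graded_quot W I\<^esub> V = I +>\<^bsub>W\<^esub> (f + g)"
    using f g rat_module.coset_add[OF word_space_module span_submodule, of f g] by simp
  ultimately show ?thesis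
    by (simp add: quot_eval f g word_eval_add[OF wc])
qed

lemma quot_smult:
  assumes "U \<in> carrier (graded_quot W I)"
  shows "on_cosets (word_eval A w) (q \<odot>\<^bsub>graded_quot W I\<^esub> U) = q \<odot> on_cosets (word_eval A w) U"
proof -
  obtain f where f: "supp f \<subseteq> B" "U = I +>\<^bsub>W\<^esub> f"
    using assms by auto
  have "supp (word_scale q f) \<subseteq> B"
    using f keys_word_scale[of q f] by auto
  moreover have "q \<odot>\<^bsub>graded_quot W I\<^esub> U = I +>\<^bsub>W\<^esub> word_scale q f"
    using f rat_module.coset_smult[OF word_space_module span_submodule, of f q] by simp
  ultimately show ?thesis
    by (simp add: quot_eval f word_eval_scale[OF wc])
qed

lemma quot_mult:
  assumes "U \<in> carrier (graded_quot W I)" "V \<in> carrier (graded_quot W I)"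
  shows "on_cosets (word_eval A w) (U \<otimes>\<^bsub>graded_quot W I\<^esub> V) =
    on_cosets (word_eval A w) U \<otimes> on_cosets (word_eval A w) V"
proof -
  obtain f g where f: "supp f \<subseteq> B" "U = I +>\<^bsub>W\<^esub> f"
    and g: "supp g \<subseteq> B" "V = I +>\<^bsub>W\<^esub> g"
    using assms by auto
  note self = rat_module.coset_self[OF word_space_module span_submodule]
  have eval: "word_eval A w z = word_eval A w f \<otimes> word_eval A w g"
    if z: "z \<in> U \<otimes>\<^bsub>graded_quot W I\<^esub> V" for z
  proof -
    from z obtain f' g' where z: "z \<in> I +>\<^bsub>W\<^esub> word_mult prd sg f' g'"
      and f': "f' \<in> I +>\<^bsub>W\<^esub> f" and g': "g' \<in> I +>\<^bsub>W\<^esub> g"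
      by (auto simp: rcoset_mult_def f g)
    have "supp (word_mult prd sg f' g') \<subseteq> B"
      by (rule keys_word_mult) (use eval_coset[OF f'] eval_coset[OF g'] f g prd in auto)
    then show ?thesis
      using eval_coset[OF z] eval_coset[OF f' f(1)] eval_coset[OF g' g(1)]
        word_eval_mult[OF wc prd mult] by simp
  qed
  have "word_mult prd sg f g \<in> I +>\<^bsub>W\<^esub> word_mult prd sg f g"
    by (rule self) (use keys_word_mult[OF f(1) g(1) prd] in simp)
  then have "word_mult prd sg f g \<in> U \<otimes>\<^bsub>graded_quot W I\<^esub> V"
    using f g self[of f] self[of g] by (auto simp: rcoset_mult_def)
  from image_eq_singletonI[OF eval this]
  have "word_eval A w ` (U \<otimes>\<^bsub>graded_quot W I\<^esub> V) = {word_eval A w f \<otimes> word_eval A w g}" .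
  then show ?thesis
    by (simp add: quot_eval f g) (simp add: on_cosets_def)
qed

lemma quot_one: "on_cosets (word_eval A w) \<one>\<^bsub>graded_quot W I\<^esub> = \<one>"
  using keys_single_subset[of e 1] unit by (simp add: quot_eval word_eval_single[OF wc])

lemma quot_hcomp:
  assumes "U \<in> hcomp (graded_quot W I) n"
  shows "on_cosets (word_eval A w) U \<in> hcomp A n"
proof -
  obtain f where f: "supp f \<subseteq> {u \<in> B. dg u = n}" "U = I +>\<^bsub>W\<^esub> f"
    using assms by auto
  then have "word_eval A w f \<in> hcomp A n"
    by (intro word_eval_in_submodule[OF wc hcomp_submodule]) (use w in auto)
  moreover have "supp f \<subseteq> B" using f by auto
  ultimately show ?thesis
    using f by (simp add: quot_eval)
qed

end

section \<open>Tensor powers and the multiplication map\<close>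

abbreviation tensor_word_prod :: "('a, 'm) dga_scheme \<Rightarrow> 'a letter list \<Rightarrow> 'a letter list \<Rightarrow> 'a letter list"
  where "tensor_word_prod A \<equiv> map2 (\<lambda>(p, a) (q, b). (p + q, a \<otimes>\<^bsub>A\<^esub> b))"

abbreviation tensor_word_sign :: "'a letter list \<Rightarrow> 'a letter list \<Rightarrow> rat"
  where "tensor_word_sign \<equiv> (\<lambda>u v. (- 1) ^ (\<Sum>i<length u. \<Sum>j<i. fst (u ! i) * fst (v ! j)))"

definition tensor_word_space :: "('a, 'm) dga_scheme \<Rightarrow> nat \<Rightarrow> ('a letter list \<Rightarrow>\<^sub>0 rat) graded"
  where "tensor_word_space A n = word_space (tensor_words A n) (tensor_word_prod A) tensor_word_sign
      (replicate n (0, \<one>\<^bsub>A\<^esub>))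
      (\<lambda>u. sum_list (map fst u))"

definition word_lin :: "('g \<Rightarrow> ('h \<Rightarrow>\<^sub>0 rat)) \<Rightarrow> ('g \<Rightarrow>\<^sub>0 rat) \<Rightarrow> ('h \<Rightarrow>\<^sub>0 rat)"
  where "word_lin d f = (\<Sum>u\<in>supp f. word_scale (coef f u) (d u))"

lemma word_lin_add: "word_lin d (f + g) = word_lin d f + word_lin d g"
  unfolding word_lin_def by (rule setsum_keys_plus_distrib) simp_all

lemma word_lin_single [simp]: "word_lin d (word u c) = word_scale c (d u)"
  by (cases "c = 0") (simp_all add: word_lin_def)

lemma word_lin_zero [simp]: "word_lin d 0 = 0"
  by (simp add: word_lin_def)

lemma word_lin_scale: "word_lin d (word_scale q f) = word_scale q (word_lin d f)"
proof -
  have "supp f \<subseteq> UNIV" by simp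
  then show ?thesis
    by (induction f rule: word_induct) (simp_all add: word_lin_add)
qed

lemma word_lin_diff: "word_lin d (f - g) = word_lin d f - word_lin d g"
  using word_lin_add[of d "f - g" g] by (simp add: algebra_simps)

lemma keys_word_lin:
  assumes "supp f \<subseteq> B" "\<And>u. u \<in> B \<Longrightarrow> supp (d u) \<subseteq> C"
  shows "supp (word_lin d f) \<subseteq> C"
  unfolding word_lin_def
  by (intro keys_sum_subset order_trans[OF keys_word_scale]) (use assms in auto)

definition tensor_gens :: "('a, 'm) dga_scheme \<Rightarrow> nat \<Rightarrow> ('a letter list \<Rightarrow>\<^sub>0 rat) set"
  where "tensor_gens A n =
    {word (u @ (p, (s \<odot>\<^bsub>A\<^esub> a) \<oplus>\<^bsub>A\<^esub> (t \<odot>\<^bsub>A\<^esub> b)) # v) 1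
       - word (u @ (p, a) # v) s - word (u @ (p, b) # v) t
     |u v p a b s t. u @ (p, a) # v \<in> tensor_words A n \<and> u @ (p, b) # v \<in> tensor_words A n}"

lemma tensor_gensI:
  "u @ (p, a) # v \<in> tensor_words A n \<Longrightarrow> u @ (p, b) # v \<in> tensor_words A n \<Longrightarrow>
    word (u @ (p, (s \<odot>\<^bsub>A\<^esub> a) \<oplus>\<^bsub>A\<^esub> (t \<odot>\<^bsub>A\<^esub> b)) # v) 1
      - word (u @ (p, a) # v) s - word (u @ (p, b) # v) t \<in> tensor_gens A n"
  unfolding tensor_gens_def by blast

lemma tensor_space_eq:
  "tensor_space A n = with_diff (tensor_word_space A n) (word_lin (tensor_word_diff A))"
  by (simp add: tensor_space_def tensor_word_space_def word_lin_def[abs_def])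

lemma tensor_rels_eq: "tensor_rels A n = lin_span (tensor_word_space A n) (tensor_gens A n)"
  by (simp add: tensor_rels_def tensor_gens_def tensor_space_eq)

lemma tensor_word_space_module: "rat_module (tensor_word_space A n)"
  unfolding tensor_word_space_def by (rule word_space_module)

lemma tensor_word_space_simps [simp]:
  "carrier (tensor_word_space A n) = {f. supp f \<subseteq> tensor_words A n}"
  "ring.zero (tensor_word_space A n) = 0"
  "add (tensor_word_space A n) = (+)"
  "module.smult (tensor_word_space A n) q = word_scale q"
  by (simp_all add: tensor_word_space_def)

lemma tensor_power_simps [simp]:
  "carrier (tensor_power A n) = (\<lambda>f. tensor_rels A n +>\<^bsub>tensor_word_space A n\<^esub> f) `
    {f. supp f \<subseteq> tensor_words A n}"
  "monoid.mult (tensor_power A n) = monoid.mult (graded_quot (tensor_word_space A n) (tensor_rels A n))"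
  "one (tensor_power A n) = one (graded_quot (tensor_word_space A n) (tensor_rels A n))"
  "ring.zero (tensor_power A n) = tensor_rels A n"
  "add (tensor_power A n) = set_add (tensor_word_space A n)"
  "module.smult (tensor_power A n) = module.smult (graded_quot (tensor_word_space A n) (tensor_rels A n))"
  "hcomp (tensor_power A n) = hcomp (graded_quot (tensor_word_space A n) (tensor_rels A n))"
  "diff (tensor_power A n) = on_cosets (\<lambda>f. tensor_rels A n +>\<^bsub>tensor_word_space A n\<^esub>
    word_lin (tensor_word_diff A) f)"
  by (auto simp: tensor_power_def tensor_space_eq fun_eq_iff)

lemma pure_tensor_eq:
  "pure_tensor A u = tensor_rels A (length u) +>\<^bsub>tensor_word_space A (length u)\<^esub> word u 1"
  by (simp add: pure_tensor_def tensor_space_eq)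

definition diff_at :: "('a, 'm) dga_scheme \<Rightarrow> nat \<Rightarrow> 'a letter list \<Rightarrow> 'a letter list"
  where "diff_at A i u = u[i := (Suc (fst (u ! i)), diff A (snd (u ! i)))]"

lemma tensor_word_diff_eq:
  "tensor_word_diff A u =
    (\<Sum>i<length u. word (diff_at A i u) ((- 1) ^ (\<Sum>j<i. fst (u ! j))))"
  by (simp add: tensor_word_diff_def diff_at_def)

lemma tensor_words_iff:
  "u \<in> tensor_words A n \<longleftrightarrow> length u = n \<and> (\<forall>p a. (p, a) \<in> set u \<longrightarrow> a \<in> hcomp A p)"
  by (auto simp: tensor_words_def)

lemma diff_at_append:
  "i < length u \<Longrightarrow> diff_at A i (u @ v) = diff_at A i u @ v"
  "diff_at A (length u) (u @ (p, x) # v) = u @ (Suc p, diff A x) # v"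
  "diff_at A (Suc (length u + k)) (u @ (p, x) # v) = u @ (p, x) # diff_at A k v"
  by (simp_all add: diff_at_def nth_append list_update_append)

context cdga
begin

lemma diff_at_words:
  assumes "u \<in> tensor_words A n" "i < n"
  shows "diff_at A i u \<in> tensor_words A n"
proof -
  have "(fst (u ! i), snd (u ! i)) \<in> set u"
    using assms by (simp add: tensor_words_iff)
  then have "snd (u ! i) \<in> hcomp A (fst (u ! i))"
    using assms(1) unfolding tensor_words_iff by blast
  moreover have "(p, a) = (Suc (fst (u ! i)), diff A (snd (u ! i))) \<or> (p, a) \<in> set u"
    if "(p, a) \<in> set (diff_at A i u)" for p a
    using that set_update_subset_insert[of u i "(Suc (fst (u ! i)), diff A (snd (u ! i)))"]
    unfolding diff_at_def by blast
  ultimately show ?thesis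
    using assms diff_hcomp unfolding tensor_words_iff by (metis diff_at_def length_list_update prod.inject)
qed

lemma keys_tensor_word_diff:
  "u \<in> tensor_words A n \<Longrightarrow> supp (tensor_word_diff A u) \<subseteq> tensor_words A n"
  unfolding tensor_word_diff_eq
  by (intro keys_sum_subset order_trans[OF keys_single_subset])
    (auto simp: diff_at_words tensor_words_iff[of u])

lemma tensor_words_sum:
  assumes "u @ (p, a) # v \<in> tensor_words A n" "u @ (p, b) # v \<in> tensor_words A n"
  shows "u @ (p, (s \<odot> a) \<oplus> (t \<odot> b)) # v \<in> tensor_words A n"
  using assms by (auto simp: tensor_words_iff intro!: hcomp_add hcomp_smult)

lemma tensor_gens_carrier: "tensor_gens A n \<subseteq> carrier (tensor_word_space A n)"
proof
  fix r assume "r \<in> tensor_gens A n"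
  then obtain u v p a b s t where w: "u @ (p, a) # v \<in> tensor_words A n" "u @ (p, b) # v \<in> tensor_words A n"
    and r: "r = word (u @ (p, (s \<odot> a) \<oplus> (t \<odot> b)) # v) 1
       - word (u @ (p, a) # v) s - word (u @ (p, b) # v) t"
    unfolding tensor_gens_def by blast
  show "r \<in> carrier (tensor_word_space A n)"
    using w tensor_words_sum[OF w, of s t] unfolding r tensor_word_space_simps
    by (auto dest!: subsetD[OF keys_diff_subset] subsetD[OF keys_single_subset])
qed

lemma tensor_rels_submodule: "submodule (tensor_rels A n) rat_field (tensor_word_space A n)"
  unfolding tensor_rels_eq
  by (rule rat_module.lin_span_submodule[OF tensor_word_space_module tensor_gens_carrier])

lemma tensor_rels_add: "f \<in> tensor_rels A n \<Longrightarrow> g \<in> tensor_rels A n \<Longrightarrow> f + g \<in> tensor_rels A n"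
  using rat_module.submodule_add[OF tensor_word_space_module tensor_rels_submodule] by simp

lemma tensor_rels_scale: "f \<in> tensor_rels A n \<Longrightarrow> word_scale q f \<in> tensor_rels A n"
  using rat_module.submodule_smult[OF tensor_word_space_module tensor_rels_submodule] by simp

lemma tensor_rels_zero: "0 \<in> tensor_rels A n"
  using rat_module.submodule_zero[OF tensor_word_space_module tensor_rels_submodule] by simp

lemma tensor_rels_sum: "(\<And>i. i \<in> S \<Longrightarrow> f i \<in> tensor_rels A n) \<Longrightarrow> (\<Sum>i\<in>S. f i) \<in> tensor_rels A n"
  by (induction S rule: infinite_finite_induct) (auto simp: tensor_rels_zero tensor_rels_add)

lemma tensor_gens_rels: "r \<in> tensor_gens A n \<Longrightarrow> r \<in> tensor_rels A n"
  unfolding tensor_rels_eq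
  by (rule rat_module.lin_span_superset[OF tensor_word_space_module tensor_gens_carrier])

text \<open>Differentiating a multilinearity relation at one position gives a multilinearity relation
  again: at the position of the sum because the differential is linear, elsewhere because the
  sum is not touched.  The signs depend only on the degrees, so they agree for all three words.\<close>

lemma tensor_diff_gens:
  assumes "r \<in> tensor_gens A n"
  shows "word_lin (tensor_word_diff A) r \<in> tensor_rels A n"
proof -
  from assms obtain u v p a b s t where
    w: "u @ (p, a) # v \<in> tensor_words A n" "u @ (p, b) # v \<in> tensor_words A n"
    and r: "r = word (u @ (p, (s \<odot> a) \<oplus> (t \<odot> b)) # v) 1
       - word (u @ (p, a) # v) s - word (u @ (p, b) # v) t"
    unfolding tensor_gens_def by blast
  define c where "c = (s \<odot> a) \<oplus> (t \<odot> b)"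
  define sgn where "sgn i = (- 1 :: rat) ^ (\<Sum>j<i. fst ((u @ (p, \<zero>) # v) ! j))" for i
  have n: "n = length u + Suc (length v)"
    using w by (simp add: tensor_words_iff)
  have deg: "fst ((u @ (p, x) # v) ! j) = fst ((u @ (p, \<zero>) # v) ! j)" for x j
    by (simp add: nth_append nth_Cons')
  have twd: "tensor_word_diff A (u @ (p, x) # v) =
      (\<Sum>i<n. word (diff_at A i (u @ (p, x) # v)) (sgn i))" for x
    unfolding tensor_word_diff_eq sgn_def deg[of x] by (simp add: n)
  define g where "g i = word (diff_at A i (u @ (p, c) # v)) 1
    - word (diff_at A i (u @ (p, a) # v)) s
    - word (diff_at A i (u @ (p, b) # v)) t" for i
  have scale_sum: "word_scale q (\<Sum>i<n. f i) = (\<Sum>i<n. word_scale q (f i))"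
    for q and f :: "nat \<Rightarrow> ('a letter list \<Rightarrow>\<^sub>0 rat)"
    by (rule poly_mapping_eqI) (simp add: lookup_sum sum_distrib_left)
  have "word_lin (tensor_word_diff A) r = (\<Sum>i<n. word_scale (sgn i) (g i))"
    unfolding r c_def[symmetric] g_def
    by (simp add: word_lin_diff twd scale_sum sum_subtractf mult.commute)
  moreover have "g i \<in> tensor_rels A n" if i: "i < n" for i
  proof -
    have wi: "diff_at A i (u @ (p, a) # v) \<in> tensor_words A n"
      "diff_at A i (u @ (p, b) # v) \<in> tensor_words A n"
      using diff_at_words[OF _ i] w by auto
    have "g i \<in> tensor_gens A n"
    proof -
      consider "i < length u" | "i = length u" | k where "i = Suc (length u + k)"
        by (metis less_iff_Suc_add linorder_cases)
      then show ?thesis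
      proof cases
        case 1
        then show ?thesis
          using wi unfolding g_def diff_at_append(1)[OF 1] c_def by (intro tensor_gensI)
      next
        case 2
        have "a \<in> carrier A" "b \<in> carrier A"
          using w by (auto simp: tensor_words_iff)
        then have "diff A c = (s \<odot> diff A a) \<oplus> (t \<odot> diff A b)"
          by (simp add: c_def diff_add diff_smult)
        then show ?thesis
          using wi tensor_gensI[of u "Suc p" "diff A a" v A n "diff A b" s t]
          by (simp add: g_def 2 diff_at_append(2))
      next
        case (3 k)
        show ?thesis
          using wi unfolding g_def 3 diff_at_append(3) c_def by (intro tensor_gensI)
      qed
    qed
    then show ?thesis by (rule tensor_gens_rels)
  qed
  ultimately show ?thesis
    by (auto intro!: tensor_rels_sum tensor_rels_scale)
qed

lemma tensor_diff_rels:
  assumes "f \<in> tensor_rels A n"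
  shows "word_lin (tensor_word_diff A) f \<in> tensor_rels A n"
  using assms unfolding tensor_rels_eq
proof induction
  case (step r f q)
  then show ?case
    using tensor_diff_gens[OF step(1)]
    by (simp add: tensor_rels_eq[symmetric] word_lin_add word_lin_scale tensor_rels_add tensor_rels_scale)
qed (simp add: tensor_rels_eq[symmetric] tensor_rels_zero)

lemma tensor_power_diff:
  assumes "supp f \<subseteq> tensor_words A n"
  shows "diff (tensor_power A n) (tensor_rels A n +>\<^bsub>tensor_word_space A n\<^esub> f) =
    tensor_rels A n +>\<^bsub>tensor_word_space A n\<^esub> word_lin (tensor_word_diff A) f"
  unfolding tensor_power_simps
proof (rule rat_module.quot_diff[OF tensor_word_space_module tensor_rels_submodule])
  fix f assume "f \<in> carrier (tensor_word_space A n)"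
  then show "word_lin (tensor_word_diff A) f \<in> carrier (tensor_word_space A n)"
    by (auto dest!: subsetD[OF keys_word_lin[OF _ keys_tensor_word_diff]])
qed (use assms in \<open>simp_all add: word_lin_add tensor_diff_rels\<close>)

abbreviation letter_prod :: "'a letter list \<Rightarrow> 'a"
  where "letter_prod \<equiv> word_prod A (\<lambda>q a. a)"

lemma tensor_mult_eq: "tensor_mult A = on_cosets (word_eval A letter_prod)"
  by (simp add: tensor_mult_def word_eval_def[abs_def] word_prod_def[abs_def])

lemma letter_prod_hcomp: "u \<in> tensor_words A n \<Longrightarrow> letter_prod u \<in> hcomp A (sum_list (map fst u))"
  by (rule word_prod_hcomp) (auto simp: tensor_words_iff)

lemma finsum_lessThan_Suc_shift:
  assumes "\<And>i. i \<le> n \<Longrightarrow> f i \<in> carrier A"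
  shows "(\<Oplus>i\<in>{..<Suc n}. f i) = f 0 \<oplus> (\<Oplus>i\<in>{..<n}. f (Suc i))"
proof -
  have "(\<Oplus>i\<in>Suc ` {..<n}. f i) = (\<Oplus>i\<in>{..<n}. f (Suc i))"
    by (rule finsum_reindex) (use assms in auto)
  then show ?thesis
    unfolding lessThan_Suc_eq_insert_0
    by (subst finsum_insert) (use assms in auto)
qed

lemma letter_prod_leibniz:
  assumes "u \<in> tensor_words A (length u)"
  shows "diff A (letter_prod u) =
    (\<Oplus>i\<in>{..<length u}. (- 1) ^ (\<Sum>j<i. fst (u ! j)) \<odot> letter_prod (diff_at A i u))"
  using assms
proof (induction u)
  case Nil
  have "diff A \<one> = \<zero>"
    using diff_mult[OF one_hcomp one_hcomp] diff_carrier[OF one_closed] by simp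
  then show ?case by simp
next
  case (Cons x u)
  obtain p a where x: "x = (p, a)" by (cases x)
  have a: "a \<in> hcomp A p" and u: "u \<in> tensor_words A (length u)"
    using Cons.prems by (auto simp: tensor_words_iff x)
  have ac: "a \<in> carrier A" using a by auto
  have pu: "letter_prod u \<in> hcomp A (sum_list (map fst u))" "letter_prod u \<in> carrier A"
    using letter_prod_hcomp[OF u] by auto
  have pd: "letter_prod (diff_at A i u) \<in> carrier A" if "i < length u" for i
    using letter_prod_hcomp[OF diff_at_words[OF u that]] by auto
  let ?f = "\<lambda>u i. (- 1) ^ (\<Sum>j<i. fst (u ! j)) \<odot> letter_prod (diff_at A i u)"
  have f0: "?f (x # u) 0 = diff A a \<otimes> letter_prod u"
    using ac pu by (simp add: x diff_at_def)
  have fSuc: "?f (x # u) (Suc i) = (- 1) ^ p \<odot> (a \<otimes> ?f u i)" if "i < length u" for i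
    using ac pd[OF that]
    by (simp add: x diff_at_def sum.lessThan_Suc_shift power_add smult_smult smult_mult_right
        del: sum.lessThan_Suc)
  have "diff A (letter_prod (x # u)) = diff A a \<otimes> letter_prod u \<oplus> (- 1) ^ p \<odot> (a \<otimes> diff A (letter_prod u))"
    using diff_mult[OF a pu(1)] by (simp add: x)
  also have "a \<otimes> diff A (letter_prod u) = (\<Oplus>i\<in>{..<length u}. a \<otimes> ?f u i)"
    unfolding Cons.IH[OF u] by (rule finsum_rdistr) (use ac pd in auto)
  also have "(- 1) ^ p \<odot> \<dots> = (\<Oplus>i\<in>{..<length u}. (- 1) ^ p \<odot> (a \<otimes> ?f u i))"
    by (rule finsum_smult_ldistr) (use ac pd in auto)
  also have "\<dots> = (\<Oplus>i\<in>{..<length u}. ?f (x # u) (Suc i))"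
    by (rule finsum_cong') (use fSuc ac pd in auto)
  also have "diff A a \<otimes> letter_prod u \<oplus> \<dots> = (\<Oplus>i\<in>{..<Suc (length u)}. ?f (x # u) i)"
    unfolding f0[symmetric]
  proof (rule finsum_lessThan_Suc_shift[symmetric])
    fix i assume "i \<le> length u"
    then show "?f (x # u) i \<in> carrier A"
      using letter_prod_hcomp[OF diff_at_words[OF Cons.prems, of i]] by auto
  qed
  finally show ?case by simp
qed

text \<open>Moving the letter \<open>b\<close> of degree \<open>q\<close> to the left past the word \<open>u\<close> costs the sign
  \<open>(-1)\<^bsup>q|u|\<^esup>\<close>; this is the Koszul sign of the product of two words.\<close>

lemma letter_prod_mult:
  assumes "length u = length v" "u \<in> tensor_words A n" "v \<in> tensor_words A n"
  shows "tensor_word_sign u v \<odot> letter_prod (tensor_word_prod A u v) = letter_prod u \<otimes> letter_prod v \<and>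
    tensor_word_prod A u v \<in> tensor_words A n"
  using assms
proof (induction u v arbitrary: n rule: list_induct2)
  case (Cons x u y v)
  obtain p a q b where x: "x = (p, a)" and y: "y = (q, b)" by (cases x, cases y)
  obtain m where n: "n = Suc m" using Cons.prems by (auto simp: tensor_words_iff)
  have a: "a \<in> hcomp A p" and b: "b \<in> hcomp A q"
    and u: "u \<in> tensor_words A m" and v: "v \<in> tensor_words A m"
    using Cons.prems by (auto simp: tensor_words_iff x y n)
  let ?uv = "tensor_word_prod A u v"
  let ?s = "\<Sum>i<length u. \<Sum>j<i. fst (u ! i) * fst (v ! j)"
  let ?d = "sum_list (map fst u)"
  have IH: "(- 1) ^ ?s \<odot> letter_prod ?uv = letter_prod u \<otimes> letter_prod v" "?uv \<in> tensor_words A m"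
    using Cons.IH[OF u v] by auto
  have ac: "a \<in> carrier A" "b \<in> carrier A" "letter_prod u \<in> carrier A" "letter_prod v \<in> carrier A"
    "letter_prod ?uv \<in> carrier A"
    using a b letter_prod_hcomp[OF u] letter_prod_hcomp[OF v] letter_prod_hcomp[OF IH(2)] by auto
  have "(\<Sum>i<length (x # u). \<Sum>j<i. fst ((x # u) ! i) * fst ((y # v) ! j)) =
      (\<Sum>i<length u. fst (u ! i)) * q + ?s"
    by (simp add: sum.lessThan_Suc_shift y sum.distrib sum_distrib_right del: sum.lessThan_Suc)
  also have "(\<Sum>i<length u. fst (u ! i)) = ?d"
    by (simp add: sum_list_sum_nth atLeast0LessThan)
  finally have sign: "(\<Sum>i<length (x # u). \<Sum>j<i. fst ((x # u) ! i) * fst ((y # v) ! j)) = ?d * q + ?s" .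
  have "letter_prod (x # u) \<otimes> letter_prod (y # v) = a \<otimes> ((letter_prod u \<otimes> b) \<otimes> letter_prod v)"
    using ac by (simp add: x y m_assoc)
  also have "letter_prod u \<otimes> b = (- 1) ^ (?d * q) \<odot> (b \<otimes> letter_prod u)"
    by (rule graded_comm[OF letter_prod_hcomp[OF u] b])
  also have "a \<otimes> (\<dots> \<otimes> letter_prod v) = (- 1) ^ (?d * q) \<odot> ((a \<otimes> b) \<otimes> (letter_prod u \<otimes> letter_prod v))"
    using ac by (simp add: m_assoc smult_mult_left smult_mult_right)
  also have "\<dots> = (- 1) ^ (?d * q + ?s) \<odot> ((a \<otimes> b) \<otimes> letter_prod ?uv)"
    using ac by (simp add: IH(1)[symmetric] smult_mult_right smult_smult power_add)
  finally show ?case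
    unfolding sign using IH(2) mult_hcomp[OF a b] by (auto simp: x y n tensor_words_iff)
qed (auto simp: tensor_words_iff)

lemma letter_prod_relation:
  assumes "u @ (p, a) # v \<in> tensor_words A n" "u @ (p, b) # v \<in> tensor_words A n"
  shows "letter_prod (u @ (p, (s \<odot> a) \<oplus> (t \<odot> b)) # v) =
    s \<odot> letter_prod (u @ (p, a) # v) \<oplus> t \<odot> letter_prod (u @ (p, b) # v)"
  by (rule word_prod_relation) (use assms in \<open>auto simp: tensor_words_iff\<close>)

lemma letter_prod_gens:
  assumes "r \<in> tensor_gens A n"
  shows "supp r \<subseteq> tensor_words A n \<and> word_eval A letter_prod r = \<zero>"
proof -
  from assms obtain u v p a b s t where
    w: "u @ (p, a) # v \<in> tensor_words A n" "u @ (p, b) # v \<in> tensor_words A n"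
    and r: "r = word (u @ (p, (s \<odot> a) \<oplus> (t \<odot> b)) # v) 1
       - word (u @ (p, a) # v) s - word (u @ (p, b) # v) t"
    unfolding tensor_gens_def by blast
  show ?thesis
    unfolding r
    by (rule word_eval_relation[OF _ tensor_words_sum[OF w] w letter_prod_relation[OF w]])
      (use letter_prod_hcomp in blast)
qed

lemma tensor_word_morphism:
  "word_morphism A (tensor_words A n) (tensor_word_prod A)
    tensor_word_sign
    (replicate n (0, \<one>)) (\<lambda>u. sum_list (map fst u)) (tensor_gens A n) letter_prod"
proof (unfold_locales)
  fix u v assume uv: "u \<in> tensor_words A n" "v \<in> tensor_words A n"
  then have len: "length u = length v" by (simp add: tensor_words_iff)
  show "tensor_word_prod A u v \<in> tensor_words A n"
    and "tensor_word_sign u v \<odot> letter_prod (tensor_word_prod A u v) = letter_prod u \<otimes> letter_prod v"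
    using letter_prod_mult[OF len uv] by blast+
next
  show "replicate n (0, \<one>) \<in> tensor_words A n"
    by (auto simp: tensor_words_iff one_hcomp)
  show "letter_prod (replicate n (0, \<one>)) = \<one>"
    by (induction n) auto
qed (use letter_prod_hcomp letter_prod_gens in blast)+

lemma tensor_mult_coset:
  assumes "supp f \<subseteq> tensor_words A n"
  shows "tensor_mult A (tensor_rels A n +>\<^bsub>tensor_word_space A n\<^esub> f) = word_eval A letter_prod f"
  unfolding tensor_mult_eq tensor_rels_eq tensor_word_space_def
  by (rule word_morphism.quot_eval[OF tensor_word_morphism assms])

lemma tensor_mult_pure:
  assumes "u \<in> tensor_words A n"
  shows "tensor_mult A (pure_tensor A u) = letter_prod u"
proof -
  have "n = length u" "supp (word u 1) \<subseteq> tensor_words A n"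
    using assms keys_single_subset[of u] by (auto simp: tensor_words_iff)
  then show ?thesis
    using tensor_mult_coset[of _ n] assms hcomp_carrier[OF letter_prod_hcomp[OF assms]]
      word_eval_single[OF hcomp_carrier[OF letter_prod_hcomp] assms, where c = 1]
    by (simp add: pure_tensor_eq)
qed

lemma word_eval_tensor_diff:
  assumes "supp f \<subseteq> tensor_words A n"
  shows "word_eval A letter_prod (word_lin (tensor_word_diff A) f) = diff A (word_eval A letter_prod f)"
proof -
  have wc: "\<And>u. u \<in> tensor_words A n \<Longrightarrow> letter_prod u \<in> carrier A"
    using letter_prod_hcomp by blast
  have word: "word_eval A letter_prod (tensor_word_diff A u) = diff A (letter_prod u)"
    if u: "u \<in> tensor_words A n" for u
  proof -
    have n: "length u = n" using u by (simp add: tensor_words_iff)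
    have "word_eval A letter_prod (tensor_word_diff A u) =
      (\<Oplus>i\<in>{..<length u}. word_eval A letter_prod
        (word (diff_at A i u) ((- 1) ^ (\<Sum>j<i. fst (u ! j)))))"
      unfolding tensor_word_diff_eq
      by (rule word_eval_sum[OF wc])
        (auto simp: n diff_at_words[OF u] intro!: order_trans[OF keys_single_subset])
    also have "\<dots> = (\<Oplus>i\<in>{..<length u}. (- 1) ^ (\<Sum>j<i. fst (u ! j)) \<odot> letter_prod (diff_at A i u))"
      by (rule finsum_cong') (auto simp: n word_eval_single[OF wc] wc diff_at_words[OF u])
    also have "\<dots> = diff A (letter_prod u)"
      using u by (intro letter_prod_leibniz[symmetric]) (simp add: n)
    finally show ?thesis .
  qed
  show ?thesis
    using assms
  proof (induction f rule: word_induct)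
    case (add u c g)
    have k: "supp (word u c) \<subseteq> tensor_words A n"
      "supp (word_lin (tensor_word_diff A) g) \<subseteq> tensor_words A n"
      "supp (word_scale c (tensor_word_diff A u)) \<subseteq> tensor_words A n"
      using add keys_single_subset[of u c] keys_word_lin[OF add(2) keys_tensor_word_diff]
        keys_word_scale[of c "tensor_word_diff A u"] keys_tensor_word_diff[OF add(1)] by auto
    show ?case
      using add k keys_tensor_word_diff[OF add(1)] wc word[OF add(1)]
      by (simp add: word_lin_add word_eval_add[OF wc] word_eval_single[OF wc] word_eval_scale[OF wc]
          word_eval_closed[OF wc] diff_add diff_smult)
  qed simp
qed

text \<open>The multiplication is compatible with products because \<open>A\<close> is graded commutative, and with the
  differentials by the iterated Leibniz rule \<open>letter_prod_leibniz\<close>.\<close>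

theorem tensor_mult_hom: "tensor_mult A \<in> cdga_hom (tensor_power A n) A"
proof -
  interpret tm: word_morphism A "tensor_words A n" "tensor_word_prod A" tensor_word_sign
    "replicate n (0, \<one>)" "\<lambda>u. sum_list (map fst u)" "tensor_gens A n" letter_prod
    by (rule tensor_word_morphism)
  note eqs = tensor_mult_eq tensor_rels_eq tensor_word_space_def
  show ?thesis
  proof (rule cdga_homI)
    fix U V q assume U: "U \<in> carrier (tensor_power A n)" and V: "V \<in> carrier (tensor_power A n)"
    have gU: "U \<in> carrier (graded_quot (tensor_word_space A n) (tensor_rels A n))"
      and gV: "V \<in> carrier (graded_quot (tensor_word_space A n) (tensor_rels A n))"
      using U V by simp_all
    show "tensor_mult A U \<in> carrier A"
      using tm.quot_closed gU unfolding eqs .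
    show "tensor_mult A (U \<otimes>\<^bsub>tensor_power A n\<^esub> V) = tensor_mult A U \<otimes> tensor_mult A V"
      using tm.quot_mult gU gV unfolding eqs tensor_power_simps .
    show "tensor_mult A (U \<oplus>\<^bsub>tensor_power A n\<^esub> V) = tensor_mult A U \<oplus> tensor_mult A V"
      using tm.quot_add gU gV unfolding eqs tensor_power_simps graded_quot_simps(5) .
    show "tensor_mult A (q \<odot>\<^bsub>tensor_power A n\<^esub> U) = q \<odot> tensor_mult A U"
      using tm.quot_smult gU unfolding eqs tensor_power_simps .
    from U obtain f where f: "supp f \<subseteq> tensor_words A n"
      "U = tensor_rels A n +>\<^bsub>tensor_word_space A n\<^esub> f" by auto
    then show "tensor_mult A (diff (tensor_power A n) U) = diff A (tensor_mult A U)"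
      using tensor_power_diff[OF f(1)] keys_word_lin[OF f(1) keys_tensor_word_diff]
      by (simp add: tensor_mult_coset word_eval_tensor_diff del: tensor_power_simps)
  next
    show "tensor_mult A \<one>\<^bsub>tensor_power A n\<^esub> = \<one>"
      using tm.quot_one unfolding eqs tensor_power_simps .
    show "tensor_mult A U \<in> hcomp A k" if "U \<in> hcomp (tensor_power A n) k" for U k
      using tm.quot_hcomp that unfolding eqs tensor_power_simps .
  qed
qed

end

section \<open>Linear selections\<close>

definition linear_on ::
    "(rat, 'v, 'm) module_scheme \<Rightarrow> (rat, 'e, 'n) module_scheme \<Rightarrow> 'v set \<Rightarrow> ('v \<Rightarrow> 'e) \<Rightarrow> bool"
  where "linear_on V E S l \<longleftrightarrow> (\<forall>v\<in>S. \<forall>w\<in>S. \<forall>s. l (v \<oplus>\<^bsub>V\<^esub> s \<odot>\<^bsub>V\<^esub> w) = l v \<oplus>\<^bsub>E\<^esub> s \<odot>\<^bsub>E\<^esub> l w)"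

text \<open>A linear relation that is total on \<open>S\<close> contains the graph of a linear map, and the map may
  be prescribed on a subspace.  By Zorn's lemma there is a maximal functional linear subrelation;
  if its domain missed some \<open>a\<close>, adjoining a pair \<open>(a, b)\<close> of the relation would enlarge it.\<close>

lemma linear_selection:
  fixes V :: "(rat, 'v, 'm) module_scheme" and E :: "(rat, 'e, 'n) module_scheme"
  assumes V: "rat_module V" and E: "rat_module E"
    and S: "submodule S rat_field V" and F: "submodule F rat_field V" "F \<subseteq> S"
    and dom: "\<And>v x. (v, x) \<in> L \<Longrightarrow> v \<in> S \<and> x \<in> carrier E"
    and lin: "\<And>v x w y s. (v, x) \<in> L \<Longrightarrow> (w, y) \<in> L \<Longrightarrow> (v \<oplus>\<^bsub>V\<^esub> s \<odot>\<^bsub>V\<^esub> w, x \<oplus>\<^bsub>E\<^esub> s \<odot>\<^bsub>E\<^esub> y) \<in> L"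
    and total: "\<And>v. v \<in> S \<Longrightarrow> \<exists>x. (v, x) \<in> L"
    and l0: "\<And>v. v \<in> F \<Longrightarrow> (v, l0 v) \<in> L" "linear_on V E F l0"
  obtains l where "linear_on V E S l" "\<And>v. v \<in> S \<Longrightarrow> (v, l v) \<in> L" "\<And>v. v \<in> F \<Longrightarrow> l v = l0 v"
proof -
  interpret V: rat_module V by fact
  interpret E: rat_module E by fact
  define linear where "linear G \<longleftrightarrow> (\<forall>v x w y s. (v, x) \<in> G \<longrightarrow> (w, y) \<in> G \<longrightarrow>
    (v \<oplus>\<^bsub>V\<^esub> s \<odot>\<^bsub>V\<^esub> w, x \<oplus>\<^bsub>E\<^esub> s \<odot>\<^bsub>E\<^esub> y) \<in> G)" for G
  define functional where "functional G \<longleftrightarrow> (\<forall>v x y. (v, x) \<in> G \<longrightarrow> (v, y) \<in> G \<longrightarrow> x = y)" for G :: "('v \<times> 'e) set"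
  define \<G> where "\<G> = {G. (\<lambda>v. (v, l0 v)) ` F \<subseteq> G \<and> G \<subseteq> L \<and> linear G \<and> functional G}"
  have Sc: "S \<subseteq> carrier V" using V.submodule_subset[OF S] .
  have "\<exists>M\<in>\<G>. \<forall>G\<in>\<G>. M \<subseteq> G \<longrightarrow> G = M"
  proof (rule subset_Zorn_nonempty)
    have "linear ((\<lambda>v. (v, l0 v)) ` F)"
      unfolding linear_def
    proof (intro allI impI)
      fix v x w y s assume "(v, x) \<in> (\<lambda>v. (v, l0 v)) ` F" "(w, y) \<in> (\<lambda>v. (v, l0 v)) ` F"
      then have "v \<in> F" "x = l0 v" "w \<in> F" "y = l0 w" by auto
      then show "(v \<oplus>\<^bsub>V\<^esub> s \<odot>\<^bsub>V\<^esub> w, x \<oplus>\<^bsub>E\<^esub> s \<odot>\<^bsub>E\<^esub> y) \<in> (\<lambda>v. (v, l0 v)) ` F"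
        using l0(2) V.submodule_add[OF F(1)] V.submodule_smult[OF F(1)]
        by (auto simp: linear_on_def)
    qed
    moreover have "functional ((\<lambda>v. (v, l0 v)) ` F)"
      by (auto simp: functional_def)
    ultimately have "(\<lambda>v. (v, l0 v)) ` F \<in> \<G>"
      using l0(1) by (auto simp: \<G>_def)
    then show "\<G> \<noteq> {}" by blast
  next
    fix \<C> assume ne: "\<C> \<noteq> {}" and chain: "subset.chain \<G> \<C>"
    have sub: "G \<in> \<G>" if "G \<in> \<C>" for G
      using chain that by (auto simp: subset.chain_def)
    have pair: "\<exists>G\<in>\<C>. a \<in> G \<and> b \<in> G" if "a \<in> \<Union>\<C>" "b \<in> \<Union>\<C>" for a b
      using that chain unfolding subset.chain_def subset_chain_def by blast
    have "linear (\<Union>\<C>)"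
      unfolding linear_def
    proof (intro allI impI)
      fix v x w y s assume "(v, x) \<in> \<Union>\<C>" "(w, y) \<in> \<Union>\<C>"
      then obtain G where "G \<in> \<C>" "(v, x) \<in> G" "(w, y) \<in> G" using pair by blast
      then show "(v \<oplus>\<^bsub>V\<^esub> s \<odot>\<^bsub>V\<^esub> w, x \<oplus>\<^bsub>E\<^esub> s \<odot>\<^bsub>E\<^esub> y) \<in> \<Union>\<C>"
        using sub[of G] unfolding \<G>_def linear_def by blast
    qed
    moreover have "functional (\<Union>\<C>)"
      unfolding functional_def
    proof (intro allI impI)
      fix v x y assume "(v, x) \<in> \<Union>\<C>" "(v, y) \<in> \<Union>\<C>"
      then obtain G where "G \<in> \<C>" "(v, x) \<in> G" "(v, y) \<in> G" using pair by blast
      then show "x = y"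
        using sub[of G] unfolding \<G>_def functional_def by blast
    qed
    moreover have "(\<lambda>v. (v, l0 v)) ` F \<subseteq> \<Union>\<C>" "\<Union>\<C> \<subseteq> L"
      using ne sub unfolding \<G>_def by blast+
    ultimately show "\<Union>\<C> \<in> \<G>"
      unfolding \<G>_def by blast
  qed
  then obtain M where M: "M \<in> \<G>" and maximal: "\<And>G. G \<in> \<G> \<Longrightarrow> M \<subseteq> G \<Longrightarrow> G = M" by blast
  have M0: "\<And>v. v \<in> F \<Longrightarrow> (v, l0 v) \<in> M" and sub_L: "M \<subseteq> L" and Mfun: "functional M"
    and Mlin: "\<And>v x w y s. (v, x) \<in> M \<Longrightarrow> (w, y) \<in> M \<Longrightarrow> (v \<oplus>\<^bsub>V\<^esub> s \<odot>\<^bsub>V\<^esub> w, x \<oplus>\<^bsub>E\<^esub> s \<odot>\<^bsub>E\<^esub> y) \<in> M"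
    using M unfolding \<G>_def linear_def by blast+
  have carr: "v \<in> carrier V" "x \<in> carrier E" if "(v, x) \<in> M" for v x
    using that sub_L dom Sc by blast+
  have zero: "(\<zero>\<^bsub>V\<^esub>, \<zero>\<^bsub>E\<^esub>) \<in> M"
  proof -
    have m: "(\<zero>\<^bsub>V\<^esub>, l0 \<zero>\<^bsub>V\<^esub>) \<in> M"
      using M0 V.submodule_zero[OF F(1)] by blast
    from Mlin[OF m m, of "-1"] carr[OF m] show ?thesis
      by (simp add: E.smult_minus_1 E.M.r_neg)
  qed
  have scale: "(s \<odot>\<^bsub>V\<^esub> w, s \<odot>\<^bsub>E\<^esub> y) \<in> M" if "(w, y) \<in> M" for w y s
    using Mlin[OF zero that, of s] carr[OF that] by simp
  have M_total: "\<exists>x. (a, x) \<in> M" if a: "a \<in> S" for a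
  proof (rule ccontr)
    assume no: "\<nexists>x. (a, x) \<in> M"
    obtain b where b: "(a, b) \<in> L" using total[OF a] by blast
    have ab: "a \<in> carrier V" "b \<in> carrier E" using a b dom Sc by blast+
    define M' where "M' = {(v \<oplus>\<^bsub>V\<^esub> s \<odot>\<^bsub>V\<^esub> a, x \<oplus>\<^bsub>E\<^esub> s \<odot>\<^bsub>E\<^esub> b) |v x s. (v, x) \<in> M}"
    have M'I: "(v, x) \<in> M \<Longrightarrow> p = v \<oplus>\<^bsub>V\<^esub> s \<odot>\<^bsub>V\<^esub> a \<Longrightarrow> r = x \<oplus>\<^bsub>E\<^esub> s \<odot>\<^bsub>E\<^esub> b \<Longrightarrow> (p, r) \<in> M'" for p r v x s
      unfolding M'_def by blast
    have MM': "M \<subseteq> M'"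
    proof
      fix z assume "z \<in> M"
      then show "z \<in> M'"
        using M'I[of "fst z" "snd z" "fst z" 0 "snd z"] carr[of "fst z" "snd z"] ab by simp
    qed
    have "linear M'"
      unfolding linear_def
    proof (intro allI impI)
      fix v x w y s assume "(v, x) \<in> M'" "(w, y) \<in> M'"
      then obtain v' x' t w' y' r where v: "(v', x') \<in> M" "v = v' \<oplus>\<^bsub>V\<^esub> t \<odot>\<^bsub>V\<^esub> a" "x = x' \<oplus>\<^bsub>E\<^esub> t \<odot>\<^bsub>E\<^esub> b"
        and w: "(w', y') \<in> M" "w = w' \<oplus>\<^bsub>V\<^esub> r \<odot>\<^bsub>V\<^esub> a" "y = y' \<oplus>\<^bsub>E\<^esub> r \<odot>\<^bsub>E\<^esub> b"
        unfolding M'_def by blast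
      show "(v \<oplus>\<^bsub>V\<^esub> s \<odot>\<^bsub>V\<^esub> w, x \<oplus>\<^bsub>E\<^esub> s \<odot>\<^bsub>E\<^esub> y) \<in> M'"
      proof (rule M'I[OF Mlin[OF v(1) w(1), of s], of _ "t + s * r"])
        show "v \<oplus>\<^bsub>V\<^esub> s \<odot>\<^bsub>V\<^esub> w = v' \<oplus>\<^bsub>V\<^esub> s \<odot>\<^bsub>V\<^esub> w' \<oplus>\<^bsub>V\<^esub> (t + s * r) \<odot>\<^bsub>V\<^esub> a"
          using v w ab carr[OF v(1)] carr[OF w(1)]
          by (simp add: V.smult_add_left V.smult_add_right V.smult_smult V.M.a_ac)
        show "x \<oplus>\<^bsub>E\<^esub> s \<odot>\<^bsub>E\<^esub> y = x' \<oplus>\<^bsub>E\<^esub> s \<odot>\<^bsub>E\<^esub> y' \<oplus>\<^bsub>E\<^esub> (t + s * r) \<odot>\<^bsub>E\<^esub> b"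
          using v w ab carr[OF v(1)] carr[OF w(1)]
          by (simp add: E.smult_add_left E.smult_add_right E.smult_smult E.M.a_ac)
      qed
    qed
    moreover have "functional M'"
      unfolding functional_def
    proof (intro allI impI)
      fix p x y assume "(p, x) \<in> M'" "(p, y) \<in> M'"
      then obtain v' x' t w' y' r where v: "(v', x') \<in> M" "p = v' \<oplus>\<^bsub>V\<^esub> t \<odot>\<^bsub>V\<^esub> a" "x = x' \<oplus>\<^bsub>E\<^esub> t \<odot>\<^bsub>E\<^esub> b"
        and w: "(w', y') \<in> M" "p = w' \<oplus>\<^bsub>V\<^esub> r \<odot>\<^bsub>V\<^esub> a" "y = y' \<oplus>\<^bsub>E\<^esub> r \<odot>\<^bsub>E\<^esub> b"
        unfolding M'_def by blast
      note c = carr[OF v(1)] carr[OF w(1)]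
      show "x = y"
      proof (cases "t = r")
        case True
        then have "v' = w'" using v w c ab by simp
        then show ?thesis using True v w Mfun unfolding functional_def by blast
      next
        case False
        have "v' \<oplus>\<^bsub>V\<^esub> (t - r) \<odot>\<^bsub>V\<^esub> a \<oplus>\<^bsub>V\<^esub> r \<odot>\<^bsub>V\<^esub> a = w' \<oplus>\<^bsub>V\<^esub> r \<odot>\<^bsub>V\<^esub> a"
          using v w c ab V.smult_add_left[of a "t - r" r] by (simp add: V.M.a_assoc)
        then have "v' \<oplus>\<^bsub>V\<^esub> (t - r) \<odot>\<^bsub>V\<^esub> a = w'"
          using c ab by simp
        then have "(t - r) \<odot>\<^bsub>V\<^esub> a = w' \<oplus>\<^bsub>V\<^esub> (-1) \<odot>\<^bsub>V\<^esub> v'"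
          using c ab by (auto simp: V.smult_minus_1 V.M.a_ac V.M.r_neg2 V.M.r_neg1 V.M.r_neg)
        then have "((t - r) \<odot>\<^bsub>V\<^esub> a, y' \<oplus>\<^bsub>E\<^esub> (-1) \<odot>\<^bsub>E\<^esub> x') \<in> M"
          using Mlin[OF w(1) v(1), of "-1"] by simp
        from scale[OF this, of "1 / (t - r)"] have False
          using no False ab by (auto simp: V.smult_smult)
        then show ?thesis ..
      qed
    qed
    moreover have "M' \<subseteq> L"
      unfolding M'_def using sub_L lin[OF _ b] by blast
    ultimately have "M' \<in> \<G>"
      using MM' M0 unfolding \<G>_def by blast
    with maximal MM' have "M' = M" by blast
    moreover have "(a, b) \<in> M'"
      using M'I[OF zero, of a 1 b] ab by simp
    ultimately show False using no by blast
  qed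
  define l where "l v = (SOME x. (v, x) \<in> M)" for v
  have l: "(v, l v) \<in> M" if "v \<in> S" for v
    unfolding l_def using M_total[OF that] by (rule someI_ex)
  have l_eq: "l v = x" if "(v, x) \<in> M" for v x
    using l[of v] that sub_L dom Mfun unfolding functional_def by blast
  show thesis
  proof (rule that)
    show "linear_on V E S l"
      unfolding linear_on_def using l_eq Mlin l by blast
  qed (use l sub_L M0 l_eq in blast)+
qed

section \<open>The lifting property of relative Sullivan algebras\<close>

definition ext_gens :: "('c, 'm) dga_scheme \<Rightarrow> 'v graded \<Rightarrow> (('c, 'v) ext_word \<Rightarrow>\<^sub>0 rat) set"
  where "ext_gens C V =
    {word ((p, (s \<odot>\<^bsub>C\<^esub> c) \<oplus>\<^bsub>C\<^esub> (t \<odot>\<^bsub>C\<^esub> c')), u) 1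
       - word ((p, c), u) s - word ((p, c'), u) t
      |p c c' s t u. ((p, c), u) \<in> ext_words C (hcomp V) \<and> ((p, c'), u) \<in> ext_words C (hcomp V)} \<union>
    {word (c, u @ (q, (s \<odot>\<^bsub>V\<^esub> v) \<oplus>\<^bsub>V\<^esub> (t \<odot>\<^bsub>V\<^esub> v')) # w) 1
       - word (c, u @ (q, v) # w) s - word (c, u @ (q, v') # w) t
      |c u q v v' s t w. (c, u @ (q, v) # w) \<in> ext_words C (hcomp V) \<and>
        (c, u @ (q, v') # w) \<in> ext_words C (hcomp V)} \<union>
    {word (c, u @ (q, v) # (q', v') # w) 1
       - word (c, u @ (q', v') # (q, v) # w) ((- 1) ^ (q * q'))
      |c u q v q' v' w. (c, u @ (q, v) # (q', v') # w) \<in> ext_words C (hcomp V)}"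

abbreviation ext_word_prod ::
    "('c, 'm) dga_scheme \<Rightarrow> ('c, 'v) ext_word \<Rightarrow> ('c, 'v) ext_word \<Rightarrow> ('c, 'v) ext_word"
  where "ext_word_prod C \<equiv> (\<lambda>((p, c), u) ((p', c'), u'). ((p + p', c \<otimes>\<^bsub>C\<^esub> c'), u @ u'))"

abbreviation ext_word_sign :: "('c, 'v) ext_word \<Rightarrow> ('c, 'v) ext_word \<Rightarrow> rat"
  where "ext_word_sign \<equiv> (\<lambda>((p, c), u) ((p', c'), u'). (- 1) ^ (sum_list (map fst u) * p'))"

abbreviation ext_word_degree :: "('c, 'v) ext_word \<Rightarrow> nat"
  where "ext_word_degree \<equiv> (\<lambda>((p, c), u). p + sum_list (map fst u))"

lemma ext_space_eq:
  "ext_space C V = word_space (ext_words C (hcomp V)) (ext_word_prod C) ext_word_sign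
    ((0, \<one>\<^bsub>C\<^esub>), []) ext_word_degree"
  unfolding ext_space_def by (rule refl)

lemma ext_rels_eq: "ext_rels C V = lin_span (ext_space C V) (ext_gens C V)"
  unfolding ext_rels_def ext_gens_def ..

lemma ext_words_iff:
  "((p, c), u) \<in> ext_words C U \<longleftrightarrow> c \<in> hcomp C p \<and> (\<forall>q v. (q, v) \<in> set u \<longrightarrow> v \<in> U q)"
  by (auto simp: ext_words_def)

lemma ext_words_mono: "(\<And>q. U q \<subseteq> U' q) \<Longrightarrow> ext_words C U \<subseteq> ext_words C U'"
  by (fastforce simp: ext_words_def)

lemma ext_space_module: "rat_module (ext_space C V)"
  unfolding ext_space_eq by (rule word_space_module)

lemma ext_space_add [simp]: "add (ext_space C V) = (+)"
  by (simp add: ext_space_eq)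

lemma ext_dga_diff [simp]: "diff (ext_dga C V D) = D"
  by (simp add: ext_dga_def)

lemma ext_dga_carrier:
  "carrier (ext_dga C V D) = ext_class C V ` {f. supp f \<subseteq> ext_words C (hcomp V)}"
  by (auto simp: ext_dga_def ext_space_eq ext_class_def)

locale ext_algebra =
  fixes C :: "('c, 'm) dga_scheme" and V :: "'v graded" and D
  assumes C: "cdga C" and V: "graded_space V"
    and Ext: "cdga (ext_dga C V D)" and incl: "ext_incl C V \<in> cdga_hom C (ext_dga C V D)"

sublocale ext_algebra \<subseteq> C: cdga C by (rule C)
sublocale ext_algebra \<subseteq> V: graded_space V by (rule V)
sublocale ext_algebra \<subseteq> Ext: cdga "ext_dga C V D" by (rule Ext)

context ext_algebra
begin

abbreviation "words \<equiv> ext_words C (hcomp V)"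
abbreviation "CV \<equiv> ext_dga C V D"
abbreviation "class \<equiv> ext_class C V"
abbreviation "word_class x \<equiv> ext_class C V (word x 1)"

lemma ext_word_relations:
  "((p, c), u) \<in> words \<Longrightarrow> ((p, c'), u) \<in> words \<Longrightarrow>
    ((p, (s \<odot>\<^bsub>C\<^esub> c) \<oplus>\<^bsub>C\<^esub> (t \<odot>\<^bsub>C\<^esub> c')), u) \<in> words"
  "(a, u @ (q, v) # w) \<in> words \<Longrightarrow> (a, u @ (q, v') # w) \<in> words \<Longrightarrow>
    (a, u @ (q, (s \<odot>\<^bsub>V\<^esub> v) \<oplus>\<^bsub>V\<^esub> (t \<odot>\<^bsub>V\<^esub> v')) # w) \<in> words"
  "(a, u @ (q, v) # (q', v') # w) \<in> words \<Longrightarrow> (a, u @ (q', v') # (q, v) # w) \<in> words"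
  by (cases a; auto simp: ext_words_iff intro!: C.hcomp_add C.hcomp_smult V.hcomp_add V.hcomp_smult)+

text \<open>All three kinds of defining relations have the form \<open>x - s y - t z\<close> (with \<open>t = 0\<close> for the
  commutation relations), which allows a uniform treatment.\<close>

lemma ext_gens_cases:
  assumes "r \<in> ext_gens C V"
  obtains (scalar) p c c' s t u where "((p, c), u) \<in> words" "((p, c'), u) \<in> words"
      "r = word ((p, (s \<odot>\<^bsub>C\<^esub> c) \<oplus>\<^bsub>C\<^esub> (t \<odot>\<^bsub>C\<^esub> c')), u) 1
       - word ((p, c), u) s - word ((p, c'), u) t"
  | (letter) p c u q v v' s t w where "((p, c), u @ (q, v) # w) \<in> words" "((p, c), u @ (q, v') # w) \<in> words"
      "r = word ((p, c), u @ (q, (s \<odot>\<^bsub>V\<^esub> v) \<oplus>\<^bsub>V\<^esub> (t \<odot>\<^bsub>V\<^esub> v')) # w) 1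
       - word ((p, c), u @ (q, v) # w) s - word ((p, c), u @ (q, v') # w) t"
  | (swap) p c u q v q' v' w where "((p, c), u @ (q, v) # (q', v') # w) \<in> words"
      "r = word ((p, c), u @ (q, v) # (q', v') # w) 1
       - word ((p, c), u @ (q', v') # (q, v) # w) ((- 1) ^ (q * q'))
       - word ((p, c), u @ (q', v') # (q, v) # w) 0"
  using assms unfolding ext_gens_def by (elim UnE CollectE exE conjE) auto

lemma keys_relation:
  assumes "x \<in> B" "y \<in> B" "z \<in> B"
  shows "supp (word x 1 - word y s - word z t) \<subseteq> B"
  using assms by (auto dest!: subsetD[OF keys_diff_subset] subsetD[OF keys_single_subset])

lemma ext_gens_keys: "r \<in> ext_gens C V \<Longrightarrow> supp r \<subseteq> words"
  by (erule ext_gens_cases) (use ext_word_relations keys_relation in metis)+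

lemma ext_rels_submodule: "submodule (ext_rels C V) rat_field (ext_space C V)"
  unfolding ext_rels_eq
  by (rule rat_module.lin_span_submodule[OF ext_space_module])
    (use ext_gens_keys in \<open>auto simp: ext_space_eq\<close>)

lemma class_cong:
  assumes "supp g \<subseteq> words" "f - g \<in> ext_rels C V"
  shows "class f = class g"
  using rat_module.coset_shift[OF ext_space_module ext_rels_submodule assms(2), of g] assms(1)
  by (simp add: ext_class_def ext_space_eq)

lemma class_carrier: "supp f \<subseteq> words \<Longrightarrow> class f \<in> carrier CV"
  by (auto simp: ext_dga_carrier)

lemma class_zero: "class 0 = \<zero>\<^bsub>CV\<^esub>"
  using rat_module.coset_zero[OF ext_space_module ext_rels_submodule]
  by (simp add: ext_class_def ext_dga_def ext_space_eq)

lemma class_add: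
  assumes "supp f \<subseteq> words" "supp g \<subseteq> words"
  shows "class (f + g) = class f \<oplus>\<^bsub>CV\<^esub> class g"
  using rat_module.coset_add[OF ext_space_module ext_rels_submodule, of f g] assms
  by (simp add: ext_class_def ext_dga_def ext_space_eq)

lemma class_scale:
  assumes "supp f \<subseteq> words"
  shows "class (word_scale q f) = q \<odot>\<^bsub>CV\<^esub> class f"
  using rat_module.coset_smult[OF ext_space_module ext_rels_submodule, of f q] assms
  by (simp add: ext_class_def ext_dga_def ext_space_eq)

text \<open>Since \<open>C \<otimes> \<Lambda>V\<close> is a ring, the set-theoretic product of two cosets is itself a coset, and it
  is identified by any of its elements.\<close>

lemma class_mult:
  assumes f: "supp f \<subseteq> words" and g: "supp g \<subseteq> words"
  shows "class f \<otimes>\<^bsub>CV\<^esub> class g = class (word_mult (ext_word_prod C) ext_word_sign f g)"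
proof -
  let ?fg = "word_mult (ext_word_prod C) ext_word_sign f g"
  have "supp ?fg \<subseteq> words"
    using f g by (rule keys_word_mult) (auto simp: ext_words_def intro!: C.mult_hcomp)
  then have self: "f \<in> class f" "g \<in> class g" "?fg \<in> class ?fg"
    using rat_module.coset_self[OF ext_space_module ext_rels_submodule] f g
    by (simp_all add: ext_class_def ext_space_eq)
  have "class f \<otimes>\<^bsub>CV\<^esub> class g = (\<Union>a\<in>class f. \<Union>b\<in>class g. class (word_mult (ext_word_prod C) ext_word_sign a b))"
    by (simp add: ext_dga_def rcoset_mult_def ext_class_def ext_space_eq)
  then have "?fg \<in> class f \<otimes>\<^bsub>CV\<^esub> class g"
    using self by blast
  moreover obtain h where h: "supp h \<subseteq> words" "class f \<otimes>\<^bsub>CV\<^esub> class g = class h"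
    using Ext.m_closed[OF class_carrier[OF f] class_carrier[OF g]] by (auto simp: ext_dga_carrier)
  ultimately obtain i where "i \<in> ext_rels C V" "?fg = i + h"
    by (auto simp: ext_class_def rat_module.mem_coset_iff[OF ext_space_module])
  then have "class ?fg = class h"
    using h by (intro class_cong) auto
  then show ?thesis using h by simp
qed

lemma single_keys: "x \<in> words \<Longrightarrow> supp (word x (c :: rat)) \<subseteq> words"
  using keys_single_subset[of x c] by auto

lemma word_class_carrier: "x \<in> words \<Longrightarrow> word_class x \<in> carrier CV"
  by (intro class_carrier single_keys)

lemma word_class_relation:
  assumes "x \<in> words" "y \<in> words" "z \<in> words"
    "word x 1 - word y s - word z t \<in> ext_gens C V"
  shows "word_class x = s \<odot>\<^bsub>CV\<^esub> word_class y \<oplus>\<^bsub>CV\<^esub> t \<odot>\<^bsub>CV\<^esub> word_class z"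
proof -
  have "ext_gens C V \<subseteq> carrier (ext_space C V)"
    using ext_gens_keys by (auto simp: ext_space_eq)
  from rat_module.lin_span_superset[OF ext_space_module this assms(4)]
  have "word x 1 - (word y s + word z t) \<in> ext_rels C V"
    by (simp add: ext_rels_eq diff_diff_eq)
  moreover have "supp (word y s + word z t) \<subseteq> words"
    using keys_add[of "word y s" "word z t"] single_keys assms by blast
  ultimately have "word_class x = class (word y s + word z t)"
    by (intro class_cong)
  also have "\<dots> = class (word y s) \<oplus>\<^bsub>CV\<^esub> class (word z t)"
    using assms by (intro class_add single_keys)
  also have "class (word y s) = s \<odot>\<^bsub>CV\<^esub> word_class y"
    using class_scale[OF single_keys[OF assms(2), of 1], of s] by simp
  also have "class (word z t) = t \<odot>\<^bsub>CV\<^esub> word_class z"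
    using class_scale[OF single_keys[OF assms(3), of 1], of t] by simp
  finally show ?thesis .
qed

lemma word_class_hcomp: "x \<in> words \<Longrightarrow> word_class x \<in> hcomp CV (ext_word_degree x)"
  by (auto simp: ext_dga_def ext_space_eq ext_class_def intro!: imageI)

lemma ext_gen_word: "v \<in> hcomp V q \<Longrightarrow> ((0, \<one>\<^bsub>C\<^esub>), [(q, v)]) \<in> words"
  by (simp add: ext_words_iff C.one_hcomp)

lemma ext_gen_hcomp: "v \<in> hcomp V q \<Longrightarrow> ext_gen C V q v \<in> hcomp CV q"
  using word_class_hcomp[OF ext_gen_word] by (simp add: ext_gen_def)

lemma ext_gen_linear:
  assumes "v \<in> hcomp V q" "w \<in> hcomp V q"
  shows "ext_gen C V q ((s \<odot>\<^bsub>V\<^esub> v) \<oplus>\<^bsub>V\<^esub> (t \<odot>\<^bsub>V\<^esub> w)) =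
    s \<odot>\<^bsub>CV\<^esub> ext_gen C V q v \<oplus>\<^bsub>CV\<^esub> t \<odot>\<^bsub>CV\<^esub> ext_gen C V q w"
  unfolding ext_gen_def
proof (rule word_class_relation)
  have v: "((0, \<one>\<^bsub>C\<^esub>), [] @ (q, v) # []) \<in> words" and w: "((0, \<one>\<^bsub>C\<^esub>), [] @ (q, w) # []) \<in> words"
    using ext_gen_word assms by auto
  show "((0, \<one>\<^bsub>C\<^esub>), [(q, v)]) \<in> words" "((0, \<one>\<^bsub>C\<^esub>), [(q, w)]) \<in> words"
    using v w by auto
  show "((0, \<one>\<^bsub>C\<^esub>), [(q, (s \<odot>\<^bsub>V\<^esub> v) \<oplus>\<^bsub>V\<^esub> (t \<odot>\<^bsub>V\<^esub> w))]) \<in> words"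
    using ext_word_relations(2)[OF v w, of s t] by simp
  show "word ((0, \<one>\<^bsub>C\<^esub>), [(q, (s \<odot>\<^bsub>V\<^esub> v) \<oplus>\<^bsub>V\<^esub> (t \<odot>\<^bsub>V\<^esub> w))]) 1
      - word ((0, \<one>\<^bsub>C\<^esub>), [(q, v)]) s - word ((0, \<one>\<^bsub>C\<^esub>), [(q, w)]) t
    \<in> ext_gens C V"
    using v w unfolding ext_gens_def
    by (intro UnI1 UnI2 CollectI exI[of _ "(0, \<one>\<^bsub>C\<^esub>)"] exI[of _ "[]"] exI[of _ q] exI[of _ v] exI[of _ w]
        exI[of _ s] exI[of _ t]) auto
qed

lemma ext_gen_zero: "ext_gen C V q \<zero>\<^bsub>V\<^esub> = \<zero>\<^bsub>CV\<^esub>"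
  using ext_gen_linear[OF V.hcomp_zero V.hcomp_zero, of q 0 0] Ext.hcomp_carrier[OF ext_gen_hcomp[OF V.hcomp_zero]]
  by simp

text \<open>The inclusion sums over the nonzero components, so for \<open>c = 0\<close> it gives the empty sum; the word
  with entry \<open>0\<close> represents the same class only because of the linearity relations.\<close>

lemma incl_homogeneous:
  assumes c: "c \<in> hcomp C p"
  shows "ext_incl C V c = word_class ((p, c), [])"
proof (cases "c = \<zero>\<^bsub>C\<^esub>")
  case False
  then have "{n. decomp C c n \<noteq> \<zero>\<^bsub>C\<^esub>} = {p}"
    using C.decomp_homogeneous[OF c] by auto
  then show ?thesis
    using C.decomp_homogeneous[OF c] by (simp add: ext_incl_def)
next
  case True
  have w: "((p, c), []) \<in> words" using c by (simp add: ext_words_iff)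
  have "word ((p, c), []) 1
      - word ((p, c), []) 0 - word ((p, c), []) 0 \<in> ext_gens C V"
    unfolding ext_gens_def
    by (intro UnI1 CollectI exI[of _ p] exI[of _ c] exI[of _ "[]"] exI[of _ 0])
      (use w True in simp)
  from word_class_relation[OF w w w this] word_class_carrier[OF w]
  have "word_class ((p, c), []) = \<zero>\<^bsub>CV\<^esub>" by simp
  then show ?thesis
    using True by (simp add: ext_incl_def class_zero)
qed

lemma word_class_snoc:
  assumes "((p, c), u @ [(q, v)]) \<in> words"
  shows "word_class ((p, c), u @ [(q, v)]) = word_class ((p, c), u) \<otimes>\<^bsub>CV\<^esub> ext_gen C V q v"
proof -
  have w: "((p, c), u) \<in> words" "((0, \<one>\<^bsub>C\<^esub>), [(q, v)]) \<in> words" and c: "c \<in> carrier C"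
    using assms by (auto simp: ext_words_iff C.one_hcomp intro: C.hcomp_carrier)
  show ?thesis
    unfolding ext_gen_def class_mult[OF single_keys[OF w(1)] single_keys[OF w(2)]]
    using c by simp
qed

lemma carrier_eq_ext_sub: "carrier CV = ext_sub C V (hcomp V)"
  by (simp add: ext_sub_def ext_dga_carrier)

lemma incl_ext_sub: "c \<in> carrier C \<Longrightarrow> ext_incl C V c \<in> ext_sub C V U"
  unfolding ext_incl_def ext_sub_def
proof (rule imageI, rule CollectI, rule keys_sum_subset)
  fix p assume "c \<in> carrier C"
  then have "((p, decomp C c p), []) \<in> ext_words C U"
    by (simp add: ext_words_iff C.decomp_hcomp)
  then show "supp (word ((p, decomp C c p), []) 1) \<subseteq> ext_words C U"
    using keys_single_subset[of "((p, decomp C c p), [])" 1] by auto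
qed

text \<open>\<open>C \<otimes> \<Lambda>U\<close> is spanned by products of an element of \<open>C\<close> with generators from \<open>U\<close>, adjoined one at
  a time on the right.\<close>

lemma ext_sub_induct [consumes 2, case_names zero incl snoc linear]:
  assumes U: "\<And>q. U q \<subseteq> hcomp V q" and z: "z \<in> ext_sub C V U"
    and zero: "P \<zero>\<^bsub>CV\<^esub>"
    and incl: "\<And>c. c \<in> carrier C \<Longrightarrow> P (ext_incl C V c)"
    and snoc: "\<And>y n q v. y \<in> hcomp CV n \<Longrightarrow> P y \<Longrightarrow> v \<in> U q \<Longrightarrow> P (y \<otimes>\<^bsub>CV\<^esub> ext_gen C V q v)"
    and linear: "\<And>x y s. x \<in> carrier CV \<Longrightarrow> y \<in> carrier CV \<Longrightarrow> P x \<Longrightarrow> P y \<Longrightarrow> P (s \<odot>\<^bsub>CV\<^esub> x \<oplus>\<^bsub>CV\<^esub> y)"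
  shows "P z"
proof -
  have sub: "ext_words C U \<subseteq> words" by (rule ext_words_mono[OF U])
  have word: "P (word_class ((p, c), u))" if "((p, c), u) \<in> ext_words C U" for p c u
    using that
  proof (induction u rule: rev_induct)
    case Nil
    then have "c \<in> hcomp C p" by (simp add: ext_words_iff)
    then show ?case
      using incl[of c] by (simp add: incl_homogeneous C.hcomp_carrier)
  next
    case (snoc x u)
    obtain q v where x: "x = (q, v)" by (cases x)
    have w: "((p, c), u) \<in> ext_words C U" "v \<in> U q"
      using snoc.prems by (auto simp: ext_words_iff x)
    have "P (word_class ((p, c), u) \<otimes>\<^bsub>CV\<^esub> ext_gen C V q v)"
      using w sub snoc.IH by (intro assms(5)[OF word_class_hcomp]) auto
    then show ?case
      using snoc.prems sub word_class_snoc[of p c u q v] by (auto simp: x)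
  qed
  from z obtain f where f: "supp f \<subseteq> ext_words C U" "z = class f"
    by (auto simp: ext_sub_def)
  from f(1) have "P (class f)"
  proof (induction f rule: word_induct)
    case (add x a g)
    obtain p c u where x: "x = ((p, c), u)" by (metis prod.exhaust)
    have w: "x \<in> words" and g: "supp g \<subseteq> words" using add sub by auto
    have "class (word x a + g) = a \<odot>\<^bsub>CV\<^esub> word_class x \<oplus>\<^bsub>CV\<^esub> class g"
      using class_add[OF single_keys[OF w, of a] g] class_scale[OF single_keys[OF w, of 1], of a] by simp
    then show ?case
      using add word[of p c u] linear[OF word_class_carrier[OF w] class_carrier[OF g]] by (simp add: x)
  qed (simp add: class_zero zero)
  then show ?thesis using f by simp
qed

end

locale ext_extension = ext_algebra C V D
  for C :: "('c, 'm) dga_scheme" and V :: "'v graded" and D +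
  fixes E :: "('e, 'n) dga_scheme" and f
  assumes E: "cdga E" and f: "f \<in> cdga_hom C E"

sublocale ext_extension \<subseteq> E: cdga E by (rule E)

context ext_extension
begin

definition graded_linear :: "(nat \<Rightarrow> 'v \<Rightarrow> 'e) \<Rightarrow> bool"
  where "graded_linear l \<longleftrightarrow>
    (\<forall>q. linear_on V E (hcomp V q) (l q) \<and> (\<forall>v\<in>hcomp V q. l q v \<in> hcomp E q))"

definition word_image :: "(nat \<Rightarrow> 'v \<Rightarrow> 'e) \<Rightarrow> ('c, 'v) ext_word \<Rightarrow> 'e"
  where "word_image l = (\<lambda>((p, c), u). f c \<otimes>\<^bsub>E\<^esub> word_prod E l u)"

text \<open>The morphism of graded algebras determined by \<open>f\<close> and \<open>l\<close>.\<close>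

definition extend :: "(nat \<Rightarrow> 'v \<Rightarrow> 'e) \<Rightarrow> ('c, 'v) ext \<Rightarrow> 'e"
  where "extend l = on_cosets (word_eval E (word_image l))"

lemma graded_linear_combination:
  assumes l: "graded_linear l" and v: "v \<in> hcomp V q" and w: "w \<in> hcomp V q"
  shows "l q ((s \<odot>\<^bsub>V\<^esub> v) \<oplus>\<^bsub>V\<^esub> (t \<odot>\<^bsub>V\<^esub> w)) = s \<odot>\<^bsub>E\<^esub> l q v \<oplus>\<^bsub>E\<^esub> t \<odot>\<^bsub>E\<^esub> l q w"
proof -
  have lin: "l q (a \<oplus>\<^bsub>V\<^esub> r \<odot>\<^bsub>V\<^esub> b) = l q a \<oplus>\<^bsub>E\<^esub> r \<odot>\<^bsub>E\<^esub> l q b"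
    if "a \<in> hcomp V q" "b \<in> hcomp V q" for a b r
    using l that unfolding graded_linear_def linear_on_def by blast
  have carr: "l q a \<in> carrier E" if "a \<in> hcomp V q" for a
    using l that unfolding graded_linear_def by blast
  have "l q \<zero>\<^bsub>V\<^esub> = \<zero>\<^bsub>E\<^esub>"
    using lin[of "\<zero>\<^bsub>V\<^esub>" "\<zero>\<^bsub>V\<^esub>" "-1"] carr[of "\<zero>\<^bsub>V\<^esub>"] by (simp add: E.smult_minus_1 E.r_neg)
  then have "l q (s \<odot>\<^bsub>V\<^esub> v) = s \<odot>\<^bsub>E\<^esub> l q v"
    using lin[of "\<zero>\<^bsub>V\<^esub>" v s] v carr[OF v] by (simp add: V.hcomp_carrier)
  then show ?thesis
    using lin[OF V.hcomp_smult[OF v] w, of s t] by simp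
qed

context
  fixes l
  assumes l: "graded_linear l"
begin

lemma l_hcomp: "v \<in> hcomp V q \<Longrightarrow> l q v \<in> hcomp E q"
  using l by (simp add: graded_linear_def)

lemma word_letters: "((p, c), u) \<in> words \<Longrightarrow> (q, v) \<in> set u \<Longrightarrow> l q v \<in> hcomp E q"
  using l_hcomp by (auto simp: ext_words_iff)

lemma word_prod_words: "((p, c), u) \<in> words \<Longrightarrow> word_prod E l u \<in> hcomp E (sum_list (map fst u))"
  by (rule E.word_prod_hcomp) (rule word_letters)

lemma f_words: "((p, c), u) \<in> words \<Longrightarrow> f c \<in> hcomp E p"
  by (auto simp: ext_words_iff cdga_hom_hcomp[OF f])

lemma word_image_hcomp: "x \<in> words \<Longrightarrow> word_image l x \<in> hcomp E (ext_word_degree x)"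
  by (cases x) (auto simp: word_image_def intro!: E.mult_hcomp f_words word_prod_words)

lemma word_image_mult:
  assumes "x \<in> words" "y \<in> words"
  shows "ext_word_sign x y \<odot>\<^bsub>E\<^esub> word_image l (ext_word_prod C x y) = word_image l x \<otimes>\<^bsub>E\<^esub> word_image l y"
proof -
  obtain p c u p' c' u' where x: "x = ((p, c), u)" and y: "y = ((p', c'), u')"
    by (metis prod.exhaust)
  note wx = assms(1)[unfolded x] and wy = assms(2)[unfolded y]
  let ?W = "word_prod E l u" and ?W' = "word_prod E l u'"
  note W = word_prod_words[OF wx] word_prod_words[OF wy] f_words[OF wx] f_words[OF wy]
  note Wc = W[THEN E.hcomp_carrier]
  have c: "c \<in> carrier C" "c' \<in> carrier C"
    using wx wy by (auto simp: ext_words_iff)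
  have W_app: "word_prod E l (u @ u') = ?W \<otimes>\<^bsub>E\<^esub> ?W'"
    using word_letters[OF wx] word_letters[OF wy] by (intro E.word_prod_append) auto
  have "word_image l x \<otimes>\<^bsub>E\<^esub> word_image l y = f c \<otimes>\<^bsub>E\<^esub> ((?W \<otimes>\<^bsub>E\<^esub> f c') \<otimes>\<^bsub>E\<^esub> ?W')"
    using Wc by (simp add: x y word_image_def E.m_assoc)
  also have "?W \<otimes>\<^bsub>E\<^esub> f c' = (- 1) ^ (sum_list (map fst u) * p') \<odot>\<^bsub>E\<^esub> (f c' \<otimes>\<^bsub>E\<^esub> ?W)"
    by (rule E.graded_comm[OF W(1) W(4)])
  also have "f c \<otimes>\<^bsub>E\<^esub> (\<dots> \<otimes>\<^bsub>E\<^esub> ?W') =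
      (- 1) ^ (sum_list (map fst u) * p') \<odot>\<^bsub>E\<^esub> ((f c \<otimes>\<^bsub>E\<^esub> f c') \<otimes>\<^bsub>E\<^esub> (?W \<otimes>\<^bsub>E\<^esub> ?W'))"
    using Wc by (simp add: E.smult_mult_left E.smult_mult_right E.m_assoc)
  also have "\<dots> = ext_word_sign x y \<odot>\<^bsub>E\<^esub> word_image l (ext_word_prod C x y)"
    using c by (simp add: x y word_image_def W_app cdga_hom_mult[OF f])
  finally show ?thesis ..
qed

lemma word_image_gens:
  assumes "r \<in> ext_gens C V"
  shows "supp r \<subseteq> words \<and> word_eval E (word_image l) r = \<zero>\<^bsub>E\<^esub>"
proof -
  have wc: "\<And>x. x \<in> words \<Longrightarrow> word_image l x \<in> carrier E"
    using word_image_hcomp by blast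
  from assms show ?thesis
  proof (cases rule: ext_gens_cases)
    case (scalar p c c' s t u)
    note w = scalar(1,2) ext_word_relations(1)[OF scalar(1,2), of s t]
    have c: "c \<in> carrier C" "c' \<in> carrier C"
      using w by (auto simp: ext_words_iff)
    note W = E.hcomp_carrier[OF word_prod_words[OF w(1)]] cdga_hom_carrier[OF f c(1)] cdga_hom_carrier[OF f c(2)]
    have "word_image l ((p, (s \<odot>\<^bsub>C\<^esub> c) \<oplus>\<^bsub>C\<^esub> (t \<odot>\<^bsub>C\<^esub> c')), u) =
        s \<odot>\<^bsub>E\<^esub> word_image l ((p, c), u) \<oplus>\<^bsub>E\<^esub> t \<odot>\<^bsub>E\<^esub> word_image l ((p, c'), u)"
      using c W by (simp add: word_image_def cdga_hom_add[OF f] cdga_hom_smult[OF f] E.l_distr E.smult_mult_left)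
    from E.word_eval_relation[OF wc w(3) w(1) w(2) this] show ?thesis
      unfolding scalar(3) .
  next
    case (letter p c u q v v' s t w)
    note w' = letter(1,2) ext_word_relations(2)[OF letter(1,2), of s t]
    have v: "v \<in> hcomp V q" "v' \<in> hcomp V q"
      using w' by (auto simp: ext_words_iff)
    have "word_prod E l (u @ (q, (s \<odot>\<^bsub>V\<^esub> v) \<oplus>\<^bsub>V\<^esub> (t \<odot>\<^bsub>V\<^esub> v')) # w) =
        s \<odot>\<^bsub>E\<^esub> word_prod E l (u @ (q, v) # w) \<oplus>\<^bsub>E\<^esub> t \<odot>\<^bsub>E\<^esub> word_prod E l (u @ (q, v') # w)"
      by (rule E.word_prod_relation)
        (use word_letters[OF w'(1)] l_hcomp[OF v(1)] l_hcomp[OF v(2)]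
          graded_linear_combination[OF l v] in auto)
    moreover note W = E.hcomp_carrier[OF word_prod_words[OF w'(1)]]
      E.hcomp_carrier[OF word_prod_words[OF w'(2)]] E.hcomp_carrier[OF f_words[OF w'(1)]]
    ultimately have "word_image l ((p, c), u @ (q, (s \<odot>\<^bsub>V\<^esub> v) \<oplus>\<^bsub>V\<^esub> (t \<odot>\<^bsub>V\<^esub> v')) # w) =
        s \<odot>\<^bsub>E\<^esub> word_image l ((p, c), u @ (q, v) # w) \<oplus>\<^bsub>E\<^esub> t \<odot>\<^bsub>E\<^esub> word_image l ((p, c), u @ (q, v') # w)"
      by (simp add: word_image_def E.r_distr E.smult_mult_right)
    from E.word_eval_relation[OF wc w'(3) w'(1) w'(2) this] show ?thesis
      unfolding letter(3) .
  next
    case (swap p c u q v q' v' w)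
    note w' = swap(1) ext_word_relations(3)[OF swap(1)]
    have v: "v \<in> hcomp V q" "v' \<in> hcomp V q'"
      using w' by (auto simp: ext_words_iff)
    note lv = l_hcomp[OF v(1)] l_hcomp[OF v(2)]
    have u: "((p, c), u) \<in> words" "((p, c), w) \<in> words"
      using w' by (auto simp: ext_words_iff)
    note W = E.hcomp_carrier[OF word_prod_words[OF u(1)]] E.hcomp_carrier[OF word_prod_words[OF u(2)]]
      E.hcomp_carrier[OF f_words[OF u(1)]] lv[THEN E.hcomp_carrier]
    have app: "word_prod E l (u @ (a, x) # (b, y) # w) =
        word_prod E l u \<otimes>\<^bsub>E\<^esub> ((l a x \<otimes>\<^bsub>E\<^esub> l b y) \<otimes>\<^bsub>E\<^esub> word_prod E l w)"
      if "l a x \<in> hcomp E a" "l b y \<in> hcomp E b" for a x b y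
      using E.word_prod_append[of u "(a, x) # (b, y) # w" l] word_letters[OF u(1)] word_letters[OF u(2)] that
        W(2) that[THEN E.hcomp_carrier]
      by (auto simp: E.m_assoc)
    have "word_image l ((p, c), u @ (q, v) # (q', v') # w) =
        (- 1) ^ (q * q') \<odot>\<^bsub>E\<^esub> word_image l ((p, c), u @ (q', v') # (q, v) # w)"
      using W E.graded_comm[OF lv]
      by (simp add: word_image_def app lv E.smult_mult_left E.smult_mult_right)
    then have "word_image l ((p, c), u @ (q, v) # (q', v') # w) =
        (- 1) ^ (q * q') \<odot>\<^bsub>E\<^esub> word_image l ((p, c), u @ (q', v') # (q, v) # w) \<oplus>\<^bsub>E\<^esub>
        0 \<odot>\<^bsub>E\<^esub> word_image l ((p, c), u @ (q', v') # (q, v) # w)"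
      using wc[OF w'(2)] by simp
    from E.word_eval_relation[OF wc w'(1) w'(2) w'(2) this] show ?thesis
      unfolding swap(2) .
  qed
qed

lemma ext_word_morphism:
  "word_morphism E words (ext_word_prod C) ext_word_sign ((0, \<one>\<^bsub>C\<^esub>), []) ext_word_degree
    (ext_gens C V) (word_image l)"
proof (unfold_locales)
  show "ext_word_prod C x y \<in> words" if "x \<in> words" "y \<in> words" for x y
    using that by (auto simp: ext_words_def intro!: C.mult_hcomp)
  show "((0, \<one>\<^bsub>C\<^esub>), []) \<in> words"
    by (simp add: ext_words_iff C.one_hcomp)
  show "word_image l ((0, \<one>\<^bsub>C\<^esub>), []) = \<one>\<^bsub>E\<^esub>"
    by (simp add: word_image_def cdga_hom_one[OF f])
qed (use word_image_hcomp word_image_mult word_image_gens in blast)+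

lemma extend_class:
  assumes "supp g \<subseteq> words"
  shows "extend l (class g) = word_eval E (word_image l) g"
  unfolding extend_def ext_class_def ext_rels_eq ext_space_eq
  by (rule word_morphism.quot_eval[OF ext_word_morphism assms])

lemma CV_graded_quot:
  "carrier CV = carrier (graded_quot (ext_space C V) (ext_rels C V))"
  "monoid.mult CV = monoid.mult (graded_quot (ext_space C V) (ext_rels C V))"
  "one CV = one (graded_quot (ext_space C V) (ext_rels C V))"
  "add CV = add (graded_quot (ext_space C V) (ext_rels C V))"
  "module.smult CV = module.smult (graded_quot (ext_space C V) (ext_rels C V))"
  "hcomp CV = hcomp (graded_quot (ext_space C V) (ext_rels C V))"
  by (simp_all add: ext_dga_def)

lemma extend_carrier: "x \<in> carrier CV \<Longrightarrow> extend l x \<in> carrier E"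
  unfolding CV_graded_quot extend_def ext_rels_eq ext_space_eq
  by (rule word_morphism.quot_closed[OF ext_word_morphism])

lemma extend_mult:
  "x \<in> carrier CV \<Longrightarrow> y \<in> carrier CV \<Longrightarrow> extend l (x \<otimes>\<^bsub>CV\<^esub> y) = extend l x \<otimes>\<^bsub>E\<^esub> extend l y"
  unfolding CV_graded_quot extend_def ext_rels_eq ext_space_eq
  by (rule word_morphism.quot_mult[OF ext_word_morphism])

lemma extend_add:
  "x \<in> carrier CV \<Longrightarrow> y \<in> carrier CV \<Longrightarrow> extend l (x \<oplus>\<^bsub>CV\<^esub> y) = extend l x \<oplus>\<^bsub>E\<^esub> extend l y"
  unfolding CV_graded_quot extend_def ext_rels_eq ext_space_eq
  by (rule word_morphism.quot_add[OF ext_word_morphism])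

lemma extend_smult: "x \<in> carrier CV \<Longrightarrow> extend l (q \<odot>\<^bsub>CV\<^esub> x) = q \<odot>\<^bsub>E\<^esub> extend l x"
  unfolding CV_graded_quot extend_def ext_rels_eq ext_space_eq
  by (rule word_morphism.quot_smult[OF ext_word_morphism])

lemma extend_one: "extend l \<one>\<^bsub>CV\<^esub> = \<one>\<^bsub>E\<^esub>"
  unfolding CV_graded_quot extend_def ext_rels_eq ext_space_eq
  by (rule word_morphism.quot_one[OF ext_word_morphism])

lemma extend_hcomp: "x \<in> hcomp CV n \<Longrightarrow> extend l x \<in> hcomp E n"
  unfolding CV_graded_quot extend_def ext_rels_eq ext_space_eq
  by (rule word_morphism.quot_hcomp[OF ext_word_morphism])

lemma extend_zero: "extend l \<zero>\<^bsub>CV\<^esub> = \<zero>\<^bsub>E\<^esub>"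
  using extend_class[of 0] by (simp add: class_zero)

lemma extend_word_class: "x \<in> words \<Longrightarrow> extend l (word_class x) = word_image l x"
  using extend_class[OF single_keys, of x 1] word_image_hcomp[of x]
    E.word_eval_single[of words "word_image l" x 1, OF E.hcomp_carrier[OF word_image_hcomp]]
  by (simp add: E.hcomp_carrier)

lemma extend_gen: "v \<in> hcomp V q \<Longrightarrow> extend l (ext_gen C V q v) = l q v"
  using extend_word_class[OF ext_gen_word] l_hcomp[of v q] cdga_hom_one[OF f]
  by (simp add: ext_gen_def word_image_def E.hcomp_carrier)

lemma extend_incl: "c \<in> carrier C \<Longrightarrow> extend l (ext_incl C V c) = f c"
proof (induction c rule: C.graded_induct)
  case zero
  then show ?case
    using cdga_hom_zero[OF C Ext incl] cdga_hom_zero[OF C E f] by (simp add: extend_zero)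
next
  case (add n a c)
  have a: "a \<in> carrier C" using add by blast
  have "((n, a), []) \<in> words" using add by (simp add: ext_words_iff)
  then have "extend l (ext_incl C V a) = f a"
    using add cdga_hom_carrier[OF f a] by (simp add: incl_homogeneous extend_word_class word_image_def)
  then show ?case
    using add a by (simp add: cdga_hom_add[OF incl] cdga_hom_add[OF f] cdga_hom_carrier[OF incl] extend_add)
qed

text \<open>A morphism of algebras commutes with the differentials on the subalgebra generated by \<open>C\<close>
  and \<open>U\<close> as soon as it does so on the generators, by the Leibniz rule.\<close>

lemma extend_diff:
  assumes U: "\<And>q. U q \<subseteq> hcomp V q"
    and gen: "\<And>q v. v \<in> U q \<Longrightarrow> diff E (l q v) = extend l (D (ext_gen C V q v))"
    and z: "z \<in> ext_sub C V U"
  shows "diff E (extend l z) = extend l (D z)"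
  using U z
proof (induction rule: ext_sub_induct)
  case zero
  then show ?case
    using Ext.diff_zero by (simp add: extend_zero)
next
  case (incl c)
  note c = incl
  have "D (ext_incl C V c) = ext_incl C V (diff C c)"
    using cdga_hom_diff[OF ext_algebra.incl[OF ext_algebra_axioms] c] by simp
  then show ?case
    using c by (simp add: extend_incl cdga_hom_diff[OF f])
next
  case (snoc y n q v)
  have v: "v \<in> hcomp V q" using snoc U by blast
  note gen_h = ext_gen_hcomp[OF v]
  have carr: "y \<in> carrier CV" "ext_gen C V q v \<in> carrier CV"
    "D y \<in> carrier CV" "D (ext_gen C V q v) \<in> carrier CV"
    using snoc gen_h Ext.diff_carrier[of y] Ext.diff_carrier[of "ext_gen C V q v"]
    by (auto simp: Ext.hcomp_carrier)
  have "diff E (extend l (y \<otimes>\<^bsub>CV\<^esub> ext_gen C V q v)) = diff E (extend l y \<otimes>\<^bsub>E\<^esub> l q v)"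
    using carr v by (simp add: extend_mult extend_gen)
  also have "\<dots> = diff E (extend l y) \<otimes>\<^bsub>E\<^esub> l q v \<oplus>\<^bsub>E\<^esub> (- 1) ^ n \<odot>\<^bsub>E\<^esub> (extend l y \<otimes>\<^bsub>E\<^esub> diff E (l q v))"
    by (rule E.diff_mult[OF extend_hcomp[OF snoc(1)] l_hcomp[OF v]])
  also have "\<dots> = extend l (D y \<otimes>\<^bsub>CV\<^esub> ext_gen C V q v \<oplus>\<^bsub>CV\<^esub>
      (- 1) ^ n \<odot>\<^bsub>CV\<^esub> (y \<otimes>\<^bsub>CV\<^esub> D (ext_gen C V q v)))"
    using carr v snoc gen[OF snoc(2)] by (simp add: extend_mult extend_add extend_smult extend_gen)
  also have "D y \<otimes>\<^bsub>CV\<^esub> ext_gen C V q v \<oplus>\<^bsub>CV\<^esub> (- 1) ^ n \<odot>\<^bsub>CV\<^esub> (y \<otimes>\<^bsub>CV\<^esub> D (ext_gen C V q v)) =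
      D (y \<otimes>\<^bsub>CV\<^esub> ext_gen C V q v)"
    using Ext.diff_mult[OF snoc(1) gen_h] by simp
  finally show ?case .
next
  case (linear x y s)
  then show ?case
    using Ext.diff_carrier[of x] Ext.diff_carrier[of y] Ext.diff_add[of "s \<odot>\<^bsub>CV\<^esub> x" y] Ext.diff_smult[of x s]
    by (simp add: extend_add extend_smult extend_carrier E.diff_add E.diff_smult)
qed

end

text \<open>A partial lift is a linear map on all of \<open>V\<close> that respects the differential on a subspace only.
  Two such maps that agree on \<open>U\<close> extend to the same map on \<open>C \<otimes> \<Lambda>U\<close>; in this way the stages of the
  construction are compared inside \<open>C \<otimes> \<Lambda>V\<close>, without identifying \<open>C \<otimes> \<Lambda>U\<close> with an abstract
  Sullivan algebra on \<open>U\<close>.\<close>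

lemma extend_cong:
  assumes l: "graded_linear l" "graded_linear l'" and U: "\<And>q. U q \<subseteq> hcomp V q"
    and l_eq: "\<And>q v. v \<in> U q \<Longrightarrow> l q v = l' q v" and z: "z \<in> ext_sub C V U"
  shows "extend l z = extend l' z"
  using U z
proof (induction rule: ext_sub_induct)
  case (snoc y n q v)
  have v: "v \<in> hcomp V q" using snoc U by blast
  then show ?case
    using snoc l_eq[OF snoc(2)] ext_gen_hcomp[OF v]
    by (simp add: extend_mult l extend_gen Ext.hcomp_carrier)
qed (simp_all add: extend_zero extend_incl extend_add extend_smult l)

end

locale sullivan_lifting = ext_extension C V D E f
  for C :: "('c, 'm) dga_scheme" and V :: "'v graded" and D and E :: "('e, 'n) dga_scheme" and f +
  fixes Q :: "('q, 'k) dga_scheme" and g and p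
  assumes g: "g \<in> cdga_hom (ext_dga C V D) Q" and p_lifts: "lifts_cocycles E Q p"
    and square: "\<And>c. c \<in> carrier C \<Longrightarrow> p (f c) = g (ext_incl C V c)"
begin

lemma p: "p \<in> cdga_hom E Q"
  using p_lifts by (simp add: lifts_cocycles_def)

lemma p_zero: "p \<zero>\<^bsub>E\<^esub> = g \<zero>\<^bsub>CV\<^esub>"
  using square[of "\<zero>\<^bsub>C\<^esub>"] cdga_hom_zero[OF C Ext incl] cdga_hom_zero[OF C E f] by simp

lemma p_extend:
  assumes l: "graded_linear l" and U: "\<And>q. U q \<subseteq> hcomp V q"
    and gen: "\<And>q v. v \<in> U q \<Longrightarrow> p (l q v) = g (ext_gen C V q v)"
    and z: "z \<in> ext_sub C V U"
  shows "p (extend l z) = g z"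
  using U z
proof (induction rule: ext_sub_induct)
  case (snoc y n q v)
  have v: "v \<in> hcomp V q" using snoc U by blast
  then have "l q v \<in> carrier E"
    using l_hcomp[OF l] by blast
  then show ?case
    using v snoc gen[OF snoc(2)] ext_gen_hcomp[OF v]
    by (simp add: extend_mult[OF l] extend_gen[OF l] Ext.hcomp_carrier extend_carrier[OF l]
        cdga_hom_mult[OF p] cdga_hom_mult[OF g])
next
  case (linear x y s)
  then show ?case
    by (simp add: extend_add[OF l] extend_smult[OF l] extend_carrier[OF l]
        cdga_hom_add[OF p] cdga_hom_add[OF g] cdga_hom_smult[OF p] cdga_hom_smult[OF g])
qed (simp_all add: extend_zero[OF l] extend_incl[OF l] p_zero square)

definition lifts_on :: "(nat \<Rightarrow> 'v set) \<Rightarrow> (nat \<Rightarrow> 'v \<Rightarrow> 'e) \<Rightarrow> bool"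
  where "lifts_on U l \<longleftrightarrow> graded_linear l \<and>
    (\<forall>q. \<forall>v\<in>U q. p (l q v) = g (ext_gen C V q v) \<and> diff E (l q v) = extend l (D (ext_gen C V q v)))"

text \<open>One stage of the filtration: for \<open>v\<close> in \<open>U'\<close> the element \<open>D v\<close> lies in \<open>C \<otimes> \<Lambda>U\<close>, so the
  partial lift sends it to a cocycle, and the lifting property of \<open>p\<close> provides a value at \<open>v\<close>.
  The admissible pairs \<open>(v, x)\<close> form a linear relation, so the values can be chosen linearly in
  \<open>v\<close> without changing those on \<open>U\<close>.\<close>

lemma lifts_on_step:
  assumes l: "lifts_on U l"
    and U: "\<And>q. submodule (U q) rat_field V" and U': "\<And>q. submodule (U' q) rat_field V"
    and UU': "\<And>q. U q \<subseteq> U' q" "\<And>q. U' q \<subseteq> hcomp V q"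
    and D: "\<And>q v. v \<in> U' q \<Longrightarrow> D (ext_gen C V q v) \<in> ext_sub C V U"
  shows "\<exists>l'. lifts_on U' l' \<and> (\<forall>q. \<forall>v\<in>U q. l' q v = l q v)"
proof -
  have lin: "graded_linear l"
    and lU: "\<And>q v. v \<in> U q \<Longrightarrow> p (l q v) = g (ext_gen C V q v)"
      "\<And>q v. v \<in> U q \<Longrightarrow> diff E (l q v) = extend l (D (ext_gen C V q v))"
    using l by (auto simp: lifts_on_def)
  have Uh: "U q \<subseteq> hcomp V q" for q using UU' by blast
  have ex: "\<exists>m. linear_on V E (hcomp V q) m \<and> (\<forall>v\<in>hcomp V q. m v \<in> hcomp E q) \<and>
      (\<forall>v\<in>U' q. p (m v) = g (ext_gen C V q v) \<and> diff E (m v) = extend l (D (ext_gen C V q v))) \<and>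
      (\<forall>v\<in>U q. m v = l q v)" for q
  proof -
    define L where "L = {(v, x). v \<in> U' q \<and> x \<in> hcomp E q \<and> p x = g (ext_gen C V q v) \<and>
      diff E x = extend l (D (ext_gen C V q v))}"
    have LI: "(v, x) \<in> L" if "v \<in> U' q" "x \<in> hcomp E q" "p x = g (ext_gen C V q v)"
      "diff E x = extend l (D (ext_gen C V q v))" for v x
      using that by (simp add: L_def)
    have mods: "rat_module V" "rat_module E"
      using V.rat_module_axioms E.rat_module_axioms by auto
    have gen_carr: "ext_gen C V q v \<in> carrier CV" "D (ext_gen C V q v) \<in> carrier CV" if "v \<in> hcomp V q" for v
      using ext_gen_hcomp[OF that] Ext.diff_carrier[of "ext_gen C V q v"] by (auto simp: Ext.hcomp_carrier)
    obtain k where k: "linear_on V E (U' q) k" "\<And>v. v \<in> U' q \<Longrightarrow> (v, k v) \<in> L"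
      "\<And>v. v \<in> U q \<Longrightarrow> k v = l q v"
    proof (rule linear_selection[OF mods U'[of q] U[of q] UU'(1)[of q], where L = L and ?l0.0 = "l q"])
      show "v \<in> U' q \<and> x \<in> carrier E" if "(v, x) \<in> L" for v x
        using that by (auto simp: L_def)
      show "(v \<oplus>\<^bsub>V\<^esub> s \<odot>\<^bsub>V\<^esub> w, x \<oplus>\<^bsub>E\<^esub> s \<odot>\<^bsub>E\<^esub> y) \<in> L" if vx: "(v, x) \<in> L" and wy: "(w, y) \<in> L" for v x w y s
      proof -
        have v: "v \<in> U' q" "v \<in> hcomp V q" "x \<in> hcomp E q" "p x = g (ext_gen C V q v)"
          "diff E x = extend l (D (ext_gen C V q v))"
          and w: "w \<in> U' q" "w \<in> hcomp V q" "y \<in> hcomp E q" "p y = g (ext_gen C V q w)"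
          "diff E y = extend l (D (ext_gen C V q w))"
          using vx wy UU' by (auto simp: L_def)
        have xy: "x \<in> carrier E" "y \<in> carrier E" using v w by auto
        have gen: "ext_gen C V q (v \<oplus>\<^bsub>V\<^esub> s \<odot>\<^bsub>V\<^esub> w) = ext_gen C V q v \<oplus>\<^bsub>CV\<^esub> s \<odot>\<^bsub>CV\<^esub> ext_gen C V q w"
          using ext_gen_linear[OF v(2) w(2), of 1 s] gen_carr[OF v(2)] v(2) by (simp add: V.hcomp_carrier)
        have Dgen: "D (ext_gen C V q v \<oplus>\<^bsub>CV\<^esub> s \<odot>\<^bsub>CV\<^esub> ext_gen C V q w) =
            D (ext_gen C V q v) \<oplus>\<^bsub>CV\<^esub> s \<odot>\<^bsub>CV\<^esub> D (ext_gen C V q w)"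
          using gen_carr(1)[OF v(2)] gen_carr(1)[OF w(2)]
            Ext.diff_add[of "ext_gen C V q v" "s \<odot>\<^bsub>CV\<^esub> ext_gen C V q w"] Ext.diff_smult[of "ext_gen C V q w" s]
          by simp
        show ?thesis
        proof (rule LI)
          show "v \<oplus>\<^bsub>V\<^esub> s \<odot>\<^bsub>V\<^esub> w \<in> U' q"
            using v w V.submodule_add[OF U'] V.submodule_smult[OF U'] by blast
          show "x \<oplus>\<^bsub>E\<^esub> s \<odot>\<^bsub>E\<^esub> y \<in> hcomp E q"
            using v w by (intro E.hcomp_add E.hcomp_smult)
          show "p (x \<oplus>\<^bsub>E\<^esub> s \<odot>\<^bsub>E\<^esub> y) = g (ext_gen C V q (v \<oplus>\<^bsub>V\<^esub> s \<odot>\<^bsub>V\<^esub> w))"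
            unfolding gen using v w xy gen_carr
            by (simp add: cdga_hom_add[OF p] cdga_hom_smult[OF p] cdga_hom_add[OF g] cdga_hom_smult[OF g])
          show "diff E (x \<oplus>\<^bsub>E\<^esub> s \<odot>\<^bsub>E\<^esub> y) = extend l (D (ext_gen C V q (v \<oplus>\<^bsub>V\<^esub> s \<odot>\<^bsub>V\<^esub> w)))"
            unfolding gen Dgen using v w xy gen_carr
            by (simp add: E.diff_add E.diff_smult extend_add[OF lin] extend_smult[OF lin])
        qed
      qed
      show "\<exists>x. (v, x) \<in> L" if v: "v \<in> U' q" for v
      proof -
        have vh: "v \<in> hcomp V q" using v UU' by blast
        note gen_h = ext_gen_hcomp[OF vh]
        let ?e = "extend l (D (ext_gen C V q v))"
        have "?e \<in> hcomp E (Suc q)"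
          using extend_hcomp[OF lin] Ext.diff_hcomp[OF gen_h] by simp
        moreover have "diff E ?e = \<zero>\<^bsub>E\<^esub>"
          using extend_diff[OF lin Uh lU(2) D[OF v]] Ext.diff_diff[OF gen_carr(1)[OF vh]]
          by (simp add: extend_zero[OF lin])
        moreover have "p ?e = diff Q (g (ext_gen C V q v))"
          using p_extend[OF lin Uh lU(1) D[OF v]] cdga_hom_diff[OF g gen_carr(1)[OF vh]] by simp
        moreover have "g (ext_gen C V q v) \<in> hcomp Q q"
          using cdga_hom_hcomp[OF g gen_h] .
        ultimately obtain x where "x \<in> hcomp E q" "p x = g (ext_gen C V q v)" "diff E x = ?e"
          using p_lifts unfolding lifts_cocycles_def by blast
        then show ?thesis
          using LI[OF v] by blast
      qed
      show "(v, l q v) \<in> L" if "v \<in> U q" for v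
        using that UU' lU l_hcomp[OF lin] by (intro LI) blast+
      show "linear_on V E (U q) (l q)"
        using lin Uh[of q] unfolding graded_linear_def linear_on_def by blast
    qed (use that in blast)
    \<comment> \<open>Extended to \<open>V\<^sup>q\<close> by linear algebra alone: no condition is imposed outside \<open>U'\<close>.\<close>
    obtain m where m: "linear_on V E (hcomp V q) m" "\<And>v. v \<in> hcomp V q \<Longrightarrow> (v, m v) \<in> hcomp V q \<times> hcomp E q"
      "\<And>v. v \<in> U' q \<Longrightarrow> m v = k v"
    proof (rule linear_selection[OF mods V.hcomp_submodule[of q] U'[of q] UU'(2)[of q],
          where L = "hcomp V q \<times> hcomp E q" and ?l0.0 = k])
      show "(v, k v) \<in> hcomp V q \<times> hcomp E q" if "v \<in> U' q" for v
        using k(2)[OF that] that UU'(2)[of q] by (auto simp: L_def)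
      show "\<exists>x. (v, x) \<in> hcomp V q \<times> hcomp E q" if "v \<in> hcomp V q" for v
        using that E.hcomp_zero by blast
    qed (auto simp: k intro!: V.hcomp_add V.hcomp_smult E.hcomp_add E.hcomp_smult)
    show ?thesis
    proof (intro exI[of _ m] conjI ballI)
      show "m v = l q v" if "v \<in> U q" for v
        using m(3)[of v] k(3)[OF that] UU'(1)[of q] that by auto
      show "p (m v) = g (ext_gen C V q v)" "diff E (m v) = extend l (D (ext_gen C V q v))" if "v \<in> U' q" for v
        using k(2)[OF that] m(3)[OF that] by (auto simp: L_def)
    qed (use m in auto)
  qed
  then obtain l' where l': "\<And>q. linear_on V E (hcomp V q) (l' q)" "\<And>q v. v \<in> hcomp V q \<Longrightarrow> l' q v \<in> hcomp E q"
    "\<And>q v. v \<in> U' q \<Longrightarrow> p (l' q v) = g (ext_gen C V q v) \<and> diff E (l' q v) = extend l (D (ext_gen C V q v))"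
    "\<And>q v. v \<in> U q \<Longrightarrow> l' q v = l q v"
    by metis
  have lin': "graded_linear l'"
    using l' by (simp add: graded_linear_def)
  have "extend l (D (ext_gen C V q v)) = extend l' (D (ext_gen C V q v))" if "v \<in> U' q" for q v
    using l'(4) D[OF that] by (intro extend_cong[OF lin lin' Uh]) auto
  then have "lifts_on U' l'"
    using lin' l'(3) by (simp add: lifts_on_def)
  then show ?thesis
    using l'(4) by blast
qed

end

text \<open>The stages agree on the smaller subspaces, so they glue to a linear map on the union \<open>V\<close> that
  respects the differential everywhere.\<close>

theorem relative_sullivan_lift:
  fixes C :: "('c, 'm) dga_scheme" and V :: "'v graded" and E :: "('e, 'n) dga_scheme"
    and Q :: "('q, 'k) dga_scheme"
  assumes S: "relative_sullivan C V D" and E: "cdga E" and f: "f \<in> cdga_hom C E"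
    and g: "g \<in> cdga_hom (ext_dga C V D) Q" and p: "lifts_cocycles E Q p"
    and square: "\<And>c. c \<in> carrier C \<Longrightarrow> p (f c) = g (ext_incl C V c)"
  obtains h where "h \<in> cdga_hom (ext_dga C V D) E" "\<And>c. c \<in> carrier C \<Longrightarrow> h (ext_incl C V c) = f c"
    "\<And>z. z \<in> carrier (ext_dga C V D) \<Longrightarrow> p (h z) = g z"
proof -
  interpret sullivan_lifting C V D E f Q g p
    using S
    by (intro sullivan_lifting.intro ext_extension.intro ext_algebra.intro
        sullivan_lifting_axioms.intro ext_extension_axioms.intro E f g p square)
      (auto simp: relative_sullivan_def)
  from S obtain F where
    F: "\<forall>k q. submodule (F k q) rat_field V \<and> F k q \<subseteq> F (Suc k) q" "\<forall>q. hcomp V q = (\<Union>k. F k q)"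
      "\<forall>q. \<forall>v\<in>F 0 q. D (ext_gen C V q v) \<in> ext_incl C V ` carrier C"
      "\<forall>k q. \<forall>v\<in>F (Suc k) q. D (ext_gen C V q v) \<in> ext_sub C V (F k)"
    unfolding relative_sullivan_def by (elim conjE exE) (rule that)
  have sub: "\<And>k q. submodule (F k q) rat_field V" and mono: "\<And>k q. F k q \<subseteq> F (Suc k) q"
    and union: "\<And>q. hcomp V q = (\<Union>k. F k q)"
    using F(1,2) by blast+
  have D0: "D (ext_gen C V q v) \<in> ext_incl C V ` carrier C" if "v \<in> F 0 q" for q v
    using F(3) that by blast
  have DSuc: "D (ext_gen C V q v) \<in> ext_sub C V (F k)" if "v \<in> F (Suc k) q" for k q v
    using F(4) that by blast
  \<comment> \<open>Starting the filtration at \<open>0\<close> turns the condition on \<open>V(0)\<close> into an instance of the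
    general one.\<close>
  define G where "G n q = (case n of 0 \<Rightarrow> {\<zero>\<^bsub>V\<^esub>} | Suc k \<Rightarrow> F k q)" for n q
  have G_sub: "submodule (G n q) rat_field V" for n q
    using sub by (cases n) (auto simp: G_def intro!: V.rat_submoduleI)
  have G_h: "G n q \<subseteq> hcomp V q" for n q
    using union[of q] V.submodule_zero[OF sub[of _ q]] by (cases n) (auto simp: G_def)
  have G_mono: "G n q \<subseteq> G (Suc n) q" for n q
    using mono V.submodule_zero[OF sub] by (cases n) (auto simp: G_def)
  have G_D: "D (ext_gen C V q v) \<in> ext_sub C V (G n)" if "v \<in> G (Suc n) q" for n q v
  proof (cases n)
    case 0
    then show ?thesis
      using that D0[of v q] incl_ext_sub by (auto simp: G_def)
  next
    case (Suc k)
    then have "G n = F k" by (auto simp: G_def fun_eq_iff)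
    then show ?thesis
      using that DSuc[of v k q] Suc by (simp add: G_def)
  qed
  have "\<exists>l. \<forall>n. lifts_on (G n) (l n) \<and> (\<forall>q. \<forall>v\<in>G n q. l (Suc n) q v = l n q v)"
  proof (rule dependent_nat_choice)
    have lin: "graded_linear (\<lambda>q v. \<zero>\<^bsub>E\<^esub>)"
      by (simp add: graded_linear_def linear_on_def)
    have "D \<zero>\<^bsub>CV\<^esub> = \<zero>\<^bsub>CV\<^esub>" using Ext.diff_zero by simp
    then have "lifts_on (G 0) (\<lambda>q v. \<zero>\<^bsub>E\<^esub>)"
      by (simp add: lifts_on_def lin G_def ext_gen_zero p_zero extend_zero[OF lin])
    then show "\<exists>l. lifts_on (G 0) l" by blast
    show "\<exists>l'. lifts_on (G (Suc n)) l' \<and> (\<forall>q. \<forall>v\<in>G n q. l' q v = l q v)" if "lifts_on (G n) l" for l n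
      using that by (rule lifts_on_step) (use G_sub G_h G_mono G_D in auto)
  qed
  then obtain l where l: "\<And>n. lifts_on (G n) (l n)" and agree: "\<And>n q v. v \<in> G n q \<Longrightarrow> l (Suc n) q v = l n q v"
    by blast
  have G_le: "G n q \<subseteq> G m q" if "n \<le> m" for n m q
    using that G_mono by (rule lift_Suc_mono_le[of "\<lambda>n. G n q", rotated])
  have stable: "l m q v = l n q v" if "n \<le> m" "v \<in> G n q" for n m q v
    using that(1)
  proof (induction m rule: dec_induct)
    case (step m)
    then show ?case
      using agree[of v m q] G_le[of n m q] that by auto
  qed simp
  define h where "h q v = l (LEAST n. v \<in> G n q) q v" for q v
  have h_eq: "h q v = l n q v" if "v \<in> G n q" for n q v
    unfolding h_def by (rule stable[symmetric]) (use that in \<open>auto intro: LeastI Least_le\<close>)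
  have ex_G: "\<exists>n. v \<in> G (Suc n) q" if "v \<in> hcomp V q" for q v
    using that union by (auto simp: G_def)
  have lin_l: "graded_linear (l n)" for n
    using l by (simp add: lifts_on_def)
  have lin_h: "graded_linear h"
    unfolding graded_linear_def linear_on_def
  proof (intro allI conjI ballI)
    fix q v assume v: "v \<in> hcomp V q"
    obtain n where n: "v \<in> G (Suc n) q" using ex_G[OF v] by blast
    show "h q v \<in> hcomp E q"
      using h_eq[OF n] l_hcomp[OF lin_l v] by simp
    fix w s assume w: "w \<in> hcomp V q"
    obtain m where m: "w \<in> G (Suc m) q" using ex_G[OF w] by blast
    define N where "N = max (Suc n) (Suc m)"
    have vw: "v \<in> G N q" "w \<in> G N q"
      using n m G_le[of "Suc n" N q] G_le[of "Suc m" N q] by (auto simp: N_def)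
    then have "v \<oplus>\<^bsub>V\<^esub> s \<odot>\<^bsub>V\<^esub> w \<in> G N q"
      using V.submodule_add[OF G_sub] V.submodule_smult[OF G_sub] by blast
    then show "h q (v \<oplus>\<^bsub>V\<^esub> s \<odot>\<^bsub>V\<^esub> w) = h q v \<oplus>\<^bsub>E\<^esub> s \<odot>\<^bsub>E\<^esub> h q w"
      using vw lin_l[of N] v w by (simp add: h_eq graded_linear_def linear_on_def)
  qed
  have h_lifts: "p (h q v) = g (ext_gen C V q v) \<and> diff E (h q v) = extend h (D (ext_gen C V q v))"
    if v: "v \<in> hcomp V q" for q v
  proof -
    obtain n where n: "v \<in> G (Suc n) q" using ex_G[OF v] by blast
    have "extend (l (Suc n)) (D (ext_gen C V q v)) = extend h (D (ext_gen C V q v))"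
      by (rule extend_cong[OF lin_l lin_h G_h _ G_D[OF n]]) (use h_eq stable[of n "Suc n"] in simp)
    then show ?thesis
      using l[of "Suc n"] n h_eq[OF n] by (simp add: lifts_on_def)
  qed
  show thesis
  proof (rule that)
    show "extend h \<in> cdga_hom CV E"
    proof (rule cdga_homI)
      show "extend h (diff CV x) = diff E (extend h x)" if "x \<in> carrier CV" for x
        using extend_diff[OF lin_h, of "hcomp V" x] h_lifts that by (simp add: carrier_eq_ext_sub)
    qed (simp_all add: extend_carrier extend_mult extend_add extend_one extend_smult extend_hcomp lin_h)
    show "p (extend h z) = g z" if "z \<in> carrier CV" for z
      using p_extend[OF lin_h, of "hcomp V" z] h_lifts that by (simp add: carrier_eq_ext_sub)
  qed (rule extend_incl[OF lin_h])
qed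

section \<open>Powers of a differential ideal\<close>

lemma letter_ideal_power:
  assumes A: "cdga A" and u: "u \<in> tensor_words A (Suc n)" and K: "\<And>p a. (p, a) \<in> set u \<Longrightarrow> a \<in> K"
  shows "word_prod A (\<lambda>q a. a) u \<in> ideal_power A K (Suc n)"
proof -
  interpret cdga A by fact
  show ?thesis
    using u K
  proof (induction n arbitrary: u)
    case 0
    then obtain p a where "u = [(p, a)]"
      by (cases u) (auto simp: tensor_words_iff)
    then show ?case
      using 0 hcomp_carrier[of a p] by (auto simp: tensor_words_iff)
  next
    case (Suc n)
    obtain v x where uv: "u = v @ [x]"
      using Suc.prems(1) by (cases u rule: rev_exhaust) (auto simp: tensor_words_iff)
    obtain p a where x: "x = (p, a)" by (cases x)
    have v: "v \<in> tensor_words A (Suc n)" and "a \<in> hcomp A p" and aK: "a \<in> K"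
      using Suc.prems by (auto simp: tensor_words_iff uv x)
    then have a: "a \<in> carrier A" by blast
    have "letter_prod u = letter_prod v \<otimes>\<^bsub>A\<^esub> letter_prod [x]"
      unfolding uv by (rule word_prod_append) (use Suc.prems(1) in \<open>auto simp: tensor_words_iff uv\<close>)
    also have "letter_prod [x] = a"
      using a by (simp add: x)
    finally show ?case
      using Suc.IH[OF v] Suc.prems(2) aK by (auto simp: uv intro: ideal_prod.prod)
  qed
qed

context cdga
begin

lemma differential_ideal_zero: "differential_ideal A {\<zero>}"
  by (auto simp: differential_ideal_def zeroideal)

lemma acyclic_zero: "acyclic_ideal A {\<zero>}"
proof -
  have "boundaries (restrict_to A {\<zero>}) = {\<zero>}" "cocycles (restrict_to A {\<zero>}) = {\<zero>}"
    by (auto simp: boundaries_def cocycles_def)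
  then show ?thesis
    using coset_zero[OF zero_submodule] by (simp add: acyclic_ideal_def differential_ideal_zero)
qed

lemma differential_ideal_prod:
  assumes I: "differential_ideal A I" and J: "differential_ideal A J"
  shows "differential_ideal A (ideal_prod A I J)"
proof -
  note ideal_I = differential_idealD(1)[OF I] and ideal_J = differential_idealD(1)[OF J]
  have ideal: "ideal (ideal_prod A I J) A"
    by (rule ideal_prod_is_ideal[OF ideal_I ideal_J])
  note sub = ideal_submodule[OF ideal]
  have carr: "x \<in> carrier A" if "x \<in> I \<or> x \<in> J" for x
    using that submodule_subset[OF ideal_submodule] ideal_I ideal_J by blast
  have comp: "decomp A x n \<in> ideal_prod A I J" "diff A x \<in> ideal_prod A I J"
    if "x \<in> ideal_prod A I J" for x n
    using that
  proof induction
    case (prod i j)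
    note c = carr[of i] carr[of j]
    {
      case 1
      show ?case
      proof (rule additive_on_products[OF sub, where T = "\<lambda>x. decomp A x n"])
        fix k m
        have "decomp A i k \<otimes> decomp A j m \<in> hcomp A (k + m)"
          by (rule mult_hcomp[OF decomp_hcomp decomp_hcomp]) (use c prod in auto)
        moreover have "decomp A i k \<otimes> decomp A j m \<in> ideal_prod A I J"
          using prod differential_idealD(2)[OF I] differential_idealD(2)[OF J] by (intro ideal_prod.prod)
        ultimately show "decomp A (decomp A i k \<otimes> decomp A j m) n \<in> ideal_prod A I J"
          using submodule_zero[OF sub] by (simp add: decomp_homogeneous)
      qed (use prod c in \<open>auto simp: decomp_add\<close>)
    next
      case 2
      show ?case
      proof (rule additive_on_products[OF sub diff_add diff_zero])
        fix k m
        have d: "decomp A i k \<in> I" "decomp A j m \<in> J"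
          using prod differential_idealD(2)[OF I] differential_idealD(2)[OF J] by auto
        have "diff A (decomp A i k \<otimes> decomp A j m) =
            diff A (decomp A i k) \<otimes> decomp A j m \<oplus> (- 1) ^ k \<odot> (decomp A i k \<otimes> diff A (decomp A j m))"
          by (rule diff_mult[OF decomp_hcomp decomp_hcomp]) (use c prod in auto)
        then show "diff A (decomp A i k \<otimes> decomp A j m) \<in> ideal_prod A I J"
          using d differential_idealD(3)[OF I] differential_idealD(3)[OF J]
          by (simp add: ideal_prod.prod submodule_add[OF sub] submodule_smult[OF sub])
      qed (use prod c in auto)
    }
  next
    case (sum x y)
    have xy: "x \<in> carrier A" "y \<in> carrier A"
      using sum submodule_subset[OF sub] by auto
    {
      case 1
      then show ?case using sum xy by (simp add: decomp_add submodule_add[OF sub])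
    next
      case 2
      then show ?case using sum xy by (simp add: diff_add submodule_add[OF sub])
    }
  qed
  show ?thesis
    unfolding differential_ideal_def using ideal comp by blast
qed

lemma differential_ideal_power:
  assumes "differential_ideal A K"
  shows "differential_ideal A (ideal_power A K (Suc n))"
  by (induction n) (simp_all add: assms differential_ideal_prod)

end

lemma differential_ideal_kernel:
  assumes A: "cdga A" and B: "cdga B" and \<phi>: "\<phi> \<in> cdga_hom A B"
  shows "differential_ideal A (a_kernel A B \<phi>)"
proof -
  interpret A: cdga A by fact
  interpret B: cdga B by fact
  have mem: "x \<in> a_kernel A B \<phi> \<longleftrightarrow> x \<in> carrier A \<and> \<phi> x = \<zero>\<^bsub>B\<^esub>" for x
    unfolding a_kernel_def' by blast
  show ?thesis
    unfolding differential_ideal_def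
  proof (intro conjI ballI allI)
    show "ideal (a_kernel A B \<phi>) A"
      by (intro ring_hom_ring.kernel_is_ideal ring_hom_ringI2 A.ring_axioms B.ring_axioms
          cdga_hom_cdga_ring_hom[OF \<phi>])
    show "decomp A x n \<in> a_kernel A B \<phi>" if "x \<in> a_kernel A B \<phi>" for x n
      using that cdga_hom_decomp[OF A B \<phi>, of x n] unfolding mem by simp
    show "diff A ` a_kernel A B \<phi> \<subseteq> a_kernel A B \<phi>"
    proof
      fix y assume "y \<in> diff A ` a_kernel A B \<phi>"
      then obtain w where w: "w \<in> carrier A" "\<phi> w = \<zero>\<^bsub>B\<^esub>" "y = diff A w"
        unfolding mem by (auto simp: mem)
      then show "y \<in> a_kernel A B \<phi>"
        using cdga_hom_diff[OF \<phi> w(1)] unfolding mem by simp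
    qed
  qed
qed

section \<open>Models of projections onto quotients\<close>

lemma quot_model:
  assumes C: "cdga C" and I: "submodule I rat_field C"
    and model: "relative_sullivan_model C (dga_quot C I) (\<lambda>c. I +>\<^bsub>C\<^esub> c) V D \<pi>"
  shows "\<pi> \<in> cdga_hom (ext_dga C V D) (dga_quot C I)"
    and "quasi_iso (ext_dga C V D) (dga_quot C I) \<pi>"
    and "cdga (ext_dga C V D)" and "ext_incl C V \<in> cdga_hom C (ext_dga C V D)"
    and "\<And>c. c \<in> carrier C \<Longrightarrow> \<pi> (ext_incl C V c) = I +>\<^bsub>C\<^esub> c"
    and "\<pi> ` carrier (ext_dga C V D) = carrier (dga_quot C I)"
    and "\<pi> \<zero>\<^bsub>ext_dga C V D\<^esub> = \<zero>\<^bsub>dga_quot C I\<^esub>"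
proof -
  interpret C: cdga C by fact
  show q: "quasi_iso (ext_dga C V D) (dga_quot C I) \<pi>"
    and Ext: "cdga (ext_dga C V D)" and incl: "ext_incl C V \<in> cdga_hom C (ext_dga C V D)"
    and \<pi>: "\<And>c. c \<in> carrier C \<Longrightarrow> \<pi> (ext_incl C V c) = I +>\<^bsub>C\<^esub> c"
    using model by (auto simp: relative_sullivan_model_def relative_sullivan_def)
  then show hom: "\<pi> \<in> cdga_hom (ext_dga C V D) (dga_quot C I)"
    by (simp add: quasi_iso_def)
  show "\<pi> ` carrier (ext_dga C V D) = carrier (dga_quot C I)"
  proof
    show "\<pi> ` carrier (ext_dga C V D) \<subseteq> carrier (dga_quot C I)"
      using cdga_hom_carrier[OF hom] by auto
    show "carrier (dga_quot C I) \<subseteq> \<pi> ` carrier (ext_dga C V D)"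
    proof
      fix y assume "y \<in> carrier (dga_quot C I)"
      then obtain c where "c \<in> carrier C" "y = I +>\<^bsub>C\<^esub> c" by auto
      then show "y \<in> \<pi> ` carrier (ext_dga C V D)"
        using \<pi> cdga_hom_carrier[OF incl] by (metis image_eqI)
    qed
  qed
  show "\<pi> \<zero>\<^bsub>ext_dga C V D\<^esub> = \<zero>\<^bsub>dga_quot C I\<^esub>"
    using \<pi>[of "\<zero>\<^bsub>C\<^esub>"] cdga_hom_zero[OF C Ext incl] C.coset_zero[OF I] by simp
qed

text \<open>The model is onto since \<open>A\<close> maps onto \<open>A/I\<close>, and its kernel is homogeneous since \<open>I\<close> is.\<close>

lemma quot_model_lifts_cocycles:
  assumes A: "cdga A" and I: "differential_ideal A I"
    and model: "relative_sullivan_model A (dga_quot A I) (\<lambda>c. I +>\<^bsub>A\<^esub> c) V D \<pi>"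
  shows "lifts_cocycles (ext_dga A V D) (dga_quot A I) \<pi>"
proof -
  interpret cdga A by fact
  note sub = ideal_submodule[OF differential_idealD(1)[OF I]]
  note M = quot_model[OF A sub model]
  interpret E: cdga "ext_dga A V D" by (rule M(3))
  show ?thesis
  proof (rule quasi_iso_lifts_cocycles[OF M(3,2,6) _ M(7)])
    show "hcomp (dga_quot A I) n \<subseteq> \<pi> ` hcomp (ext_dga A V D) n" for n
    proof
      fix y assume "y \<in> hcomp (dga_quot A I) n"
      then obtain c where c: "c \<in> hcomp A n" "y = I +>\<^bsub>A\<^esub> c" by auto
      then have "y = \<pi> (ext_incl A V c)"
        using M(5) by (simp add: hcomp_carrier)
      then show "y \<in> \<pi> ` hcomp (ext_dga A V D) n"
        using cdga_hom_hcomp[OF M(4) c(1)] by blast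
    qed
  next
    fix x n assume x: "x \<in> carrier (ext_dga A V D)" and px: "\<pi> x = \<zero>\<^bsub>dga_quot A I\<^esub>"
    \<comment> \<open>A representative of \<open>\<pi> x\<close> can be chosen whose components represent the images of the
      components of \<open>x\<close>.\<close>
    have "\<exists>b\<in>carrier A. \<pi> x = I +>\<^bsub>A\<^esub> b \<and> (\<forall>n. \<pi> (decomp (ext_dga A V D) x n) = I +>\<^bsub>A\<^esub> decomp A b n)"
      using x
    proof (induction x rule: E.graded_induct)
      case zero
      then show ?case
        using M(7) coset_zero[OF sub] by (intro bexI[of _ "\<zero>\<^bsub>A\<^esub>"]) auto
    next
      case (add m a y)
      from add obtain b where b: "b \<in> carrier A" "\<pi> y = I +>\<^bsub>A\<^esub> b"
        "\<And>n. \<pi> (decomp (ext_dga A V D) y n) = I +>\<^bsub>A\<^esub> decomp A b n" by blast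
      obtain c where c: "c \<in> hcomp A m" "\<pi> a = I +>\<^bsub>A\<^esub> c"
        using cdga_hom_hcomp[OF M(1) add(1)] by auto
      have cc: "c \<in> carrier A" and ac: "a \<in> carrier (ext_dga A V D)"
        using c add by auto
      have a_dec: "\<pi> (decomp (ext_dga A V D) a n) = I +>\<^bsub>A\<^esub> decomp A c n" for n
        using c M(7) coset_zero[OF sub]
        by (simp add: E.decomp_homogeneous[OF add(1)] decomp_homogeneous[OF c(1)])
      show ?case
      proof (intro bexI[of _ "c \<oplus>\<^bsub>A\<^esub> b"] conjI allI)
        show "\<pi> (a \<oplus>\<^bsub>ext_dga A V D\<^esub> y) = I +>\<^bsub>A\<^esub> (c \<oplus>\<^bsub>A\<^esub> b)"
          using b c cc ac add by (simp add: cdga_hom_add[OF M(1)] coset_add[OF sub])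
        show "\<pi> (decomp (ext_dga A V D) (a \<oplus>\<^bsub>ext_dga A V D\<^esub> y) n) = I +>\<^bsub>A\<^esub> decomp A (c \<oplus>\<^bsub>A\<^esub> b) n" for n
          using b cc ac add a_dec
          by (simp add: E.decomp_add decomp_add cdga_hom_add[OF M(1)] coset_add[OF sub])
      qed (use b cc in simp)
    qed
    then obtain b where b: "b \<in> carrier A" "\<pi> x = I +>\<^bsub>A\<^esub> b"
      "\<And>n. \<pi> (decomp (ext_dga A V D) x n) = I +>\<^bsub>A\<^esub> decomp A b n" by blast
    then have "b \<in> I"
      using px coset_eq_zero_iff[OF sub b(1)] by simp
    then have "decomp A b n \<in> I"
      by (rule differential_idealD(2)[OF I])
    then show "\<pi> (decomp (ext_dga A V D) x n) = \<zero>\<^bsub>dga_quot A I\<^esub>"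
      using b coset_eq_zero_iff[OF sub, of "decomp A b n"] by simp
  qed
qed

section \<open>The upper bounds\<close>

text \<open>\<open>A \<rightarrow> A/J\<close> has the lifting property for acyclic \<open>J\<close>, so \<open>A \<otimes> \<Lambda>V \<rightarrow> A/K\<^bsup>m+1\<^esup> \<rightarrow> A/J\<close> lifts
  to a retraction.\<close>

lemma homotopy_retraction_if_power_acyclic:
  fixes A :: "'a dga"
  assumes A: "cdga A" and K: "differential_ideal A K"
    and model: "has_relative_sullivan_model TYPE('v) A (Asecat_quot A K m) (Asecat_proj A K m)"
    and J: "acyclic_ideal A J" and sub_J: "ideal_power A K (m + 1) \<subseteq> J"
  shows "homotopy_retraction TYPE('v) A (Asecat_quot A K m) (Asecat_proj A K m)"
proof -
  interpret cdga A by fact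
  let ?I = "ideal_power A K (m + 1)"
  have I: "differential_ideal A ?I"
    using differential_ideal_power[OF K] by simp
  have J': "differential_ideal A J"
    using J by (simp add: acyclic_ideal_def)
  note subI = ideal_submodule[OF differential_idealD(1)[OF I]]
  note idealJ = differential_idealD(1)[OF J']
  note subJ = ideal_submodule[OF idealJ]
  have proj: "Asecat_proj A K m = (\<lambda>x. ?I +>\<^bsub>A\<^esub> x)"
    by (simp add: Asecat_proj_def fun_eq_iff)
  obtain V :: "'v graded" and D \<pi> where
    model: "relative_sullivan_model A (dga_quot A ?I) (\<lambda>x. ?I +>\<^bsub>A\<^esub> x) V D \<pi>"
    using model unfolding has_relative_sullivan_model_def Asecat_quot_def proj by blast
  note M = quot_model[OF A subI model]
  let ?p = "\<lambda>x. J +>\<^bsub>A\<^esub> x"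
  have p: "?p \<in> cdga_hom A (dga_quot A J)"
    by (rule quot_projection_hom[OF A idealJ differential_idealD(3)[OF J']])
  have vanish: "\<forall>i\<in>?I. ?p i = ?p \<zero>\<^bsub>A\<^esub>"
  proof
    fix i assume "i \<in> ?I"
    then have "i \<in> J" "i \<in> carrier A" using sub_J submodule_subset[OF subJ] by auto
    then show "?p i = ?p \<zero>\<^bsub>A\<^esub>"
      using coset_eq_zero_iff[OF subJ] by (simp add: coset_zero[OF subJ])
  qed
  have diff_I: "\<forall>i\<in>?I. diff A i \<in> ?I"
    using differential_idealD(3)[OF I] by blast
  note q = hom_on_quot[OF A subI p vanish diff_I]
  obtain r where r: "r \<in> cdga_hom (ext_dga A V D) A" "\<And>c. c \<in> carrier A \<Longrightarrow> r (ext_incl A V c) = id c"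
  proof (rule relative_sullivan_lift[of A V D A id "on_cosets ?p \<circ> \<pi>" "dga_quot A J" ?p])
    show "relative_sullivan A V D"
      using model by (simp add: relative_sullivan_model_def)
    show "id \<in> cdga_hom A A" by (rule cdga_homI) auto
    show "on_cosets ?p \<circ> \<pi> \<in> cdga_hom (ext_dga A V D) (dga_quot A J)"
      by (rule cdga_hom_comp[OF M(1) q(1)])
    show "lifts_cocycles A (dga_quot A J) ?p"
      by (rule acyclic_quotient_lifts_cocycles[OF A J])
    show "?p (id c) = (on_cosets ?p \<circ> \<pi>) (ext_incl A V c)" if "c \<in> carrier A" for c
      using that M(5) q(2) by simp
  qed (use A that in blast)+
  then show ?thesis
    unfolding homotopy_retraction_def Asecat_quot_def proj using model by auto
qed

lemma tensor_power_sub_span: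
  assumes A: "cdga A" and f: "supp f \<subseteq> {u \<in> tensor_words A n. \<forall>(p, a)\<in>set u. a \<in> K}"
  shows "tensor_rels A n +>\<^bsub>tensor_word_space A n\<^esub> f \<in> tensor_power_sub A K n"
  using f
proof (induction f rule: word_induct)
  case zero
  interpret cdga A by fact
  show ?case
    using rat_module.coset_zero[OF tensor_word_space_module tensor_rels_submodule, of n]
      lin_span.zero[of "tensor_power A n"]
    by (simp add: tensor_power_sub_def)
next
  case (add u c g)
  interpret cdga A by fact
  have u: "u \<in> tensor_words A n" and n: "length u = n" using add by (auto simp: tensor_words_iff)
  have k: "supp (word u b) \<subseteq> tensor_words A n" for b :: rat
    using u keys_single_subset[of u b] by auto
  have g: "supp g \<subseteq> tensor_words A n" using add by auto
  note cosets = rat_module.coset_add[OF tensor_word_space_module tensor_rels_submodule]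
    rat_module.coset_smult[OF tensor_word_space_module tensor_rels_submodule]
  have "tensor_rels A n +>\<^bsub>tensor_word_space A n\<^esub> (word u c + g) =
      (c \<odot>\<^bsub>tensor_power A n\<^esub> pure_tensor A u) \<oplus>\<^bsub>tensor_power A n\<^esub>
      (tensor_rels A n +>\<^bsub>tensor_word_space A n\<^esub> g)"
    using cosets(1)[of "word u c" n g] cosets(2)[of "word u 1" n c] k g u
    by (simp add: pure_tensor_eq n)
  moreover have "pure_tensor A u \<in> {pure_tensor A u |u. u \<in> tensor_words A n \<and> (\<forall>(p, a)\<in>set u. a \<in> K)}"
    using add by blast
  ultimately show ?case
    using add(3) unfolding tensor_power_sub_def by (simp only:) (rule lin_span.step)
qed

lemma pure_tensor_carrier:
  assumes "u \<in> tensor_words A n" shows "pure_tensor A u \<in> carrier (tensor_power A n)"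
proof -
  have "length u = n" "supp (word u 1) \<subseteq> tensor_words A n"
    using assms keys_single_subset[of u 1] by (auto simp: tensor_words_iff)
  then show ?thesis
    by (auto simp: pure_tensor_eq)
qed

lemma pure_tensor_diff:
  assumes "cdga A" "u \<in> tensor_words A n"
  shows "diff (tensor_power A n) (pure_tensor A u) =
    tensor_rels A n +>\<^bsub>tensor_word_space A n\<^esub> tensor_word_diff A u"
proof -
  interpret cdga A by fact
  have "length u = n" "supp (word u 1) \<subseteq> tensor_words A n"
    using assms keys_single_subset[of u 1] by (auto simp: tensor_words_iff)
  then show ?thesis
    using tensor_power_diff[of "word u 1" n] by (simp add: pure_tensor_eq del: tensor_power_simps)
qed

context
  fixes A :: "'a dga" and K n
  assumes A: "cdga A" and K: "differential_ideal A K" and T: "cdga (tensor_power A n)"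
begin

interpretation cdga A by (rule A)
interpretation T: cdga "tensor_power A n" by (rule T)

lemma tensor_power_sub_gens:
  "{pure_tensor A u |u. u \<in> tensor_words A n \<and> (\<forall>(p, a)\<in>set u. a \<in> K)} \<subseteq> carrier (tensor_power A n)"
  using pure_tensor_carrier by blast

lemma tensor_power_sub_submodule: "submodule (tensor_power_sub A K n) rat_field (tensor_power A n)"
  unfolding tensor_power_sub_def by (rule T.lin_span_submodule[OF tensor_power_sub_gens])

lemma tensor_power_sub_diff:
  assumes "x \<in> tensor_power_sub A K n"
  shows "diff (tensor_power A n) x \<in> tensor_power_sub A K n"
proof -
  note sub = tensor_power_sub_submodule
  have gens: "diff (tensor_power A n) (pure_tensor A u) \<in> tensor_power_sub A K n"
    if u: "u \<in> tensor_words A n" and uK: "\<And>p a. (p, a) \<in> set u \<Longrightarrow> a \<in> K" for u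
  proof -
    have n: "length u = n" using u by (simp add: tensor_words_iff)
    have "a \<in> K" if "(p, a) \<in> set (diff_at A i u)" "i < n" for p a i
    proof -
      have "(p, a) = (Suc (fst (u ! i)), diff A (snd (u ! i))) \<or> (p, a) \<in> set u"
        using that set_update_subset_insert[of u i "(Suc (fst (u ! i)), diff A (snd (u ! i)))"]
        unfolding diff_at_def by blast
      moreover have "snd (u ! i) \<in> K"
        using that n uK[of "fst (u ! i)" "snd (u ! i)"] by simp
      ultimately show ?thesis
        using uK differential_idealD(3)[OF K] by auto
    qed
    then have "supp (tensor_word_diff A u) \<subseteq> {u \<in> tensor_words A n. \<forall>(p, a)\<in>set u. a \<in> K}"
      unfolding tensor_word_diff_eq using n
      by (intro keys_sum_subset order_trans[OF keys_single_subset]) (auto simp: diff_at_words[OF u])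
    then show ?thesis
      unfolding pure_tensor_diff[OF A u] by (rule tensor_power_sub_span[OF A])
  qed
  show ?thesis
    using assms unfolding tensor_power_sub_def
  proof induction
    case zero
    then show ?case using T.diff_zero by (simp del: tensor_power_simps add: lin_span.zero)
  next
    case (step x y q)
    have xy: "x \<in> carrier (tensor_power A n)" "y \<in> carrier (tensor_power A n)"
      using step tensor_power_sub_gens T.lin_span_subset_carrier[OF tensor_power_sub_gens] by blast+
    have "diff (tensor_power A n) x \<in> tensor_power_sub A K n"
      using step(1) gens by auto
    then show ?case
      using step xy unfolding tensor_power_sub_def[symmetric]
      by (simp del: tensor_power_simps
          add: T.diff_add T.diff_smult T.submodule_add[OF sub] T.submodule_smult[OF sub])
  qed
qed

lemma tensor_mult_sub:
  assumes "x \<in> tensor_power_sub A K n" "n = Suc m"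
  shows "tensor_mult A x \<in> ideal_power A K n"
proof -
  note \<mu> = tensor_mult_hom[of n]
  have "differential_ideal A (ideal_power A K n)"
    unfolding assms(2) by (rule differential_ideal_power[OF K])
  note sub = ideal_submodule[OF differential_idealD(1)[OF this]]
  show ?thesis
    using assms(1) unfolding tensor_power_sub_def
  proof induction
    case zero
    then show ?case
      using cdga_hom_zero[OF T A \<mu>] submodule_zero[OF sub] by simp
  next
    case (step x y q)
    have xy: "x \<in> carrier (tensor_power A n)" "y \<in> carrier (tensor_power A n)"
      using step tensor_power_sub_gens T.lin_span_subset_carrier[OF tensor_power_sub_gens] by blast+
    obtain u where u: "x = pure_tensor A u" "u \<in> tensor_words A n" "\<forall>(p, a)\<in>set u. a \<in> K"
      using step by blast
    have "tensor_mult A x \<in> ideal_power A K n"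
      unfolding u(1) tensor_mult_pure[OF u(2)] assms(2)
      by (rule letter_ideal_power[OF A]) (use u assms(2) in auto)
    then show ?case
      using step xy
      by (simp del: tensor_power_simps add: cdga_hom_add[OF \<mu>] cdga_hom_smult[OF \<mu>]
          submodule_add[OF sub] submodule_smult[OF sub])
  qed
qed

end

text \<open>The multiplication sends \<open>K\<^bsup>\<otimes>m+1\<^esup>\<close> into \<open>K\<^bsup>m+1\<^esup>\<close>, so it lifts to the models; a retraction for
  the second model then yields the morphism required for the first.\<close>

lemma secat_condition_if_homotopy_retraction:
  fixes A :: "'a dga"
  assumes A: "cdga A" and K: "differential_ideal A K"
    and model: "has_relative_sullivan_model TYPE('w)
      (tensor_power A (m + 1)) (secat_quot A K m) (secat_proj A K m)"
    and retraction: "homotopy_retraction TYPE('v) A (Asecat_quot A K m) (Asecat_proj A K m)"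
  shows "\<exists>(W :: 'w graded) D \<pi>.
    relative_sullivan_model (tensor_power A (m + 1)) (secat_quot A K m) (secat_proj A K m) W D \<pi> \<and>
    (\<exists>\<tau>\<in>cdga_hom (ext_dga (tensor_power A (m + 1)) W D) A.
      \<forall>x\<in>carrier (tensor_power A (m + 1)).
        \<tau> (ext_incl (tensor_power A (m + 1)) W x) = tensor_mult A x)"
proof -
  interpret cdga A by fact
  let ?T = "tensor_power A (m + 1)" and ?S = "tensor_power_sub A K (m + 1)" and ?I = "ideal_power A K (m + 1)"
  have I: "differential_ideal A ?I"
    using differential_ideal_power[OF K] by simp
  note subI = ideal_submodule[OF differential_idealD(1)[OF I]]
  have proj: "Asecat_proj A K m = (\<lambda>x. ?I +>\<^bsub>A\<^esub> x)" "secat_proj A K m = (\<lambda>x. ?S +>\<^bsub>?T\<^esub> x)"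
    by (simp_all add: Asecat_proj_def secat_proj_def fun_eq_iff)
  obtain V :: "'v graded" and D \<pi> r where
    model_A: "relative_sullivan_model A (dga_quot A ?I) (\<lambda>x. ?I +>\<^bsub>A\<^esub> x) V D \<pi>"
    and r: "r \<in> cdga_hom (ext_dga A V D) A" "\<And>c. c \<in> carrier A \<Longrightarrow> r (ext_incl A V c) = c"
    using retraction unfolding homotopy_retraction_def Asecat_quot_def proj by blast
  obtain W :: "'w graded" and D' \<pi>' where
    model_T: "relative_sullivan_model ?T (dga_quot ?T ?S) (\<lambda>x. ?S +>\<^bsub>?T\<^esub> x) W D' \<pi>'"
    using model unfolding has_relative_sullivan_model_def secat_quot_def proj by blast
  then have SW: "relative_sullivan ?T W D'"
    by (simp add: relative_sullivan_model_def)
  then have T: "cdga ?T" by (simp add: relative_sullivan_def)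
  note subS = tensor_power_sub_submodule[OF A K T]
  note M = quot_model[OF A subI model_A]
  note M' = quot_model[OF T subS model_T]
  note \<mu> = tensor_mult_hom[of "m + 1"]
  let ?\<rho>\<mu> = "(\<lambda>x. ?I +>\<^bsub>A\<^esub> x) \<circ> tensor_mult A"
  have \<rho>\<mu>: "?\<rho>\<mu> \<in> cdga_hom ?T (dga_quot A ?I)"
    by (rule cdga_hom_comp[OF \<mu> quot_projection_hom[OF A differential_idealD(1)[OF I] differential_idealD(3)[OF I]]])
  have vanish: "\<forall>i\<in>?S. ?\<rho>\<mu> i = ?\<rho>\<mu> \<zero>\<^bsub>?T\<^esub>"
  proof
    fix i assume "i \<in> ?S"
    then have "tensor_mult A i \<in> ?I"
      using tensor_mult_sub[OF A K T] by simp
    then show "?\<rho>\<mu> i = ?\<rho>\<mu> \<zero>\<^bsub>?T\<^esub>"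
      using submodule_subset[OF subI] coset_eq_zero_iff[OF subI, of "tensor_mult A i"]
        coset_zero[OF subI] cdga_hom_zero[OF T A \<mu>] by auto
  qed
  have diff_S: "\<forall>i\<in>?S. diff ?T i \<in> ?S"
    using tensor_power_sub_diff[OF A K T] by blast
  note q = hom_on_quot[OF T subS \<rho>\<mu> vanish diff_S]
  obtain h where h: "h \<in> cdga_hom (ext_dga ?T W D') (ext_dga A V D)"
    "\<And>c. c \<in> carrier ?T \<Longrightarrow> h (ext_incl ?T W c) = (ext_incl A V \<circ> tensor_mult A) c"
  proof (rule relative_sullivan_lift[OF SW M(3), of "ext_incl A V \<circ> tensor_mult A" "on_cosets ?\<rho>\<mu> \<circ> \<pi>'"
        "dga_quot A ?I" \<pi>])
    show "ext_incl A V \<circ> tensor_mult A \<in> cdga_hom ?T (ext_dga A V D)"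
      by (rule cdga_hom_comp[OF \<mu> M(4)])
    show "on_cosets ?\<rho>\<mu> \<circ> \<pi>' \<in> cdga_hom (ext_dga ?T W D') (dga_quot A ?I)"
      by (rule cdga_hom_comp[OF M'(1) q(1)])
    show "lifts_cocycles (ext_dga A V D) (dga_quot A ?I) \<pi>"
      by (rule quot_model_lifts_cocycles[OF A I model_A])
    show "\<pi> ((ext_incl A V \<circ> tensor_mult A) c) = (on_cosets ?\<rho>\<mu> \<circ> \<pi>') (ext_incl ?T W c)"
      if "c \<in> carrier ?T" for c
      using that M(5)[OF cdga_hom_carrier[OF \<mu> that]] M'(5)[OF that] q(2)[OF that]
      by (simp del: tensor_power_simps add: o_def)
  qed (use that in blast)
  have "r \<circ> h \<in> cdga_hom (ext_dga ?T W D') A"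
    by (rule cdga_hom_comp[OF h(1) r(1)])
  moreover have "(r \<circ> h) (ext_incl ?T W x) = tensor_mult A x" if "x \<in> carrier ?T" for x
    using h(2)[OF that] r(2)[OF cdga_hom_carrier[OF \<mu> that]] by simp
  ultimately show ?thesis
    unfolding secat_quot_def proj using model_T by blast
qed

section \<open>Products of cocycles in the kernel\<close>

text \<open>A tensor \<open>z = a\<^sub>0 \<otimes> \<dots> \<otimes> a\<^sub>m\<close> of cocycles of \<open>K\<close> dies in the quotient by \<open>K\<^bsup>\<otimes>m+1\<^esup>\<close>, so it
  bounds in the relative model; \<open>\<tau>\<close> carries this to \<open>A\<close>, where \<open>z\<close> becomes \<open>a\<^sub>0 \<cdots> a\<^sub>m\<close>.\<close>

lemma letter_prod_boundary:
  fixes A :: "'a dga"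
  assumes A: "cdga A" and K: "differential_ideal A K"
    and model: "relative_sullivan_model (tensor_power A (m + 1)) (secat_quot A K m) (secat_proj A K m) W D \<pi>"
    and \<tau>: "\<tau> \<in> cdga_hom (ext_dga (tensor_power A (m + 1)) W D) A"
      "\<And>x. x \<in> carrier (tensor_power A (m + 1)) \<Longrightarrow> \<tau> (ext_incl (tensor_power A (m + 1)) W x) = tensor_mult A x"
    and u: "u \<in> tensor_words A (m + 1)" "\<And>p a. (p, a) \<in> set u \<Longrightarrow> a \<in> K \<inter> cocycles A"
  shows "word_prod A (\<lambda>q a. a) u \<in> boundaries A"
proof -
  interpret cdga A by fact
  let ?T = "tensor_power A (m + 1)" and ?S = "tensor_power_sub A K (m + 1)"
  let ?E = "ext_dga ?T W D"
  have proj: "secat_proj A K m = (\<lambda>x. ?S +>\<^bsub>?T\<^esub> x)"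
    by (simp add: secat_proj_def fun_eq_iff)
  have model: "relative_sullivan_model ?T (dga_quot ?T ?S) (\<lambda>x. ?S +>\<^bsub>?T\<^esub> x) W D \<pi>"
    using model unfolding secat_quot_def proj .
  then have T: "cdga ?T" by (simp add: relative_sullivan_model_def relative_sullivan_def)
  interpret T: cdga ?T by (rule T)
  note subS = tensor_power_sub_submodule[OF A K T]
  note M = quot_model[OF T subS model]
  interpret E: cdga ?E by (rule M(3))
  let ?z = "pure_tensor A u"
  have z: "?z \<in> carrier ?T" by (rule pure_tensor_carrier[OF u(1)])
  have "pure_tensor A u \<in> {pure_tensor A u |u. u \<in> tensor_words A (m + 1) \<and> (\<forall>(p, a)\<in>set u. a \<in> K)}"
    using u by blast
  then have zS: "?z \<in> ?S"
    unfolding tensor_power_sub_def by (rule T.lin_span_superset[OF tensor_power_sub_gens[OF A K T]])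
  have rel: "word (v @ (p, \<zero>\<^bsub>A\<^esub>) # w) c \<in> tensor_rels A (m + 1)"
    if "v @ (p, \<zero>\<^bsub>A\<^esub>) # w \<in> tensor_words A (m + 1)" for v p w c
    using tensor_rels_scale[OF tensor_gens_rels[OF tensor_gensI[OF that that, of 0 0]], of c] by simp
  have "word (diff_at A i u) c \<in> tensor_rels A (m + 1)" if i: "i < m + 1" for i c
  proof -
    have len: "length u = m + 1" using u by (simp add: tensor_words_iff)
    have "snd (u ! i) \<in> cocycles A"
      using u(2)[of "fst (u ! i)" "snd (u ! i)"] i len by simp
    then have "diff_at A i u = take i u @ (Suc (fst (u ! i)), \<zero>\<^bsub>A\<^esub>) # drop (Suc i) u"
      using i len by (simp add: diff_at_def upd_conv_take_nth_drop cocycles_def)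
    then show ?thesis
      using rel diff_at_words[OF u(1) i] by simp
  qed
  then have "tensor_word_diff A u \<in> tensor_rels A (m + 1)"
    unfolding tensor_word_diff_eq using u(1)
    by (intro tensor_rels_sum) (auto simp: tensor_words_iff)
  then have "tensor_rels A (m + 1) +>\<^bsub>tensor_word_space A (m + 1)\<^esub> tensor_word_diff A u = tensor_rels A (m + 1)"
    using rat_module.coset_eq_zero_iff[OF tensor_word_space_module tensor_rels_submodule,
        of "tensor_word_diff A u" "m + 1"] keys_tensor_word_diff[OF u(1)] by simp
  then have "diff ?T ?z = \<zero>\<^bsub>?T\<^esub>"
    unfolding pure_tensor_diff[OF A u(1)] tensor_power_simps(4) .
  then have De: "diff ?E (ext_incl ?T W ?z) = \<zero>\<^bsub>?E\<^esub>"
    using cdga_hom_diff[OF M(4) z] cdga_hom_zero[OF T M(3,4)] by simp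
  have "\<pi> (ext_incl ?T W ?z) = ?S"
    using M(5)[OF z] T.coset_eq_zero_iff[OF subS z] zS by simp
  then have eq: "\<pi> (ext_incl ?T W ?z) = diff (dga_quot ?T ?S) (\<pi> \<zero>\<^bsub>?E\<^esub>)"
    using cdga_hom_diff[OF M(1) E.zero_closed] E.diff_zero M(7) by (simp del: ext_dga_diff)
  obtain y where y: "y \<in> carrier ?E" "diff ?E y = ext_incl ?T W ?z"
    using quasi_iso_lift[OF M(3,2,6,7) cdga_hom_carrier[OF M(4) z] De E.zero_closed eq] by blast
  have "word_prod A (\<lambda>q a. a) u = \<tau> (ext_incl ?T W ?z)"
    using \<tau>(2)[OF z] tensor_mult_pure[OF u(1)] by simp
  also have "\<dots> = diff A (\<tau> y)"
    unfolding y(2)[symmetric] by (rule cdga_hom_diff[OF \<tau>(1) y(1)])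
  finally show ?thesis
    using cdga_hom_carrier[OF \<tau>(1) y(1)] by (auto simp: boundaries_def)
qed

text \<open>Only homogeneous cocycles occur as letters of tensors; their products span all products of
  cocycles of \<open>K\<close>.\<close>

definition cocycle_products :: "('a, 'm) dga_scheme \<Rightarrow> 'a set \<Rightarrow> nat \<Rightarrow> 'a set"
  where "cocycle_products A K n = lin_span A
    {word_prod A (\<lambda>q a. a) u |u. u \<in> tensor_words A n \<and> (\<forall>(p, a)\<in>set u. a \<in> K \<inter> cocycles A)}"

context
  fixes A :: "'a dga" and K
  assumes A: "cdga A" and K: "differential_ideal A K"
begin

interpretation cdga A by (rule A)

lemma cocycle_products_gens:
  "{letter_prod u |u. u \<in> tensor_words A n \<and> (\<forall>(p, a)\<in>set u. a \<in> K \<inter> cocycles A)} \<subseteq> carrier A"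
  using letter_prod_hcomp by blast

lemma cocycle_products_submodule: "submodule (cocycle_products A K n) rat_field A"
  unfolding cocycle_products_def by (rule lin_span_submodule[OF cocycle_products_gens])

lemma cocycle_products_1:
  assumes x: "x \<in> K \<inter> cocycles A"
  shows "x \<in> cocycle_products A K 1"
proof -
  note sub = cocycle_products_submodule[of "Suc 0"]
  have xc: "x \<in> carrier A" using x by (auto simp: cocycles_def)
  then show ?thesis
  proof (induction x rule: decomp_induct)
    case (add n y)
    let ?a = "decomp A x n"
    have a: "?a \<in> hcomp A n" "?a \<in> K \<inter> cocycles A"
      using xc x decomp_hcomp cocycle_decomp differential_idealD(2)[OF K] by auto
    have "letter_prod [(n, ?a)] \<in> cocycle_products A K 1"
      unfolding cocycle_products_def
      by (rule lin_span_superset[OF cocycle_products_gens])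
        (use a in \<open>auto simp: tensor_words_iff intro!: exI[of _ "[(n, ?a)]"]\<close>)
    then show ?case
      using add a xc by (simp add: submodule_add[OF sub])
  qed (simp add: submodule_zero[OF sub])
qed

lemma cocycle_products_mult:
  assumes x: "x \<in> cocycle_products A K m" and y: "y \<in> cocycle_products A K n"
  shows "x \<otimes>\<^bsub>A\<^esub> y \<in> cocycle_products A K (m + n)"
proof -
  note sub = cocycle_products_submodule[of "m + n"]
  have carr: "z \<in> carrier A" if "z \<in> cocycle_products A K k" for z k
    using that submodule_subset[OF cocycle_products_submodule] by blast
  have yc: "y \<in> carrier A" by (rule carr[OF y])
  have 1: "letter_prod u \<otimes>\<^bsub>A\<^esub> y \<in> cocycle_products A K (m + n)"
    if u: "u \<in> tensor_words A m" "\<forall>(p, a)\<in>set u. a \<in> K \<inter> cocycles A" for u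
    using y unfolding cocycle_products_def[of A K n]
  proof induction
    case zero
    then show ?case
      using hcomp_carrier[OF letter_prod_hcomp[OF u(1)]] submodule_zero[OF sub] by simp
  next
    case (step v z q)
    obtain w where w: "v = letter_prod w" "w \<in> tensor_words A n" "\<forall>(p, a)\<in>set w. a \<in> K \<inter> cocycles A"
      using step by blast
    have c: "letter_prod u \<in> carrier A" "v \<in> carrier A" "z \<in> carrier A"
      using letter_prod_hcomp[OF u(1)] letter_prod_hcomp[OF w(2)] w(1) step(2)
        carr[of z n] unfolding cocycle_products_def by auto
    have "letter_prod u \<otimes>\<^bsub>A\<^esub> v = letter_prod (u @ w)"
      unfolding w(1) by (rule word_prod_append[symmetric]) (use u w in \<open>auto simp: tensor_words_iff\<close>)
    also have "\<dots> \<in> cocycle_products A K (m + n)"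
      unfolding cocycle_products_def
      by (rule lin_span_superset[OF cocycle_products_gens])
        (use u w in \<open>auto simp: tensor_words_iff intro!: exI[of _ "u @ w"]\<close>)
    finally show ?case
      using step c by (simp add: r_distr smult_mult_right submodule_add[OF sub] submodule_smult[OF sub])
  qed
  show ?thesis
    using x unfolding cocycle_products_def[of A K m]
  proof induction
    case zero
    then show ?case using yc submodule_zero[OF sub] by simp
  next
    case (step v z q)
    obtain w where w: "v = letter_prod w" "w \<in> tensor_words A m" "\<forall>(p, a)\<in>set w. a \<in> K \<inter> cocycles A"
      using step by blast
    have c: "v \<in> carrier A" "z \<in> carrier A"
      using letter_prod_hcomp[OF w(2)] w(1) step(2) carr[of z m] unfolding cocycle_products_def by auto
    then show ?case
      using step 1[OF w(2,3)] yc w(1)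
      by (simp add: l_distr smult_mult_left submodule_add[OF sub] submodule_smult[OF sub])
  qed
qed

lemma kernel_cocycles_submodule: "submodule (K \<inter> cocycles A) rat_field A"
  using submodule_subset[OF cocycles_submodule]
    ideal_submodule[OF differential_idealD(1)[OF K]] cocycles_submodule
  by (intro rat_submoduleI) (auto intro: submodule_zero submodule_add submodule_smult)

lemma kernel_cocycles_mult:
  "x \<in> K \<inter> cocycles A \<Longrightarrow> y \<in> K \<inter> cocycles A \<Longrightarrow> x \<otimes>\<^bsub>A\<^esub> y \<in> K \<inter> cocycles A"
  using cocycles_mult ideal.I_r_closed[OF differential_idealD(1)[OF K]] by (auto simp: cocycles_def)

lemma cocycle_products_subset: "cocycle_products A K (Suc n) \<subseteq> K \<inter> cocycles A"
  unfolding cocycle_products_def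
proof (rule lin_span_least[OF kernel_cocycles_submodule], safe)
  fix u assume "u \<in> tensor_words A (Suc n)" "\<forall>(p, a)\<in>set u. a \<in> K \<inter> cocycles A"
  then have "letter_prod u \<in> K \<inter> cocycles A"
  proof (induction n arbitrary: u)
    case 0
    then obtain p a where "u = [(p, a)]" by (cases u) (auto simp: tensor_words_iff)
    then show ?case using 0 by (auto simp: cocycles_def)
  next
    case (Suc n)
    then obtain p a v where v: "u = (p, a) # v" by (cases u) (auto simp: tensor_words_iff)
    then have "letter_prod v \<in> K \<inter> cocycles A"
      using Suc.prems by (intro Suc.IH) (auto simp: tensor_words_iff)
    then show ?case
      using kernel_cocycles_mult[of a "letter_prod v"] Suc.prems by (simp add: v)
  qed
  then show "letter_prod u \<in> K" "letter_prod u \<in> cocycles A" by auto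
qed

text \<open>The boundaries of elements of an ideal \<open>J\<close> form an ideal in the algebra of cocycles.\<close>

lemma coset_mult_cocycles:
  assumes J: "ideal J A" and x: "x \<in> cocycles A" and y: "y \<in> cocycles A"
  shows "rcoset_mult A (diff A ` J) (diff A ` J +>\<^bsub>A\<^esub> x) (diff A ` J +>\<^bsub>A\<^esub> y) = diff A ` J +>\<^bsub>A\<^esub> (x \<otimes>\<^bsub>A\<^esub> y)"
proof (rule rcoset_mult_eqI)
  note sub = diff_image_submodule[OF ideal_submodule[OF J]]
  have c: "x \<in> carrier A" "y \<in> carrier A" using x y by (auto simp: cocycles_def)
  fix a b assume "a \<in> diff A ` J +>\<^bsub>A\<^esub> x" "b \<in> diff A ` J +>\<^bsub>A\<^esub> y"
  then obtain v w where v: "v \<in> J" "a = diff A v \<oplus>\<^bsub>A\<^esub> x" and w: "w \<in> J" "b = diff A w \<oplus>\<^bsub>A\<^esub> y"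
    by (auto simp: mem_coset_iff)
  have vw: "v \<in> carrier A" "w \<in> carrier A"
    using v w submodule_subset[OF ideal_submodule[OF J]] by auto
  then have dv: "diff A v \<in> cocycles A" by (simp add: cocycles_def diff_diff)
  let ?e = "(diff A v \<otimes>\<^bsub>A\<^esub> diff A w \<oplus>\<^bsub>A\<^esub> diff A v \<otimes>\<^bsub>A\<^esub> y) \<oplus>\<^bsub>A\<^esub> x \<otimes>\<^bsub>A\<^esub> diff A w"
  have "?e \<in> diff A ` J"
    using cocycle_mult_boundary[OF J dv w(1)] cocycle_mult_boundary[OF J y v(1)]
      cocycle_mult_boundary[OF J x w(1)] by (intro submodule_add[OF sub])
  moreover have "a \<otimes>\<^bsub>A\<^esub> b = ?e \<oplus>\<^bsub>A\<^esub> x \<otimes>\<^bsub>A\<^esub> y"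
    using c vw by (simp add: v w l_distr r_distr a_ac)
  ultimately show "diff A ` J +>\<^bsub>A\<^esub> (a \<otimes>\<^bsub>A\<^esub> b) = diff A ` J +>\<^bsub>A\<^esub> (x \<otimes>\<^bsub>A\<^esub> y)"
    using c coset_shift[OF sub] by simp
next
  note sub = diff_image_submodule[OF ideal_submodule[OF J]]
  show "diff A ` J +>\<^bsub>A\<^esub> x \<noteq> {}" "diff A ` J +>\<^bsub>A\<^esub> y \<noteq> {}"
    using coset_self[OF sub] x y by (auto simp: cocycles_def)
qed

text \<open>This applies both to the ideal \<open>ker H(\<phi>)\<close> of \<open>H(A)\<close>, with \<open>J = A\<close>, and to \<open>H(K)\<close>, with
  \<open>J = K\<close>: in either case the elements are represented by cocycles of \<open>K\<close>.\<close>

lemma nil_le_if_products_bound: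
  assumes J: "ideal J A"
    and R: "monoid.mult R = rcoset_mult A (diff A ` J)" "add R = set_add A" "\<zero>\<^bsub>R\<^esub> = diff A ` J"
    and I: "I \<subseteq> (\<lambda>x. diff A ` J +>\<^bsub>A\<^esub> x) ` (K \<inter> cocycles A)" "\<zero>\<^bsub>R\<^esub> \<in> I"
    and bound: "cocycle_products A K (m + 1) \<subseteq> diff A ` J"
  shows "nil R I \<le> enat m"
proof -
  let ?N = "diff A ` J"
  note sub = diff_image_submodule[OF ideal_submodule[OF J]]
  have Zc: "x \<in> carrier A" if "x \<in> cocycles A" for x
    using that by (simp add: cocycles_def)
  have powers: "ideal_power R I (Suc n) \<subseteq> (\<lambda>x. ?N +>\<^bsub>A\<^esub> x) ` cocycle_products A K (Suc n)" for n
  proof (induction n)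
    case 0
    then show ?case using I(1) cocycle_products_1 by auto
  next
    case (Suc n)
    show ?case
    proof
      fix U assume "U \<in> ideal_power R I (Suc (Suc n))"
      then have "U \<in> ideal_prod R (ideal_power R I (Suc n)) I" by simp
      then show "U \<in> (\<lambda>x. ?N +>\<^bsub>A\<^esub> x) ` cocycle_products A K (Suc (Suc n))"
      proof induction
        case (prod i j)
        obtain x where x: "x \<in> cocycle_products A K (Suc n)" "i = ?N +>\<^bsub>A\<^esub> x"
          using prod(1) Suc.IH by blast
        obtain y where y: "y \<in> K \<inter> cocycles A" "j = ?N +>\<^bsub>A\<^esub> y"
          using prod(2) I(1) by blast
        have "x \<otimes>\<^bsub>A\<^esub> y \<in> cocycle_products A K (Suc (Suc n))"
          using cocycle_products_mult[OF x(1) cocycle_products_1[OF y(1)]] by simp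
        moreover have "i \<otimes>\<^bsub>R\<^esub> j = ?N +>\<^bsub>A\<^esub> (x \<otimes>\<^bsub>A\<^esub> y)"
          using coset_mult_cocycles[OF J, of x y] x y cocycle_products_subset by (auto simp: R)
        ultimately show ?case by blast
      next
        case (sum s t)
        then obtain x y where xy: "x \<in> cocycle_products A K (Suc (Suc n))" "s = ?N +>\<^bsub>A\<^esub> x"
          "y \<in> cocycle_products A K (Suc (Suc n))" "t = ?N +>\<^bsub>A\<^esub> y" by blast
        then have "x \<in> carrier A" "y \<in> carrier A"
          using submodule_subset[OF cocycle_products_submodule] by blast+
        then have "s \<oplus>\<^bsub>R\<^esub> t = ?N +>\<^bsub>A\<^esub> (x \<oplus>\<^bsub>A\<^esub> y)"
          using xy coset_add[OF sub] by (simp add: R)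
        then show ?case
          using submodule_add[OF cocycle_products_submodule xy(1,3)] by blast
      qed
    qed
  qed
  have zero: "\<zero>\<^bsub>R\<^esub> \<in> ideal_power R I (Suc n)" for n
  proof (induction n)
    case (Suc n)
    have "\<zero>\<^bsub>A\<^esub> \<in> cocycles A" by (simp add: cocycles_def)
    then have "\<zero>\<^bsub>R\<^esub> \<otimes>\<^bsub>R\<^esub> \<zero>\<^bsub>R\<^esub> = \<zero>\<^bsub>R\<^esub>"
      using coset_mult_cocycles[OF J, of "\<zero>\<^bsub>A\<^esub>" "\<zero>\<^bsub>A\<^esub>"] coset_zero[OF sub] by (simp add: R)
    then show ?case
      using ideal_prod.prod[OF Suc I(2), where R = R] by simp
  qed (simp add: I(2))
  have "?N +>\<^bsub>A\<^esub> x = \<zero>\<^bsub>R\<^esub>" if "x \<in> cocycle_products A K (Suc m)" for x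
    using that bound coset_eq_zero_iff[OF sub, of x] submodule_subset[OF sub] by (auto simp: R)
  then have "ideal_power R I (m + 1) = {\<zero>\<^bsub>R\<^esub>}"
    using powers[of m] zero[of m] by auto
  then show ?thesis
    unfolding nil_def by (intro Inf_lower) blast
qed

end

section \<open>The lower bounds\<close>

lemma cohomology_map_coset:
  assumes A: "cdga A" and B: "cdga B" and \<phi>: "\<phi> \<in> cdga_hom A B" and x: "x \<in> carrier A"
  shows "cohomology_map A B \<phi> (boundaries A +>\<^bsub>A\<^esub> x) = boundaries B +>\<^bsub>B\<^esub> \<phi> x"
proof -
  interpret A: cdga A by fact
  interpret B: cdga B by fact
  show ?thesis
    unfolding cohomology_map_def
  proof (rule A.on_cosets_eq[OF A.boundaries_submodule x])
    fix n assume "n \<in> boundaries A"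
    then obtain w where w: "w \<in> carrier A" "n = diff A w" by (auto simp: boundaries_def)
    then have "\<phi> n \<in> boundaries B"
      using cdga_hom_diff[OF \<phi>] cdga_hom_carrier[OF \<phi>] by (auto simp: boundaries_def)
    then show "boundaries B +>\<^bsub>B\<^esub> \<phi> (n \<oplus>\<^bsub>A\<^esub> x) = boundaries B +>\<^bsub>B\<^esub> \<phi> x"
      using w x cdga_hom_carrier[OF \<phi> x] B.coset_shift[OF B.boundaries_submodule]
      by (simp add: cdga_hom_add[OF \<phi>])
  qed
qed

context
  fixes A :: "'a dga" and B :: "'b dga" and \<phi> K
  assumes A: "cdga A" and B: "cdga B" and \<phi>: "\<phi> \<in> cdga_hom A B" and onto: "\<phi> ` carrier A = carrier B"
    and K_def: "K = a_kernel A B \<phi>"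
begin

interpretation A: cdga A by (rule A)
interpretation B: cdga B by (rule B)

lemma kernel_differential_ideal: "differential_ideal A K"
  unfolding K_def by (rule differential_ideal_kernel[OF A B \<phi>])

lemma hom_minus: "x \<in> carrier A \<Longrightarrow> \<phi> (\<ominus>\<^bsub>A\<^esub> x) = \<ominus>\<^bsub>B\<^esub> \<phi> x"
  using cdga_hom_smult[OF \<phi>, of x "-1"] cdga_hom_carrier[OF \<phi>] by (simp add: A.smult_minus_1 B.smult_minus_1)

text \<open>As \<open>\<phi>\<close> is onto, a primitive of \<open>\<phi> x\<close> lifts to some \<open>c\<close> in \<open>A\<close>.\<close>

lemma correct_into_kernel:
  assumes x: "x \<in> carrier A" and "\<phi> x \<in> boundaries B"
  obtains c where "c \<in> carrier A" "x \<ominus>\<^bsub>A\<^esub> diff A c \<in> K"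
proof -
  from assms(2) obtain b where b: "b \<in> carrier B" "\<phi> x = diff B b" by (auto simp: boundaries_def)
  then obtain c where c: "c \<in> carrier A" "b = \<phi> c" using onto by (metis imageE)
  have "\<phi> (x \<ominus>\<^bsub>A\<^esub> diff A c) = \<phi> x \<ominus>\<^bsub>B\<^esub> diff B (\<phi> c)"
    using x c by (simp add: a_minus_def cdga_hom_add[OF \<phi>] hom_minus cdga_hom_diff[OF \<phi>])
  also have "\<dots> = \<zero>\<^bsub>B\<^esub>"
    using b c by (simp add: a_minus_def B.r_neg)
  finally show thesis
    using x c by (intro that[of c]) (auto simp: K_def a_kernel_def')
qed

lemma cohomology_kernel_representatives:
  "a_kernel (cohomology A) (cohomology B) (cohomology_map A B \<phi>)
    \<subseteq> (\<lambda>x. boundaries A +>\<^bsub>A\<^esub> x) ` (K \<inter> cocycles A)"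
proof
  fix U assume U: "U \<in> a_kernel (cohomology A) (cohomology B) (cohomology_map A B \<phi>)"
  then obtain x where x: "x \<in> cocycles A" "U = boundaries A +>\<^bsub>A\<^esub> x"
    by (auto simp: a_kernel_def')
  then have xc: "x \<in> carrier A" "diff A x = \<zero>\<^bsub>A\<^esub>" by (auto simp: cocycles_def)
  have "boundaries B +>\<^bsub>B\<^esub> \<phi> x = boundaries B"
    using U x cohomology_map_coset[OF A B \<phi> xc(1)] by (simp add: a_kernel_def')
  then have "\<phi> x \<in> boundaries B"
    using B.coset_eq_zero_iff[OF B.boundaries_submodule cdga_hom_carrier[OF \<phi> xc(1)]] by simp
  then obtain c where c: "c \<in> carrier A" "x \<ominus>\<^bsub>A\<^esub> diff A c \<in> K"
    by (rule correct_into_kernel[OF xc(1)])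
  have "x \<ominus>\<^bsub>A\<^esub> diff A c \<in> cocycles A"
    using xc c by (simp add: cocycles_def a_minus_def A.diff_add A.diff_minus A.diff_diff)
  moreover have "\<ominus>\<^bsub>A\<^esub> diff A c \<in> boundaries A"
    using c A.submodule_minus[OF A.boundaries_submodule] by (auto simp: boundaries_def)
  then have "boundaries A +>\<^bsub>A\<^esub> (x \<ominus>\<^bsub>A\<^esub> diff A c) = U"
    using xc c A.coset_shift[OF A.boundaries_submodule, of "\<ominus>\<^bsub>A\<^esub> diff A c" x]
    by (simp add: x a_minus_def A.a_comm)
  ultimately show "U \<in> (\<lambda>x. boundaries A +>\<^bsub>A\<^esub> x) ` (K \<inter> cocycles A)"
    using c by blast
qed

text \<open>Let \<open>x = d a\<close>.  Then \<open>\<phi> a\<close> is a cocycle, hence cohomologous to \<open>\<phi> z\<close> for a cocycle \<open>z\<close>, and \<open>a - z\<close>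
  can be corrected by a boundary so that it lies in \<open>K\<close>; its differential is still \<open>x\<close>.\<close>

lemma kernel_boundary:
  assumes H: "cohomology_map A B \<phi> ` carrier (cohomology A) = carrier (cohomology B)"
    and x: "x \<in> K" "x \<in> boundaries A"
  shows "x \<in> diff A ` K"
proof -
  from x obtain a where a: "a \<in> carrier A" "x = diff A a" by (auto simp: boundaries_def)
  then have "\<phi> a \<in> cocycles B"
    using x cdga_hom_diff[OF \<phi> a(1)] cdga_hom_carrier[OF \<phi>] by (simp add: cocycles_def K_def a_kernel_def')
  then have "boundaries B +>\<^bsub>B\<^esub> \<phi> a \<in> cohomology_map A B \<phi> ` carrier (cohomology A)"
    unfolding H by simp
  then obtain z where z: "z \<in> carrier A" "diff A z = \<zero>\<^bsub>A\<^esub>"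
    "boundaries B +>\<^bsub>B\<^esub> \<phi> a = boundaries B +>\<^bsub>B\<^esub> \<phi> z"
    using cohomology_map_coset[OF A B \<phi>] by (auto simp: cocycles_def)
  have "\<phi> (a \<ominus>\<^bsub>A\<^esub> z) \<in> boundaries B"
    using z a B.coset_eq_iff[OF B.boundaries_submodule, of "\<phi> a" "\<phi> z"] cdga_hom_carrier[OF \<phi>]
    by (simp add: a_minus_def cdga_hom_add[OF \<phi>] hom_minus)
  then obtain c where c: "c \<in> carrier A" "(a \<ominus>\<^bsub>A\<^esub> z) \<ominus>\<^bsub>A\<^esub> diff A c \<in> K"
    using correct_into_kernel[of "a \<ominus>\<^bsub>A\<^esub> z"] a z by auto
  have "diff A ((a \<ominus>\<^bsub>A\<^esub> z) \<ominus>\<^bsub>A\<^esub> diff A c) = x"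
    using a z c by (simp add: a_minus_def A.diff_add A.diff_minus A.diff_diff)
  then show ?thesis
    using c(2) by (metis image_eqI)
qed

end

section \<open>The chain of inequalities\<close>

theorem proposition21:
  fixes A :: "'a dga" and B :: "'b dga" and \<phi> :: "'a \<Rightarrow> 'b" and K :: "'a set"
  assumes "cdga A" and "cdga B" and "\<phi> \<in> cdga_hom A B" and "\<phi> ` carrier A = carrier B"
    and K: "K = a_kernel A B \<phi>"
    and secat_models: "\<And>m. has_relative_sullivan_model TYPE('w)
      (tensor_power A (m + 1)) (secat_quot A K m) (secat_proj A K m)"
    and Asecat_models: "\<And>m. has_relative_sullivan_model TYPE('v)
      A (Asecat_quot A K m) (Asecat_proj A K m)"
  shows "(nil (cohomology A) (a_kernel (cohomology A) (cohomology B) (cohomology_map A B \<phi>))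
          \<le> secat TYPE('w) A B \<phi> \<and>
        secat TYPE('w) A B \<phi> \<le> Asecat TYPE('v) A B \<phi> \<and>
        Asecat TYPE('v) A B \<phi> \<le> hnil A K \<and>
        hnil A K \<le> nil A K) \<and>
    (cohomology_map A B \<phi> ` carrier (cohomology A) = carrier (cohomology B) \<longrightarrow>
        nil (cohomology (restrict_to A K)) (carrier (cohomology (restrict_to A K)))
          \<le> secat TYPE('w) A B \<phi> \<and>
        secat TYPE('w) A B \<phi> \<le> hnil A K)"
proof -
  note A = assms(1) and B = assms(2) and \<phi> = assms(3) and onto = assms(4)
  interpret A: cdga A by (rule A)
  interpret B: cdga B by (rule B)
  note diff_K = kernel_differential_ideal[OF A B \<phi> onto K]
  note ideal_K = differential_idealD(1)[OF diff_K]

  have hnil_nil: "hnil A K \<le> nil A K"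
    unfolding hnil_def nil_def
    by (intro Inf_superset_mono) (use A.acyclic_zero in fastforce)

  have Asecat_hnil: "Asecat TYPE('v) A B \<phi> \<le> hnil A K"
    unfolding hnil_def Asecat_def K[symmetric]
    using homotopy_retraction_if_power_acyclic[OF A diff_K Asecat_models]
    by (intro Inf_superset_mono) blast

  have secat_Asecat: "secat TYPE('w) A B \<phi> \<le> Asecat TYPE('v) A B \<phi>"
    unfolding secat_def Asecat_def K[symmetric]
    using secat_condition_if_homotopy_retraction[OF A diff_K secat_models]
    by (intro Inf_superset_mono) blast

  have secat_greatest: "n \<le> secat TYPE('w) A B \<phi>"
    if bound: "\<And>m. cocycle_products A K (m + 1) \<subseteq> boundaries A \<Longrightarrow> n \<le> enat m" for n
    unfolding secat_def K[symmetric]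
  proof (rule Inf_greatest, elim CollectE exE conjE bexE)
    fix x m and W :: "'w graded" and D \<pi> \<tau>
    assume x: "x = enat m"
      and model: "relative_sullivan_model (tensor_power A (m + 1)) (secat_quot A K m) (secat_proj A K m) W D \<pi>"
      and \<tau>: "\<tau> \<in> cdga_hom (ext_dga (tensor_power A (m + 1)) W D) A"
        "\<forall>x\<in>carrier (tensor_power A (m + 1)).
          \<tau> (ext_incl (tensor_power A (m + 1)) W x) = tensor_mult A x"
    have "A.letter_prod u \<in> boundaries A"
      if "u \<in> tensor_words A (m + 1)" "\<forall>(p, a)\<in>set u. a \<in> K \<inter> cocycles A" for u
      by (rule letter_prod_boundary[OF A diff_K model \<tau>(1)]) (use \<tau>(2) that in auto)
    then have "cocycle_products A K (m + 1) \<subseteq> boundaries A"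
      unfolding cocycle_products_def by (intro A.lin_span_least[OF A.boundaries_submodule]) blast
    then show "n \<le> x"
      unfolding x by (rule bound)
  qed

  have lower: "nil (cohomology A) (a_kernel (cohomology A) (cohomology B) (cohomology_map A B \<phi>))
    \<le> secat TYPE('w) A B \<phi>"
  proof (rule secat_greatest)
    fix m assume products: "cocycle_products A K (m + 1) \<subseteq> boundaries A"
    have "ideal (carrier A) A" by (rule A.oneideal)
    then show "nil (cohomology A) (a_kernel (cohomology A) (cohomology B) (cohomology_map A B \<phi>)) \<le> enat m"
    proof (rule nil_le_if_products_bound[OF A diff_K])
      show "monoid.mult (cohomology A) = rcoset_mult A (diff A ` carrier A)"
        "add (cohomology A) = set_add A" "\<zero>\<^bsub>cohomology A\<^esub> = diff A ` carrier A"
        by (simp_all add: boundaries_def)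
      show "a_kernel (cohomology A) (cohomology B) (cohomology_map A B \<phi>)
          \<subseteq> (\<lambda>x. diff A ` carrier A +>\<^bsub>A\<^esub> x) ` (K \<inter> cocycles A)"
        using cohomology_kernel_representatives[OF A B \<phi> onto K] by (simp add: boundaries_def)
      have zero: "boundaries A +>\<^bsub>A\<^esub> \<zero>\<^bsub>A\<^esub> = \<zero>\<^bsub>cohomology A\<^esub>"
        using A.coset_zero[OF A.boundaries_submodule] by simp
      have "cohomology_map A B \<phi> \<zero>\<^bsub>cohomology A\<^esub> = \<zero>\<^bsub>cohomology B\<^esub>"
        unfolding zero[symmetric] cohomology_map_coset[OF A B \<phi> A.zero_closed]
        using B.coset_zero[OF B.boundaries_submodule] cdga_hom_zero[OF A B \<phi>] by simp
      moreover have "\<zero>\<^bsub>cohomology A\<^esub> \<in> carrier (cohomology A)"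
        unfolding zero[symmetric] using A.submodule_zero[OF A.cocycles_submodule] by simp
      ultimately show "\<zero>\<^bsub>cohomology A\<^esub> \<in> a_kernel (cohomology A) (cohomology B) (cohomology_map A B \<phi>)"
        unfolding a_kernel_def' by blast
      show "cocycle_products A K (m + 1) \<subseteq> diff A ` carrier A"
        using products by (simp add: boundaries_def)
    qed
  qed

  have lower': "nil (cohomology (restrict_to A K)) (carrier (cohomology (restrict_to A K)))
    \<le> secat TYPE('w) A B \<phi>"
    if H: "cohomology_map A B \<phi> ` carrier (cohomology A) = carrier (cohomology B)"
  proof (rule secat_greatest)
    fix m assume products: "cocycle_products A K (m + 1) \<subseteq> boundaries A"
    have K_subset: "K \<subseteq> carrier A"
      by (rule A.submodule_subset[OF A.ideal_submodule[OF ideal_K]])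
    have bd: "boundaries (restrict_to A K) = diff A ` K"
      by (simp add: boundaries_def)
    have coc: "cocycles (restrict_to A K) = K \<inter> cocycles A"
      using K_subset by (auto simp: cocycles_def)
    show "nil (cohomology (restrict_to A K)) (carrier (cohomology (restrict_to A K))) \<le> enat m"
    proof (rule nil_le_if_products_bound[OF A diff_K ideal_K])
      show "monoid.mult (cohomology (restrict_to A K)) = rcoset_mult A (diff A ` K)"
        "add (cohomology (restrict_to A K)) = set_add A" "\<zero>\<^bsub>cohomology (restrict_to A K)\<^esub> = diff A ` K"
        by (simp_all add: bd)
      show "carrier (cohomology (restrict_to A K)) \<subseteq> (\<lambda>x. diff A ` K +>\<^bsub>A\<^esub> x) ` (K \<inter> cocycles A)"
        by (simp add: bd coc)
      have "diff A ` K = diff A ` K +>\<^bsub>A\<^esub> \<zero>\<^bsub>A\<^esub>"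
        using A.coset_zero[OF A.diff_image_submodule[OF A.ideal_submodule[OF ideal_K]]] by simp
      moreover have "\<zero>\<^bsub>A\<^esub> \<in> K \<inter> cocycles A"
        using A.submodule_zero kernel_cocycles_submodule[OF A diff_K] by blast
      ultimately show "\<zero>\<^bsub>cohomology (restrict_to A K)\<^esub> \<in> carrier (cohomology (restrict_to A K))"
        by (auto simp: bd coc)
      show "cocycle_products A K (m + 1) \<subseteq> diff A ` K"
        using products cocycle_products_subset[OF A diff_K, of m] kernel_boundary[OF A B \<phi> onto K H]
        by auto
    qed
  qed

  show ?thesis
    using lower lower' secat_Asecat Asecat_hnil hnil_nil order_trans[OF secat_Asecat Asecat_hnil]
    by blast
qed

end
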